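(* Let $\mathcal G$ be a topological $2$-group and $X$ a topological space. The map $\Gamma\colon\check H(X,\mathcal G)\to\mathcal P(X,\mathcal G)$ defined below is surjective. Moreover, if $X$ admits good covers, then $\Gamma$ is bijective.
   Context: Topological $2$-group $\mathcal G=(\mathcal G_1\rightrightarrows\mathcal G_0)$, $\mathcal E=\mathrm{Ker}(s)$, ${}^xe=1_xe1_{x^{-1}}$. For an open cover $\mathcal U=\{U_i\}$ of $X$, a $\mathcal G$-valued Čech cocycle is $c=(\mathbf x,\mathbf e)$, $\mathbf x_{ij}\colon U_i\cap U_j\to\mathcal G_0$, $\mathbf e_{ijk}\colon U_i\cap U_j\cap U_k\to\mathcal E$ continuous with $t(\mathbf e_{ijk})\mathbf x_{ij}\mathbf x_{jk}=\mathbf x_{ik}$, $\mathbf e_{ikl}\mathbf e_{ijk}=\mathbf e_{ijl}\,{}^{\mathbf x_{ij}}\mathbf e_{jkl}$; two are cohomologous if there are continuous $a_i\colon U_i\to\mathcal G_0$, $d_{ij}\colon U_i\cap U_j\to\mathcal E$ with $\mathbf x'_{ij}=a_it(d_{ij})\mathbf x_{ij}a_j^{-1}$, $\mathbf e'_{ijk}={}^{a_i}(d_{ik}\mathbf e_{ijk}\,{}^{\mathbf x_{ij}}(d_{jk}^{-1})d_{ij}^{-1})$. $\check H(\mathcal U,\mathcal G)$ is the set of classes and $\check H(X,\mathcal G)=\varinjlim_{\mathcal U}\check H(\mathcal U,\mathcal G)$ over open covers with restriction maps, with cocone maps $\kappa_{\mathcal U}$. $\mathcal P(X,\mathcal G)$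 is the set of equivalence classes of principal $\mathcal G$-bundles over $X$ (continuous functors $\pi\colon P\to\overline X$ from $\mathcal G$-$2$-spaces admitting an atlas of trivializing charts, i.e. $\mathcal G$-equivalences $P|_{U_i}\simeq\overline{U_i}\times\mathcal G$ over $\overline{U_i}$ with $\mathcal G_0$-equivariant natural isomorphisms), where $\pi,\pi'$ are equivalent if there is a principal $\mathcal G$-bundle $\tilde\pi$ and $\mathcal G$-bundle morphisms ($\mathcal G$-equivariant continuous functors commuting with projections) $\tilde\pi\to\pi$, $\tilde\pi\to\pi'$. To a cocycle $c$ corresponds the principal bundle $\pi_c\colon P_c\to\overline X$ with objects $(u,x)_i\in\coprod U_i\times\mathcal G_0$, morphisms $(v,g)_{ij}\in\coprod(U_i\cap U_j)\times\mathcal G_1$, $s((v,g)_{ij})=(v,s(g))_i$, $t((v,g)_{ij})=(v,\mathbf x_{ij}(v)^{-1}t(g))_j$, product $(v,g)_{ij}*(v,h)_{jk}=(v,\mathbf e_{ijk}(v)(g*(1_{\mathbf x_{ij}(v)}h)))_{ik}$ ($g*h=h1_{t(g)^{-1}}g$), right multiplication action, projection to $X$. The maps $\check H(\mathcal U,\mathcal G)\to\mathcal P(X,\mathcal G)$, $[c]\mapsto[\pi_c]$, are well defined and compatible with restriction, and $\Gamma$ is the unique map with $\Gamma\circ\kappa_{\mathcal U}([c])=[\pi_c]$ for all $\mathcal U$ and $c$. $X$ admits good covers if every open cover has a refinement by an open cover all of whose nonempty finite intersections are contractible. *)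

theory Defs
  imports "HOL-Analysis.Analysis"
begin

definition top_group_on :: "'a topology \<Rightarrow> ('a \<Rightarrow> 'a \<Rightarrow> 'a) \<Rightarrow> 'a \<Rightarrow> ('a \<Rightarrow> 'a) \<Rightarrow> bool" where
  "top_group_on T m e i \<longleftrightarrow>
     e \<in> topspace T \<and>
     (\<forall>x\<in>topspace T. \<forall>y\<in>topspace T. m x y \<in> topspace T) \<and>
     (\<forall>x\<in>topspace T. i x \<in> topspace T) \<and>
     (\<forall>x\<in>topspace T. \<forall>y\<in>topspace T. \<forall>z\<in>topspace T. m (m x y) z = m x (m y z)) \<and>
     (\<forall>x\<in>topspace T. m e x = x \<and> m x e = x) \<and>
     (\<forall>x\<in>topspace T. m (i x) x = e \<and> m x (i x) = e) \<and>
     continuous_map (prod_topology T T) T (\<lambda>(x, y). m x y) \<and>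
     continuous_map T T i"

definition composable_pairs :: "'o topology \<Rightarrow> 'm topology \<Rightarrow> ('m \<Rightarrow> 'o) \<Rightarrow> ('m \<Rightarrow> 'o) \<Rightarrow> ('m \<times> 'm) set" where
  "composable_pairs T0 T1 s t = {(f, g). f \<in> topspace T1 \<and> g \<in> topspace T1 \<and> t f = s g}"

definition top_category :: "'o topology \<Rightarrow> 'm topology \<Rightarrow> ('m \<Rightarrow> 'o) \<Rightarrow> ('m \<Rightarrow> 'o) \<Rightarrow> ('o \<Rightarrow> 'm)
    \<Rightarrow> ('m \<Rightarrow> 'm \<Rightarrow> 'm) \<Rightarrow> bool" where
  "top_category T0 T1 s t u c \<longleftrightarrow>
     continuous_map T1 T0 s \<and> continuous_map T1 T0 t \<and> continuous_map T0 T1 u \<and>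
     (\<forall>x\<in>topspace T0. s (u x) = x \<and> t (u x) = x) \<and>
     (\<forall>f\<in>topspace T1. \<forall>g\<in>topspace T1. t f = s g \<longrightarrow>
         c f g \<in> topspace T1 \<and> s (c f g) = s f \<and> t (c f g) = t g) \<and>
     (\<forall>f\<in>topspace T1. c (u (s f)) f = f \<and> c f (u (t f)) = f) \<and>
     (\<forall>f\<in>topspace T1. \<forall>g\<in>topspace T1. \<forall>h\<in>topspace T1. t f = s g \<longrightarrow> t g = s h \<longrightarrow>
         c (c f g) h = c f (c g h)) \<and>
     continuous_map (subtopology (prod_topology T1 T1) (composable_pairs T0 T1 s t)) T1
       (\<lambda>(f, g). c f g)"

text \<open>A topological 2-group: a group object in topological categories, i.e. groups
  G_0 (objects) and G_1 (morphisms) such that source, target, identity and composition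
  are continuous group homomorphisms and the category axioms hold.\<close>
record ('a, 'b) two_group =
  G0 :: "'a topology"
  mult0 :: "'a \<Rightarrow> 'a \<Rightarrow> 'a"
  one0 :: 'a
  inv0 :: "'a \<Rightarrow> 'a"
  G1 :: "'b topology"
  mult1 :: "'b \<Rightarrow> 'b \<Rightarrow> 'b"
  one1 :: 'b
  inv1 :: "'b \<Rightarrow> 'b"
  src :: "'b \<Rightarrow> 'a"
  tgt :: "'b \<Rightarrow> 'a"
  ident :: "'a \<Rightarrow> 'b"
  gcomp :: "'b \<Rightarrow> 'b \<Rightarrow> 'b"   \<comment> \<open>g * h, defined when tgt g = src h\<close>

definition top_2group :: "('a, 'b) two_group \<Rightarrow> bool" where
  "top_2group G \<longleftrightarrow>
     top_group_on (G0 G) (mult0 G) (one0 G) (inv0 G) \<and>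
     top_group_on (G1 G) (mult1 G) (one1 G) (inv1 G) \<and>
     top_category (G0 G) (G1 G) (src G) (tgt G) (ident G) (gcomp G) \<and>
     (\<forall>g\<in>topspace (G1 G). \<forall>h\<in>topspace (G1 G).
        src G (mult1 G g h) = mult0 G (src G g) (src G h) \<and>
        tgt G (mult1 G g h) = mult0 G (tgt G g) (tgt G h)) \<and>
     (\<forall>x\<in>topspace (G0 G). \<forall>y\<in>topspace (G0 G).
        ident G (mult0 G x y) = mult1 G (ident G x) (ident G y)) \<and>
     (\<forall>g1\<in>topspace (G1 G). \<forall>g2\<in>topspace (G1 G). \<forall>h1\<in>topspace (G1 G). \<forall>h2\<in>topspace (G1 G).
        tgt G g1 = src G h1 \<longrightarrow> tgt G g2 = src G h2 \<longrightarrow>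
        gcomp G (mult1 G g1 g2) (mult1 G h1 h2) = mult1 G (gcomp G g1 h1) (gcomp G g2 h2))"

definition kerE :: "('a, 'b) two_group \<Rightarrow> 'b set" where
  "kerE G = {e \<in> topspace (G1 G). src G e = one0 G}"

definition E_top :: "('a, 'b) two_group \<Rightarrow> 'b topology" where
  "E_top G = subtopology (G1 G) (kerE G)"

definition conjE :: "('a, 'b) two_group \<Rightarrow> 'a \<Rightarrow> 'b \<Rightarrow> 'b" where
  "conjE G x e = mult1 G (mult1 G (ident G x) e) (ident G (inv0 G x))"

text \<open>Open covers are taken as sets of open subsets, indexed by themselves.\<close>
definition open_cover :: "'x topology \<Rightarrow> 'x set set \<Rightarrow> bool" where
  "open_cover X \<U> \<longleftrightarrow> (\<forall>U\<in>\<U>. openin X U) \<and> \<Union>\<U> = topspace X"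

type_synonym ('x, 'a, 'b) cech_cochain =
  "('x set \<Rightarrow> 'x set \<Rightarrow> 'x \<Rightarrow> 'a) \<times> ('x set \<Rightarrow> 'x set \<Rightarrow> 'x set \<Rightarrow> 'x \<Rightarrow> 'b)"

definition cech_cocycle :: "('a, 'b) two_group \<Rightarrow> 'x topology \<Rightarrow> 'x set set \<Rightarrow> ('x, 'a, 'b) cech_cochain \<Rightarrow> bool" where
  "cech_cocycle G X \<U> c \<longleftrightarrow> (case c of (xx, ee) \<Rightarrow>
     (\<forall>i\<in>\<U>. \<forall>j\<in>\<U>. continuous_map (subtopology X (i \<inter> j)) (G0 G) (xx i j)) \<and>
     (\<forall>i\<in>\<U>. \<forall>j\<in>\<U>. \<forall>k\<in>\<U>. continuous_map (subtopology X (i \<inter> j \<inter> k)) (E_top G) (ee i j k)) \<and>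
     (\<forall>i\<in>\<U>. \<forall>j\<in>\<U>. \<forall>k\<in>\<U>. \<forall>v\<in>topspace X \<inter> i \<inter> j \<inter> k.
        mult0 G (mult0 G (tgt G (ee i j k v)) (xx i j v)) (xx j k v) = xx i k v) \<and>
     (\<forall>i\<in>\<U>. \<forall>j\<in>\<U>. \<forall>k\<in>\<U>. \<forall>l\<in>\<U>. \<forall>v\<in>topspace X \<inter> i \<inter> j \<inter> k \<inter> l.
        mult1 G (ee i k l v) (ee i j k v) = mult1 G (ee i j l v) (conjE G (xx i j v) (ee j k l v))))"

definition cohomologous :: "('a, 'b) two_group \<Rightarrow> 'x topology \<Rightarrow> 'x set set
    \<Rightarrow> ('x, 'a, 'b) cech_cochain \<Rightarrow> ('x, 'a, 'b) cech_cochain \<Rightarrow> bool" where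
  "cohomologous G X \<U> c c' \<longleftrightarrow> (case c of (xx, ee) \<Rightarrow> case c' of (xx', ee') \<Rightarrow>
     (\<exists>(a :: 'x set \<Rightarrow> 'x \<Rightarrow> 'a) (d :: 'x set \<Rightarrow> 'x set \<Rightarrow> 'x \<Rightarrow> 'b).
       (\<forall>i\<in>\<U>. continuous_map (subtopology X i) (G0 G) (a i)) \<and>
       (\<forall>i\<in>\<U>. \<forall>j\<in>\<U>. continuous_map (subtopology X (i \<inter> j)) (E_top G) (d i j)) \<and>
       (\<forall>i\<in>\<U>. \<forall>j\<in>\<U>. \<forall>v\<in>topspace X \<inter> i \<inter> j.
          xx' i j v = mult0 G (mult0 G (mult0 G (a i v) (tgt G (d i j v))) (xx i j v)) (inv0 G (a j v))) \<and>
       (\<forall>i\<in>\<U>. \<forall>j\<in>\<U>. \<forall>k\<in>\<U>. \<forall>v\<in>topspace X \<inter> i \<inter> j \<inter> k.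
          ee' i j k v = conjE G (a i v)
            (mult1 G (mult1 G (mult1 G (d i k v) (ee i j k v))
                (conjE G (xx i j v) (inv1 G (d j k v)))) (inv1 G (d i j v))))))"

definition restrict_cochain :: "('x set \<Rightarrow> 'x set) \<Rightarrow> ('x, 'a, 'b) cech_cochain \<Rightarrow> ('x, 'a, 'b) cech_cochain" where
  "restrict_cochain r c = (case c of (xx, ee) \<Rightarrow>
     (\<lambda>i j. xx (r i) (r j), \<lambda>i j k. ee (r i) (r j) (r k)))"

definition refinement_map :: "'x set set \<Rightarrow> 'x set set \<Rightarrow> ('x set \<Rightarrow> 'x set) \<Rightarrow> bool" where
  "refinement_map \<V> \<U> r \<longleftrightarrow> (\<forall>V\<in>\<V>. r V \<in> \<U> \<and> V \<subseteq> r V)"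

text \<open>Equality in the direct limit  H(X,G) = colim_\<U> H(\<U>,G) of the classes
  \<kappa>_\<U>[c] and \<kappa>_\<U>'[c']: they become cohomologous on a common refinement.\<close>
definition cech_colim_eq :: "('a, 'b) two_group \<Rightarrow> 'x topology
    \<Rightarrow> 'x set set \<Rightarrow> ('x, 'a, 'b) cech_cochain \<Rightarrow> 'x set set \<Rightarrow> ('x, 'a, 'b) cech_cochain \<Rightarrow> bool" where
  "cech_colim_eq G X \<U> c \<U>' c' \<longleftrightarrow>
     (\<exists>\<V> r r'. open_cover X \<V> \<and> refinement_map \<V> \<U> r \<and> refinement_map \<V> \<U>' r' \<and>
        cohomologous G X \<V> (restrict_cochain r c) (restrict_cochain r' c'))"

record ('p0, 'p1, 'a, 'b) two_space =
  ob_top :: "'p0 topology"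
  mor_top :: "'p1 topology"
  dom :: "'p1 \<Rightarrow> 'p0"
  cod :: "'p1 \<Rightarrow> 'p0"
  idm :: "'p0 \<Rightarrow> 'p1"
  cmp :: "'p1 \<Rightarrow> 'p1 \<Rightarrow> 'p1"   \<comment> \<open>diagrammatic order, cod f = dom g\<close>
  act0 :: "'p0 \<Rightarrow> 'a \<Rightarrow> 'p0"
  act1 :: "'p1 \<Rightarrow> 'b \<Rightarrow> 'p1"

definition G_2space :: "('a, 'b) two_group \<Rightarrow> ('p0, 'p1, 'a, 'b) two_space \<Rightarrow> bool" where
  "G_2space G P \<longleftrightarrow>
     top_category (ob_top P) (mor_top P) (dom P) (cod P) (idm P) (cmp P) \<and>
     continuous_map (prod_topology (ob_top P) (G0 G)) (ob_top P) (\<lambda>(p, x). act0 P p x) \<and>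
     continuous_map (prod_topology (mor_top P) (G1 G)) (mor_top P) (\<lambda>(f, g). act1 P f g) \<and>
     (\<forall>f\<in>topspace (mor_top P). \<forall>g\<in>topspace (G1 G).
        dom P (act1 P f g) = act0 P (dom P f) (src G g) \<and>
        cod P (act1 P f g) = act0 P (cod P f) (tgt G g)) \<and>
     (\<forall>p\<in>topspace (ob_top P). \<forall>x\<in>topspace (G0 G). act1 P (idm P p) (ident G x) = idm P (act0 P p x)) \<and>
     (\<forall>f1\<in>topspace (mor_top P). \<forall>f2\<in>topspace (mor_top P). \<forall>g1\<in>topspace (G1 G). \<forall>g2\<in>topspace (G1 G).
        cod P f1 = dom P f2 \<longrightarrow> tgt G g1 = src G g2 \<longrightarrow>
        act1 P (cmp P f1 f2) (gcomp G g1 g2) = cmp P (act1 P f1 g1) (act1 P f2 g2)) \<and>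
     (\<forall>p\<in>topspace (ob_top P). act0 P p (one0 G) = p) \<and>
     (\<forall>p\<in>topspace (ob_top P). \<forall>x\<in>topspace (G0 G). \<forall>y\<in>topspace (G0 G).
        act0 P (act0 P p x) y = act0 P p (mult0 G x y)) \<and>
     (\<forall>f\<in>topspace (mor_top P). act1 P f (one1 G) = f) \<and>
     (\<forall>f\<in>topspace (mor_top P). \<forall>g\<in>topspace (G1 G). \<forall>h\<in>topspace (G1 G).
        act1 P (act1 P f g) h = act1 P f (mult1 G g h))"

text \<open>A continuous functor pi : P \<rightarrow> Xbar to the discrete category on X, given by its object map.\<close>
definition functor_to_discrete :: "'x topology \<Rightarrow> ('p0, 'p1, 'a, 'b) two_space \<Rightarrow> ('p0 \<Rightarrow> 'x) \<Rightarrow> bool" where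
  "functor_to_discrete X P \<pi> \<longleftrightarrow> continuous_map (ob_top P) X \<pi> \<and>
     (\<forall>f\<in>topspace (mor_top P). \<pi> (dom P f) = \<pi> (cod P f))"

definition G_functor :: "('a, 'b) two_group \<Rightarrow> ('p0, 'p1, 'a, 'b) two_space \<Rightarrow> ('q0, 'q1, 'a, 'b) two_space
    \<Rightarrow> ('p0 \<Rightarrow> 'q0) \<Rightarrow> ('p1 \<Rightarrow> 'q1) \<Rightarrow> bool" where
  "G_functor G P Q F0 F1 \<longleftrightarrow>
     continuous_map (ob_top P) (ob_top Q) F0 \<and> continuous_map (mor_top P) (mor_top Q) F1 \<and>
     (\<forall>f\<in>topspace (mor_top P). dom Q (F1 f) = F0 (dom P f) \<and> cod Q (F1 f) = F0 (cod P f)) \<and>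
     (\<forall>p\<in>topspace (ob_top P). F1 (idm P p) = idm Q (F0 p)) \<and>
     (\<forall>f\<in>topspace (mor_top P). \<forall>g\<in>topspace (mor_top P). cod P f = dom P g \<longrightarrow>
        F1 (cmp P f g) = cmp Q (F1 f) (F1 g)) \<and>
     (\<forall>p\<in>topspace (ob_top P). \<forall>x\<in>topspace (G0 G). F0 (act0 P p x) = act0 Q (F0 p) x) \<and>
     (\<forall>f\<in>topspace (mor_top P). \<forall>g\<in>topspace (G1 G). F1 (act1 P f g) = act1 Q (F1 f) g)"

definition G0_nat_trans :: "('a, 'b) two_group \<Rightarrow> ('p0, 'p1, 'a, 'b) two_space \<Rightarrow> ('q0, 'q1, 'a, 'b) two_space
    \<Rightarrow> ('p0 \<Rightarrow> 'q0) \<Rightarrow> ('p1 \<Rightarrow> 'q1) \<Rightarrow> ('p0 \<Rightarrow> 'q0) \<Rightarrow> ('p1 \<Rightarrow> 'q1) \<Rightarrow> ('p0 \<Rightarrow> 'q1) \<Rightarrow> bool" where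
  "G0_nat_trans G P Q F0 F1 F0' F1' \<alpha> \<longleftrightarrow>
     continuous_map (ob_top P) (mor_top Q) \<alpha> \<and>
     (\<forall>p\<in>topspace (ob_top P). dom Q (\<alpha> p) = F0 p \<and> cod Q (\<alpha> p) = F0' p) \<and>
     (\<forall>f\<in>topspace (mor_top P). cmp Q (F1 f) (\<alpha> (cod P f)) = cmp Q (\<alpha> (dom P f)) (F1' f)) \<and>
     (\<forall>p\<in>topspace (ob_top P). \<forall>x\<in>topspace (G0 G). \<alpha> (act0 P p x) = act1 Q (\<alpha> p) (ident G x))"

definition G0_nat_iso :: "('a, 'b) two_group \<Rightarrow> ('p0, 'p1, 'a, 'b) two_space \<Rightarrow> ('q0, 'q1, 'a, 'b) two_space
    \<Rightarrow> ('p0 \<Rightarrow> 'q0) \<Rightarrow> ('p1 \<Rightarrow> 'q1) \<Rightarrow> ('p0 \<Rightarrow> 'q0) \<Rightarrow> ('p1 \<Rightarrow> 'q1) \<Rightarrow> bool" where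
  "G0_nat_iso G P Q F0 F1 F0' F1' \<longleftrightarrow>
     (\<exists>\<alpha> \<beta>. G0_nat_trans G P Q F0 F1 F0' F1' \<alpha> \<and> G0_nat_trans G P Q F0' F1' F0 F1 \<beta> \<and>
        (\<forall>p\<in>topspace (ob_top P). cmp Q (\<alpha> p) (\<beta> p) = idm Q (F0 p) \<and>
                                  cmp Q (\<beta> p) (\<alpha> p) = idm Q (F0' p)))"

definition G_equiv_over :: "('a, 'b) two_group \<Rightarrow> ('p0, 'p1, 'a, 'b) two_space \<Rightarrow> ('p0 \<Rightarrow> 'x)
    \<Rightarrow> ('q0, 'q1, 'a, 'b) two_space \<Rightarrow> ('q0 \<Rightarrow> 'x) \<Rightarrow> bool" where
  "G_equiv_over G P \<pi> Q \<rho> \<longleftrightarrow>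
     (\<exists>\<phi>0 \<phi>1 \<psi>0 \<psi>1.
        G_functor G P Q \<phi>0 \<phi>1 \<and> G_functor G Q P \<psi>0 \<psi>1 \<and>
        (\<forall>p\<in>topspace (ob_top P). \<rho> (\<phi>0 p) = \<pi> p) \<and>
        (\<forall>q\<in>topspace (ob_top Q). \<pi> (\<psi>0 q) = \<rho> q) \<and>
        G0_nat_iso G P P (\<psi>0 \<circ> \<phi>0) (\<psi>1 \<circ> \<phi>1) id id \<and>
        G0_nat_iso G Q Q (\<phi>0 \<circ> \<psi>0) (\<phi>1 \<circ> \<psi>1) id id)"

definition restrict_space :: "('p0, 'p1, 'a, 'b) two_space \<Rightarrow> ('p0 \<Rightarrow> 'x) \<Rightarrow> 'x set \<Rightarrow> ('p0, 'p1, 'a, 'b) two_space" where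
  "restrict_space P \<pi> U = P\<lparr> ob_top := subtopology (ob_top P) {p. \<pi> p \<in> U},
                             mor_top := subtopology (mor_top P) {f. \<pi> (dom P f) \<in> U} \<rparr>"

definition trivial_space :: "('a, 'b) two_group \<Rightarrow> 'x topology \<Rightarrow> 'x set \<Rightarrow> ('x \<times> 'a, 'x \<times> 'b, 'a, 'b) two_space" where
  "trivial_space G X U = \<lparr> ob_top = prod_topology (subtopology X U) (G0 G),
     mor_top = prod_topology (subtopology X U) (G1 G),
     dom = (\<lambda>(u, g). (u, src G g)), cod = (\<lambda>(u, g). (u, tgt G g)),
     idm = (\<lambda>(u, x). (u, ident G x)),
     cmp = (\<lambda>(u, g) (u', h). (u, gcomp G g h)),
     act0 = (\<lambda>(u, x) y. (u, mult0 G x y)),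
     act1 = (\<lambda>(u, g) h. (u, mult1 G g h)) \<rparr>"

definition principal_bundle :: "('a, 'b) two_group \<Rightarrow> 'x topology \<Rightarrow> ('p0, 'p1, 'a, 'b) two_space
    \<Rightarrow> ('p0 \<Rightarrow> 'x) \<Rightarrow> bool" where
  "principal_bundle G X P \<pi> \<longleftrightarrow>
     G_2space G P \<and> functor_to_discrete X P \<pi> \<and>
     (\<forall>p\<in>topspace (ob_top P). \<forall>x\<in>topspace (G0 G). \<pi> (act0 P p x) = \<pi> p) \<and>
     (\<exists>\<U>. open_cover X \<U> \<and>
        (\<forall>U\<in>\<U>. G_equiv_over G (restrict_space P \<pi> U) \<pi> (trivial_space G X U) fst))"

definition bundle_morphism :: "('a, 'b) two_group \<Rightarrow> ('p0, 'p1, 'a, 'b) two_space \<Rightarrow> ('p0 \<Rightarrow> 'x)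
    \<Rightarrow> ('q0, 'q1, 'a, 'b) two_space \<Rightarrow> ('q0 \<Rightarrow> 'x) \<Rightarrow> bool" where
  "bundle_morphism G P \<pi> Q \<rho> \<longleftrightarrow>
     (\<exists>F0 F1. G_functor G P Q F0 F1 \<and> (\<forall>p\<in>topspace (ob_top P). \<rho> (F0 p) = \<pi> p))"

definition bundle_equiv_via :: "('a, 'b) two_group \<Rightarrow> 'x topology
    \<Rightarrow> ('w0, 'w1, 'a, 'b) two_space \<Rightarrow> ('w0 \<Rightarrow> 'x)
    \<Rightarrow> ('p0, 'p1, 'a, 'b) two_space \<Rightarrow> ('p0 \<Rightarrow> 'x)
    \<Rightarrow> ('q0, 'q1, 'a, 'b) two_space \<Rightarrow> ('q0 \<Rightarrow> 'x) \<Rightarrow> bool" where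
  "bundle_equiv_via G X W \<omega> P \<pi> Q \<rho> \<longleftrightarrow>
     principal_bundle G X W \<omega> \<and> principal_bundle G X P \<pi> \<and> principal_bundle G X Q \<rho> \<and>
     bundle_morphism G W \<omega> P \<pi> \<and> bundle_morphism G W \<omega> Q \<rho>"

type_synonym ('x, 'a) Pc_ob = "'x set \<times> ('x \<times> 'a)"
type_synonym ('x, 'b) Pc_mor = "('x set \<times> 'x set) \<times> ('x \<times> 'b)"

definition Pc_obtop :: "('a, 'b) two_group \<Rightarrow> 'x topology \<Rightarrow> 'x set set \<Rightarrow> ('x, 'a) Pc_ob topology" where
  "Pc_obtop G X \<U> = sum_topology (\<lambda>i. prod_topology (subtopology X i) (G0 G)) \<U>"

definition Pc_mortop :: "('a, 'b) two_group \<Rightarrow> 'x topology \<Rightarrow> 'x set set \<Rightarrow> ('x, 'b) Pc_mor topology" where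
  "Pc_mortop G X \<U> = sum_topology (\<lambda>(i, j). prod_topology (subtopology X (i \<inter> j)) (G1 G)) (\<U> \<times> \<U>)"

definition Pc_dom :: "('a, 'b) two_group \<Rightarrow> ('x, 'a, 'b) cech_cochain \<Rightarrow> ('x, 'b) Pc_mor \<Rightarrow> ('x, 'a) Pc_ob" where
  "Pc_dom G c = (\<lambda>((i, j), (v, g)). (i, (v, src G g)))"

definition Pc_cod :: "('a, 'b) two_group \<Rightarrow> ('x, 'a, 'b) cech_cochain \<Rightarrow> ('x, 'b) Pc_mor \<Rightarrow> ('x, 'a) Pc_ob" where
  "Pc_cod G c = (\<lambda>((i, j), (v, g)). (j, (v, mult0 G (inv0 G (fst c i j v)) (tgt G g))))"

definition Pc_cmp :: "('a, 'b) two_group \<Rightarrow> ('x, 'a, 'b) cech_cochain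
    \<Rightarrow> ('x, 'b) Pc_mor \<Rightarrow> ('x, 'b) Pc_mor \<Rightarrow> ('x, 'b) Pc_mor" where
  "Pc_cmp G c = (\<lambda>((i, j), (v, g)) ((j', k), (v', h)).
      ((i, k), (v, mult1 G (snd c i j k v) (gcomp G g (mult1 G (ident G (fst c i j v)) h)))))"

text \<open>Identities of P_c are the (unique) identity morphisms of the category structure.\<close>
definition Pc_idm :: "('a, 'b) two_group \<Rightarrow> 'x topology \<Rightarrow> 'x set set \<Rightarrow> ('x, 'a, 'b) cech_cochain
    \<Rightarrow> ('x, 'a) Pc_ob \<Rightarrow> ('x, 'b) Pc_mor" where
  "Pc_idm G X \<U> c p = (SOME f. f \<in> topspace (Pc_mortop G X \<U>) \<and> Pc_dom G c f = p \<and> Pc_cod G c f = p \<and>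
      (\<forall>g\<in>topspace (Pc_mortop G X \<U>). Pc_dom G c g = p \<longrightarrow> Pc_cmp G c f g = g) \<and>
      (\<forall>g\<in>topspace (Pc_mortop G X \<U>). Pc_cod G c g = p \<longrightarrow> Pc_cmp G c g f = g))"

definition Pc :: "('a, 'b) two_group \<Rightarrow> 'x topology \<Rightarrow> 'x set set \<Rightarrow> ('x, 'a, 'b) cech_cochain
    \<Rightarrow> (('x, 'a) Pc_ob, ('x, 'b) Pc_mor, 'a, 'b) two_space" where
  "Pc G X \<U> c = \<lparr> ob_top = Pc_obtop G X \<U>, mor_top = Pc_mortop G X \<U>,
      dom = Pc_dom G c, cod = Pc_cod G c, idm = Pc_idm G X \<U> c, cmp = Pc_cmp G c,
      act0 = (\<lambda>(i, (u, x)) y. (i, (u, mult0 G x y))),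
      act1 = (\<lambda>((i, j), (v, g)) h. ((i, j), (v, mult1 G g h))) \<rparr>"

definition Pc_proj :: "('x, 'a) Pc_ob \<Rightarrow> 'x" where
  "Pc_proj = (\<lambda>(i, (u, x)). u)"

definition admits_good_covers :: "'x topology \<Rightarrow> bool" where
  "admits_good_covers X \<longleftrightarrow>
     (\<forall>\<U>. open_cover X \<U> \<longrightarrow>
        (\<exists>\<V>. open_cover X \<V> \<and> (\<forall>V\<in>\<V>. \<exists>U\<in>\<U>. V \<subseteq> U) \<and>
           (\<forall>\<S>. finite \<S> \<and> \<S> \<noteq> {} \<and> \<S> \<subseteq> \<V> \<and> \<Inter>\<S> \<noteq> {} \<longrightarrow>
                 contractible_space (subtopology X (\<Inter>\<S>)))))"

end

theory Submission
  imports Defs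
begin

text \<open>
  A trivialization over \<open>U\<close> amounts to a section \<open>q\<close> of the objects over \<open>U\<close> through which morphisms become
  elements of \<open>\<G>\<^sub>1\<close>. Comparing the sections \<open>q\<^sub>i\<close> of a bundle \<open>P\<close> on overlaps gives
  \<open>s\<^sub>i\<^sub>j \<colon> q\<^sub>i x\<^sub>i\<^sub>j \<rightarrow> q\<^sub>j\<close>, and the failure of the \<open>s\<^sub>i\<^sub>j\<close> to compose gives \<open>e\<^sub>i\<^sub>j\<^sub>k\<close>. The pair \<open>(x, e)\<close> is a cocycle,
  and \<open>(u, a)\<^sub>i \<mapsto> q\<^sub>i(u) a\<close> extends to a bundle morphism from \<open>P\<^sub>c\<close> to \<open>P\<close>; this is surjectivity.
  For injectivity, let \<open>F \<colon> W \<rightarrow> P\<^sub>c\<close> and \<open>F' \<colon> W \<rightarrow> P\<^sub>c\<^sub>'\<close> be bundle morphisms. On a fine enough cover \<open>\<V>\<close> the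
  sections of \<open>W\<close> are sent by \<open>F\<close> and \<open>F'\<close> into single summands of the object spaces, which defines refinement
  maps \<open>r, r'\<close>; the components of \<open>F(s\<^sub>i\<^sub>j)\<close> and \<open>F'(s\<^sub>i\<^sub>j)\<close> then exhibit both \<open>r\<^sup>*c\<close> and \<open>r'\<^sup>*c'\<close> as cohomologous
  to the cocycle of \<open>W\<close> on \<open>\<V>\<close>.
\<close>

section \<open>Topological 2-groups\<close>

text \<open>Two things shape the work. Cocycles are not normalised: \<open>x i i\<close> and
  \<open>e i i i\<close> may be nontrivial. So the identities of \<open>P_c\<close> carry a
  correction \<open>\<epsilon>\<close>, and \<open>(u, a) \<mapsto> (i, (u, a))\<close> is inverse
  to the chart of \<open>P_c\<close> over \<open>i\<close> only up to a natural isomorphism made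
  from \<open>e i i i\<close>. Also, the composition of \<open>P_c\<close> is twisted; it is
  compared with that of \<open>\<G>\<close> by the faithful maps \<open>\<Phi> i\<close>. In
  \<open>\<G>\<close>, \<open>star_eq\<close> rewrites composition as group multiplication, and the
  one identity that is not formal is that the kernels of source and target commute, mostly used as
  the Peiffer identity. That \<open>P_c\<close> is a principal bundle has to be proved as well:
  bundle equivalence speaks only of principal bundles, and the intermediate bundle for surjectivity
  is a copy of \<open>P_c\<close>. A \<open>\<G>\<close>-2-space need not be a groupoid, so
  comparison morphisms come with explicit inverses. Covers are indexed by their own members, so each
  cover consists of all open sets that admit the wanted data, and the data are then chosen as
  functions of the set.\<close>

lemma continuous_map_locally:
  assumes "\<And>z. z \<in> topspace Z \<Longrightarrow> \<exists>U. openin Z U \<and> z \<in> U \<and> continuous_map (subtopology Z U) Y f"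
  shows "continuous_map Z Y f"
  by (rule pasting_lemma[where I = "{U. openin Z U \<and> continuous_map (subtopology Z U) Y f}"
        and T = id and f = "\<lambda>_. f"]) (use assms in fastforce)+

lemma continuous_map_closed: "continuous_map Z Y f \<Longrightarrow> z \<in> topspace Z \<Longrightarrow> f z \<in> topspace Y"
  by (auto simp: continuous_map_def)

lemma continuous_map_compose_at:
  "continuous_map Y T h \<Longrightarrow> continuous_map Z Y f \<Longrightarrow> continuous_map Z T (\<lambda>z. h (f z))"
  using continuous_map_compose[of Z Y f T h] by (simp add: o_def)

lemma continuous_map_fst_at: "continuous_map Z (prod_topology S T) f \<Longrightarrow> continuous_map Z S (\<lambda>z. fst (f z))"
  and continuous_map_snd_at: "continuous_map Z (prod_topology S T) f \<Longrightarrow> continuous_map Z T (\<lambda>z. snd (f z))"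
  by (simp_all add: continuous_map_pairwise o_def)

section \<open>Maps into and out of disjoint unions\<close>

lemma openin_sum_component:
  assumes "continuous_map Z (sum_topology T I) k"
  shows "openin Z {z \<in> topspace Z. fst (k z) = i}"
proof -
  have "openin (sum_topology T I) (Sigma I (\<lambda>j. if j = i then topspace (T j) else {}))"
    by (subst openin_disjoint_union) auto
  from openin_continuous_map_preimage[OF assms this]
  have "openin Z {z \<in> topspace Z. k z \<in> (Sigma I (\<lambda>j. if j = i then topspace (T j) else {}))}" .
  also have "{z \<in> topspace Z. k z \<in> (Sigma I (\<lambda>j. if j = i then topspace (T j) else {}))}
      = {z \<in> topspace Z. fst (k z) = i}"
    using continuous_map_image_subset_topspace[OF assms] by (force split: if_splits)
  finally show ?thesis .
qed

text \<open>The pieces on which the index of \<open>k\<close> is constant are open and cover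
  \<open>Z\<close>. This lets continuity on the object and morphism spaces of \<open>P_c\<close> be
  checked with the indices fixed.\<close>

lemma continuous_map_from_sum_pieces:
  assumes k: "continuous_map Z (sum_topology T I) k"
    and f: "\<And>i. i \<in> I \<Longrightarrow> continuous_map (subtopology Z {z. fst (k z) = i}) Y f"
  shows "continuous_map Z Y f"
proof (rule continuous_map_locally)
  fix z assume z: "z \<in> topspace Z"
  then have "k z \<in> Sigma I (topspace \<circ> T)"
    using continuous_map_image_subset_topspace[OF k] by auto
  then have i: "fst (k z) \<in> I" by auto
  have "subtopology Z {w \<in> topspace Z. fst (k w) = fst (k z)} = subtopology Z {w. fst (k w) = fst (k z)}"
    using subtopology_restrict[of Z "{w. fst (k w) = fst (k z)}"] by (simp add: Collect_conj_eq)
  then show "\<exists>U. openin Z U \<and> z \<in> U \<and> continuous_map (subtopology Z U) Y f"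
    using openin_sum_component[OF k, of "fst (k z)"] f[OF i] z
    by (intro exI[of _ "{w \<in> topspace Z. fst (k w) = fst (k z)}"]) simp
qed

lemma continuous_map_sum_component:
  assumes k: "continuous_map Z (sum_topology T I) k" and i: "i \<in> I"
    and ki: "\<And>z. z \<in> topspace Z \<Longrightarrow> fst (k z) = i"
  shows "continuous_map Z (T i) (\<lambda>z. snd (k z))"
  unfolding continuous_map_def
proof (intro conjI allI impI)
  have *: "k z \<in> Sigma I (topspace \<circ> T)" if "z \<in> topspace Z" for z
    using continuous_map_image_subset_topspace[OF k] that by auto
  then show "(\<lambda>z. snd (k z)) \<in> topspace Z \<rightarrow> topspace (T i)"
    using ki by fastforce
  fix U assume U: "openin (T i) U"
  have "openin (sum_topology T I) (Sigma I (\<lambda>j. if j = i then U else {}))"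
    using U by (subst openin_disjoint_union) auto
  from openin_continuous_map_preimage[OF k this]
  have "openin Z {z \<in> topspace Z. k z \<in> (Sigma I (\<lambda>j. if j = i then U else {}))}" .
  also have "{z \<in> topspace Z. k z \<in> (Sigma I (\<lambda>j. if j = i then U else {}))} = {z \<in> topspace Z. snd (k z) \<in> U}"
    using * ki i by (force split: if_splits)
  finally show "openin Z {z \<in> topspace Z. snd (k z) \<in> U}" .
qed

lemma continuous_map_into_sum:
  "i \<in> I \<Longrightarrow> continuous_map Z (T i) f \<Longrightarrow> continuous_map Z (sum_topology T I) (\<lambda>z. (i, f z))"
  by (rule continuous_map_compose_at[OF continuous_map_component_injection])

locale top_grp =
  fixes T :: "'a topology" and m :: "'a \<Rightarrow> 'a \<Rightarrow> 'a" and e :: 'a and i :: "'a \<Rightarrow> 'a"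
  assumes top_group_on: "top_group_on T m e i"
begin

lemma closed [simp]: "e \<in> topspace T" "x \<in> topspace T \<Longrightarrow> y \<in> topspace T \<Longrightarrow> m x y \<in> topspace T"
    "x \<in> topspace T \<Longrightarrow> i x \<in> topspace T"
  and assoc [simp]: "x \<in> topspace T \<Longrightarrow> y \<in> topspace T \<Longrightarrow> z \<in> topspace T \<Longrightarrow> m (m x y) z = m x (m y z)"
  and unit [simp]: "x \<in> topspace T \<Longrightarrow> m e x = x" "x \<in> topspace T \<Longrightarrow> m x e = x"
  and inverse [simp]: "x \<in> topspace T \<Longrightarrow> m (i x) x = e" "x \<in> topspace T \<Longrightarrow> m x (i x) = e"
  using top_group_on by (auto simp: top_group_on_def)

lemma cancel [simp]: "x \<in> topspace T \<Longrightarrow> y \<in> topspace T \<Longrightarrow> m (i x) (m x y) = y"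
    "x \<in> topspace T \<Longrightarrow> y \<in> topspace T \<Longrightarrow> m x (m (i x) y) = y"
  by (simp_all flip: assoc)

lemma cancel_iff [simp]:
  "x \<in> topspace T \<Longrightarrow> y \<in> topspace T \<Longrightarrow> z \<in> topspace T \<Longrightarrow> m x y = m x z \<longleftrightarrow> y = z"
  by (metis cancel(1))

lemma inverse_unique: "x \<in> topspace T \<Longrightarrow> y \<in> topspace T \<Longrightarrow> m x y = e \<Longrightarrow> i x = y"
  by (metis cancel(1) closed(3) unit(2))

lemma inverse_rules [simp]: "i e = e" "x \<in> topspace T \<Longrightarrow> i (i x) = x"
    "x \<in> topspace T \<Longrightarrow> y \<in> topspace T \<Longrightarrow> i (m x y) = m (i y) (i x)"
  by (rule inverse_unique; simp)+

lemma idempotent: "x \<in> topspace T \<Longrightarrow> m x x = x \<Longrightarrow> x = e"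
  by (metis cancel(1) inverse(1))

lemma move_left: "x \<in> topspace T \<Longrightarrow> y \<in> topspace T \<Longrightarrow> z \<in> topspace T \<Longrightarrow> m x y = z \<longleftrightarrow> y = m (i x) z"
  by auto

lemma continuous_mul: "continuous_map Z T f \<Longrightarrow> continuous_map Z T g \<Longrightarrow> continuous_map Z T (\<lambda>z. m (f z) (g z))"
  using continuous_map_compose_at[of "prod_topology T T" T "\<lambda>(x, y). m x y" Z "\<lambda>z. (f z, g z)"] top_group_on
  by (simp add: top_group_on_def continuous_map_paired)

lemma continuous_inverse: "continuous_map Z T f \<Longrightarrow> continuous_map Z T (\<lambda>z. i (f z))"
  using continuous_map_compose_at[of T T i Z f] top_group_on by (simp add: top_group_on_def)

end

section \<open>Calculus in a topological 2-group\<close>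

locale two_grp =
  fixes G :: "('a, 'b) two_group"
  assumes top_2group: "top_2group G"
begin

abbreviation "C0 \<equiv> topspace (G0 G)"
abbreviation "C1 \<equiv> topspace (G1 G)"
abbreviation mul0 (infixr "\<cdot>" 70) where "x \<cdot> y \<equiv> mult0 G x y"
abbreviation mul1 (infixr "\<odot>" 70) where "g \<odot> h \<equiv> mult1 G g h"
abbreviation "i0 \<equiv> inv0 G"
abbreviation "i1 \<equiv> inv1 G"
abbreviation "\<iota> \<equiv> ident G"
abbreviation "\<s> \<equiv> src G"
abbreviation "\<t> \<equiv> tgt G"
abbreviation star (infixr "\<star>" 70) where "g \<star> h \<equiv> gcomp G g h"

sublocale O: top_grp "G0 G" "mult0 G" "one0 G" "inv0 G"
  using top_2group by unfold_locales (simp add: top_2group_def)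

sublocale M: top_grp "G1 G" "mult1 G" "one1 G" "inv1 G"
  using top_2group by unfold_locales (simp add: top_2group_def)

lemma top_category: "top_category (G0 G) (G1 G) \<s> \<t> \<iota> (gcomp G)"
  using top_2group by (simp add: top_2group_def)

lemma structure_closed [simp]: "g \<in> C1 \<Longrightarrow> \<s> g \<in> C0" "g \<in> C1 \<Longrightarrow> \<t> g \<in> C0" "x \<in> C0 \<Longrightarrow> \<iota> x \<in> C1"
  using top_category continuous_map_image_subset_topspace unfolding top_category_def by blast+

lemma src_tgt_ident [simp]: "x \<in> C0 \<Longrightarrow> \<s> (\<iota> x) = x" "x \<in> C0 \<Longrightarrow> \<t> (\<iota> x) = x"
  and star_closed [simp]: "f \<in> C1 \<Longrightarrow> g \<in> C1 \<Longrightarrow> \<t> f = \<s> g \<Longrightarrow> f \<star> g \<in> C1"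
  and src_star [simp]: "f \<in> C1 \<Longrightarrow> g \<in> C1 \<Longrightarrow> \<t> f = \<s> g \<Longrightarrow> \<s> (f \<star> g) = \<s> f"
  and tgt_star [simp]: "f \<in> C1 \<Longrightarrow> g \<in> C1 \<Longrightarrow> \<t> f = \<s> g \<Longrightarrow> \<t> (f \<star> g) = \<t> g"
  and star_ident: "f \<in> C1 \<Longrightarrow> \<iota> (\<s> f) \<star> f = f" "f \<in> C1 \<Longrightarrow> f \<star> \<iota> (\<t> f) = f"
  and star_assoc: "f \<in> C1 \<Longrightarrow> g \<in> C1 \<Longrightarrow> h \<in> C1 \<Longrightarrow> \<t> f = \<s> g \<Longrightarrow> \<t> g = \<s> h \<Longrightarrow>
     (f \<star> g) \<star> h = f \<star> (g \<star> h)"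
  using top_category unfolding top_category_def by blast+

lemma hom_mul [simp]: "g \<in> C1 \<Longrightarrow> h \<in> C1 \<Longrightarrow> \<s> (g \<odot> h) = \<s> g \<cdot> \<s> h"
    "g \<in> C1 \<Longrightarrow> h \<in> C1 \<Longrightarrow> \<t> (g \<odot> h) = \<t> g \<cdot> \<t> h"
    "x \<in> C0 \<Longrightarrow> y \<in> C0 \<Longrightarrow> \<iota> (x \<cdot> y) = \<iota> x \<odot> \<iota> y"
  and interchange: "g1 \<in> C1 \<Longrightarrow> g2 \<in> C1 \<Longrightarrow> h1 \<in> C1 \<Longrightarrow> h2 \<in> C1 \<Longrightarrow> \<t> g1 = \<s> h1 \<Longrightarrow> \<t> g2 = \<s> h2 \<Longrightarrow>
        (g1 \<odot> g2) \<star> (h1 \<odot> h2) = (g1 \<star> h1) \<odot> (g2 \<star> h2)"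
  using top_2group unfolding top_2group_def by blast+

lemma hom_one [simp]: "\<s> (one1 G) = one0 G" "\<t> (one1 G) = one0 G" "\<iota> (one0 G) = one1 G"
proof -
  show "\<s> (one1 G) = one0 G" using hom_mul(1)[of "one1 G" "one1 G"] by (intro O.idempotent) simp_all
  show "\<t> (one1 G) = one0 G" using hom_mul(2)[of "one1 G" "one1 G"] by (intro O.idempotent) simp_all
  show "\<iota> (one0 G) = one1 G" using hom_mul(3)[of "one0 G" "one0 G"] by (intro M.idempotent) simp_all
qed

lemma hom_inverse [simp]: "g \<in> C1 \<Longrightarrow> \<s> (i1 g) = i0 (\<s> g)" "g \<in> C1 \<Longrightarrow> \<t> (i1 g) = i0 (\<t> g)"
    "x \<in> C0 \<Longrightarrow> \<iota> (i0 x) = i1 (\<iota> x)"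
proof -
  show "\<s> (i1 g) = i0 (\<s> g)" if "g \<in> C1"
    using hom_mul(1)[of g "i1 g"] that by (intro O.inverse_unique[symmetric]) simp_all
  show "\<t> (i1 g) = i0 (\<t> g)" if "g \<in> C1"
    using hom_mul(2)[of g "i1 g"] that by (intro O.inverse_unique[symmetric]) simp_all
  show "\<iota> (i0 x) = i1 (\<iota> x)" if "x \<in> C0"
    using hom_mul(3)[of x "i0 x"] that by (intro M.inverse_unique[symmetric]) simp_all
qed

text \<open>Write \<open>g\<close> as
  \<open>\<iota> (\<s> h) \<odot> (i1 (\<iota> (\<s> h)) \<odot> g)\<close> and \<open>h\<close> as
  \<open>h \<odot> one1 G\<close>. Both columns are composable, and interchange leaves two
  compositions with an identity. Identities between compositions thereby become identities between
  words in the group of morphisms.\<close>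

lemma star_eq:
  assumes [simp]: "g \<in> C1" "h \<in> C1" and c: "\<t> g = \<s> h"
  shows "g \<star> h = h \<odot> i1 (\<iota> (\<s> h)) \<odot> g"
proof -
  have "(\<iota> (\<s> h) \<odot> (i1 (\<iota> (\<s> h)) \<odot> g)) \<star> (h \<odot> one1 G) = (\<iota> (\<s> h) \<star> h) \<odot> ((i1 (\<iota> (\<s> h)) \<odot> g) \<star> \<iota> (one0 G))"
    using c by (subst interchange) simp_all
  moreover have "(i1 (\<iota> (\<s> h)) \<odot> g) \<star> \<iota> (one0 G) = i1 (\<iota> (\<s> h)) \<odot> g"
    using star_ident(2)[of "i1 (\<iota> (\<s> h)) \<odot> g"] c by simp
  ultimately show ?thesis by (simp add: star_ident)
qed

text \<open>An Eckmann-Hilton argument: interchange evaluates \<open>a \<star> b\<close> to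
  \<open>a \<odot> b\<close>, while \<open>star_eq\<close> evaluates it to
  \<open>b \<odot> a\<close>.\<close>

lemma ker_commute:
  assumes [simp]: "a \<in> C1" "b \<in> C1" and c: "\<t> a = one0 G" "\<s> b = one0 G"
  shows "a \<odot> b = b \<odot> a"
proof -
  have "(a \<odot> one1 G) \<star> (one1 G \<odot> b) = (a \<star> one1 G) \<odot> (one1 G \<star> b)"
    using c by (intro interchange) auto
  moreover have "a \<star> one1 G = a" "one1 G \<star> b = b" "a \<star> b = b \<odot> a"
    using c by (auto simp: star_eq)
  ultimately show ?thesis by simp
qed

text \<open>The Peiffer identity of the crossed module on \<open>\<E>\<close>: conjugation of
  \<open>f\<close> by \<open>\<iota> (\<t> e)\<close> agrees with conjugation by \<open>e\<close>.
  The quotient \<open>i1 e \<odot> \<iota> (\<t> e)\<close> has trivial target, hence commutes with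
  \<open>\<E>\<close>.\<close>

lemma peiffer:
  assumes [simp]: "e \<in> C1" "f \<in> C1" and c [simp]: "\<s> e = one0 G" "\<s> f = one0 G"
  shows "\<iota> (\<t> e) \<odot> f = e \<odot> f \<odot> i1 e \<odot> \<iota> (\<t> e)"
proof -
  have "(i1 e \<odot> \<iota> (\<t> e)) \<odot> f = f \<odot> (i1 e \<odot> \<iota> (\<t> e))"
    by (rule ker_commute) simp_all
  then show ?thesis by (simp add: M.move_left)
qed

text \<open>The inverse for \<open>\<star>\<close>, obtained by solving
  \<open>g \<star> h = \<iota> (\<s> g)\<close> for \<open>h\<close> with \<open>star_eq\<close>.
  Every morphism of a 2-group is thus invertible, and the formula is visibly continuous.\<close>

definition ginv :: "'b \<Rightarrow> 'b" where
  "ginv g = \<iota> (\<s> g) \<odot> i1 g \<odot> \<iota> (\<t> g)"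

lemma ginv [simp]:
  assumes [simp]: "g \<in> C1"
  shows "ginv g \<in> C1" "\<s> (ginv g) = \<t> g" "\<t> (ginv g) = \<s> g" "g \<star> ginv g = \<iota> (\<s> g)" "ginv g \<star> g = \<iota> (\<t> g)"
  by (simp_all add: ginv_def star_eq)

lemma star_ginv:
  assumes [simp]: "f \<in> C1" "g \<in> C1"
  shows "\<t> f = \<s> g \<Longrightarrow> ginv f \<star> (f \<star> g) = g" "\<t> g = \<s> f \<Longrightarrow> (g \<star> f) \<star> ginv f = g"
  using star_ident(2)[of g] by (simp_all add: star_ident star_assoc[of g f] star_assoc[of "ginv f" f g, symmetric])

lemma star_cancel:
  assumes "f \<in> C1" "g \<in> C1" "h \<in> C1"
  shows "\<t> f = \<s> g \<Longrightarrow> \<t> f = \<s> h \<Longrightarrow> f \<star> g = f \<star> h \<Longrightarrow> g = h"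
    and "\<t> g = \<s> f \<Longrightarrow> \<t> h = \<s> f \<Longrightarrow> g \<star> f = h \<star> f \<Longrightarrow> g = h"
  using assms star_ginv by metis+

text \<open>Serves to recognise the image of a unit of \<open>P_c\<close> under
  \<open>\<Phi> i\<close> as an identity without computing it.\<close>

lemma star_idempotent:
  assumes [simp]: "g \<in> C1" and "\<t> g = \<s> g" "g \<star> g = g"
  shows "g = \<iota> (\<s> g)"
  using assms by (simp add: star_eq M.move_left)

lemma continuous_src: "continuous_map Z (G1 G) f \<Longrightarrow> continuous_map Z (G0 G) (\<lambda>z. \<s> (f z))"
  and continuous_tgt: "continuous_map Z (G1 G) f \<Longrightarrow> continuous_map Z (G0 G) (\<lambda>z. \<t> (f z))"
  and continuous_ident: "continuous_map Z (G0 G) h \<Longrightarrow> continuous_map Z (G1 G) (\<lambda>z. \<iota> (h z))"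
  using top_category unfolding top_category_def by (metis continuous_map_compose_at)+

lemma continuous_star:
  assumes "continuous_map Z (G1 G) f" "continuous_map Z (G1 G) g" "\<And>z. z \<in> topspace Z \<Longrightarrow> \<t> (f z) = \<s> (g z)"
  shows "continuous_map Z (G1 G) (\<lambda>z. f z \<star> g z)"
proof -
  have "continuous_map Z (subtopology (prod_topology (G1 G) (G1 G)) (composable_pairs (G0 G) (G1 G) \<s> \<t>))
     (\<lambda>z. (f z, g z))"
    using assms continuous_map_image_subset_topspace[OF assms(1)] continuous_map_image_subset_topspace[OF assms(2)]
    by (auto simp: continuous_map_in_subtopology continuous_map_paired composable_pairs_def)
  from continuous_map_compose_at[OF _ this, of "G1 G" "\<lambda>(f, g). f \<star> g"] show ?thesis
    using top_category unfolding top_category_def by simp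
qed

lemmas continuous_rules = O.continuous_mul O.continuous_inverse M.continuous_mul M.continuous_inverse
  continuous_src continuous_tgt continuous_ident

lemma continuous_ginv: "continuous_map Z (G1 G) f \<Longrightarrow> continuous_map Z (G1 G) (\<lambda>z. ginv (f z))"
  unfolding ginv_def by (intro continuous_rules)

lemma kerE_iff [simp]: "e \<in> kerE G \<longleftrightarrow> e \<in> C1 \<and> \<s> e = one0 G"
  by (auto simp: kerE_def)

lemma continuous_E_top:
  "continuous_map Z (E_top G) f \<longleftrightarrow> continuous_map Z (G1 G) f \<and> (\<forall>z\<in>topspace Z. \<s> (f z) = one0 G)"
  unfolding E_top_def continuous_map_in_subtopology
  using continuous_map_image_subset_topspace[of Z "G1 G" f] by (auto simp: kerE_def)

text \<open>The case \<open>i j k l\<close> of the cocycle identity makes \<open>g \<mapsto> e\<^sub>i\<^sub>j\<^sub>k \<odot> \<iota> x\<^sub>i\<^sub>j \<odot> g\<close> turn the composition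
  of \<open>P\<^sub>c\<close> into that of \<open>\<G>\<close>.\<close>
lemma cocycle_functorial:
  assumes [simp]: "e1 \<in> C1" "e2 \<in> C1" "e3 \<in> C1" "e4 \<in> C1" "x \<in> C0" "y \<in> C0" "g \<in> C1" "h \<in> C1"
    and s [simp]: "\<s> e1 = one0 G" "\<s> e2 = one0 G" "\<s> e3 = one0 G" "\<s> e4 = one0 G"
    and z: "z = \<t> e1 \<cdot> x \<cdot> y" and e: "e2 \<odot> e1 = e3 \<odot> \<iota> x \<odot> e4 \<odot> i1 (\<iota> x)" and gh: "\<t> g = y \<cdot> \<s> h"
  shows "e3 \<odot> \<iota> x \<odot> e4 \<odot> (g \<star> (\<iota> y \<odot> h)) = (e1 \<odot> \<iota> x \<odot> g) \<star> (e2 \<odot> \<iota> z \<odot> h)"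
proof -
  have e': "e3 \<odot> \<iota> x \<odot> e4 \<odot> w = e2 \<odot> e1 \<odot> \<iota> x \<odot> w" if [simp]: "w \<in> C1" for w
    using arg_cong[OF e, of "\<lambda>u. u \<odot> \<iota> x \<odot> w"] by simp
  \<comment> \<open>\<open>a\<close> is the conjugate by \<open>\<iota> (x \<cdot> y)\<close> of
    \<open>h \<odot> i1 (\<iota> (\<s> h))\<close>, the translate of \<open>h\<close> with source
    the unit. It lies in \<open>\<E>\<close>, so \<open>peiffer\<close> can exchange
    \<open>\<iota> (\<t> e1)\<close>, which enters through \<open>z\<close>, for
    \<open>e1\<close>.\<close>
  define a where "a = \<iota> x \<odot> \<iota> y \<odot> h \<odot> i1 (\<iota> (\<s> h)) \<odot> i1 (\<iota> y) \<odot> i1 (\<iota> x)"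
  have a [simp]: "a \<in> C1" "\<s> a = one0 G" by (simp_all add: a_def)
  have "(e1 \<odot> \<iota> x \<odot> g) \<star> (e2 \<odot> \<iota> z \<odot> h) = e2 \<odot> (\<iota> (\<t> e1) \<odot> a) \<odot> i1 (\<iota> (\<t> e1)) \<odot> e1 \<odot> \<iota> x \<odot> g"
    by (simp add: star_eq gh z a_def)
  also have "\<dots> = e2 \<odot> e1 \<odot> a \<odot> \<iota> x \<odot> g" by (subst peiffer) simp_all
  also have "\<dots> = e2 \<odot> e1 \<odot> \<iota> x \<odot> (g \<star> (\<iota> y \<odot> h))" by (simp add: a_def star_eq gh)
  finally show ?thesis by (simp add: e' gh)
qed

end

section \<open>Chart sections of principal bundles\<close>

text \<open>The inverse is an argument, not an existential, so that a family of isomorphisms can be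
  given together with a continuous family of inverses.\<close>

definition inverse_pair :: "('p0, 'p1, 'a, 'b) two_space \<Rightarrow> 'p1 \<Rightarrow> 'p1 \<Rightarrow> bool" where
  "inverse_pair P f f' \<longleftrightarrow> f \<in> topspace (mor_top P) \<and> f' \<in> topspace (mor_top P) \<and>
     dom P f' = cod P f \<and> cod P f' = dom P f \<and> cmp P f f' = idm P (dom P f) \<and> cmp P f' f = idm P (cod P f)"

lemma G_functorD:
  assumes "G_functor G P Q F0 F1"
  shows "continuous_map (ob_top P) (ob_top Q) F0" "continuous_map (mor_top P) (mor_top Q) F1"
    "f \<in> topspace (mor_top P) \<Longrightarrow> dom Q (F1 f) = F0 (dom P f)"
    "f \<in> topspace (mor_top P) \<Longrightarrow> cod Q (F1 f) = F0 (cod P f)"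
    "p \<in> topspace (ob_top P) \<Longrightarrow> F1 (idm P p) = idm Q (F0 p)"
    "f \<in> topspace (mor_top P) \<Longrightarrow> g \<in> topspace (mor_top P) \<Longrightarrow> cod P f = dom P g \<Longrightarrow>
        F1 (cmp P f g) = cmp Q (F1 f) (F1 g)"
    "p \<in> topspace (ob_top P) \<Longrightarrow> x \<in> topspace (G0 G) \<Longrightarrow> F0 (act0 P p x) = act0 Q (F0 p) x"
    "f \<in> topspace (mor_top P) \<Longrightarrow> h \<in> topspace (G1 G) \<Longrightarrow> F1 (act1 P f h) = act1 Q (F1 f) h"
    "p \<in> topspace (ob_top P) \<Longrightarrow> F0 p \<in> topspace (ob_top Q)"
    "f \<in> topspace (mor_top P) \<Longrightarrow> F1 f \<in> topspace (mor_top Q)"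
  using assms continuous_map_image_subset_topspace unfolding G_functor_def by blast+

lemma G0_nat_transD:
  assumes "G0_nat_trans G P Q F0 F1 F0' F1' \<alpha>"
  shows "continuous_map (ob_top P) (mor_top Q) \<alpha>"
    "p \<in> topspace (ob_top P) \<Longrightarrow> \<alpha> p \<in> topspace (mor_top Q)"
    "p \<in> topspace (ob_top P) \<Longrightarrow> dom Q (\<alpha> p) = F0 p" "p \<in> topspace (ob_top P) \<Longrightarrow> cod Q (\<alpha> p) = F0' p"
    "f \<in> topspace (mor_top P) \<Longrightarrow> cmp Q (F1 f) (\<alpha> (cod P f)) = cmp Q (\<alpha> (dom P f)) (F1' f)"
  using assms continuous_map_image_subset_topspace unfolding G0_nat_trans_def by blast+

lemma restrict_space_simps [simp]:
  "ob_top (restrict_space P \<pi> U) = subtopology (ob_top P) {p. \<pi> p \<in> U}"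
  "mor_top (restrict_space P \<pi> U) = subtopology (mor_top P) {f. \<pi> (dom P f) \<in> U}"
  "dom (restrict_space P \<pi> U) = dom P" "cod (restrict_space P \<pi> U) = cod P"
  "idm (restrict_space P \<pi> U) = idm P" "cmp (restrict_space P \<pi> U) = cmp P"
  "act0 (restrict_space P \<pi> U) = act0 P" "act1 (restrict_space P \<pi> U) = act1 P"
  by (simp_all add: restrict_space_def)

lemma trivial_space_simps [simp]:
  "ob_top (trivial_space G X U) = prod_topology (subtopology X U) (G0 G)"
  "mor_top (trivial_space G X U) = prod_topology (subtopology X U) (G1 G)"
  "dom (trivial_space G X U) a = (fst a, src G (snd a))" "cod (trivial_space G X U) a = (fst a, tgt G (snd a))"
  "idm (trivial_space G X U) b = (fst b, ident G (snd b))"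
  "cmp (trivial_space G X U) a a' = (fst a, gcomp G (snd a) (snd a'))"
  "act0 (trivial_space G X U) b y = (fst b, mult0 G (snd b) y)"
  "act1 (trivial_space G X U) a h = (fst a, mult1 G (snd a) h)"
  by (simp_all add: trivial_space_def split_beta)

text \<open>A section \<open>q\<close> over \<open>U\<close> whose \<open>\<G>\<close>-translates meet every isomorphism class of \<open>P|\<^sub>U\<close> and through which
  the hom-sets of \<open>P|\<^sub>U\<close> become those of \<open>\<G>\<close>, continuously in the base point. Unlike a trivialization it
  restricts to smaller sets without changing the data.\<close>
definition chart_section :: "('a, 'b) two_group \<Rightarrow> 'x topology \<Rightarrow> ('p0, 'p1, 'a, 'b) two_space \<Rightarrow> ('p0 \<Rightarrow> 'x)
    \<Rightarrow> 'x set \<Rightarrow> ('x \<Rightarrow> 'p0) \<Rightarrow> bool" where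
  "chart_section G X P \<pi> U q \<longleftrightarrow> U \<subseteq> topspace X \<and>
     continuous_map (subtopology X U) (ob_top P) q \<and> (\<forall>u\<in>U. \<pi> (q u) = u) \<and>
     (\<forall>S\<subseteq>U. \<forall>p. continuous_map (subtopology X S) (ob_top P) p \<longrightarrow> (\<forall>v\<in>S. \<pi> (p v) = v) \<longrightarrow>
        (\<exists>x s s'. continuous_map (subtopology X S) (G0 G) x \<and> continuous_map (subtopology X S) (mor_top P) s \<and>
           continuous_map (subtopology X S) (mor_top P) s' \<and>
           (\<forall>v\<in>S. inverse_pair P (s v) (s' v) \<and> dom P (s v) = act0 P (q v) (x v) \<and> cod P (s v) = p v))) \<and>
     (\<forall>S\<subseteq>U. \<forall>x y f. continuous_map (subtopology X S) (G0 G) x \<longrightarrow> continuous_map (subtopology X S) (G0 G) y \<longrightarrow>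
        continuous_map (subtopology X S) (mor_top P) f \<longrightarrow>
        (\<forall>v\<in>S. dom P (f v) = act0 P (q v) (x v) \<and> cod P (f v) = act0 P (q v) (y v)) \<longrightarrow>
        (\<exists>g. continuous_map (subtopology X S) (G1 G) g \<and>
           (\<forall>v\<in>S. src G (g v) = x v \<and> tgt G (g v) = y v \<and> act1 P (idm P (q v)) (g v) = f v))) \<and>
     (\<forall>u\<in>U. \<forall>g\<in>topspace (G1 G). \<forall>h\<in>topspace (G1 G). src G g = src G h \<longrightarrow> tgt G g = tgt G h \<longrightarrow>
        act1 P (idm P (q u)) g = act1 P (idm P (q u)) h \<longrightarrow> g = h)"

text \<open>The clauses on objects and morphisms already range over all subsets \<open>S\<close> of
  \<open>U\<close>, so they pass to \<open>V\<close> unchanged.\<close>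

lemma chart_section_mono:
  "chart_section G X P \<pi> U q \<Longrightarrow> V \<subseteq> U \<Longrightarrow> chart_section G X P \<pi> V q"
proof -
  have *: "V \<subseteq> U \<Longrightarrow> \<forall>S\<subseteq>U. Q S \<Longrightarrow> \<forall>S\<subseteq>V. Q S" for Q by blast
  show "chart_section G X P \<pi> U q \<Longrightarrow> V \<subseteq> U \<Longrightarrow> chart_section G X P \<pi> V q"
    unfolding chart_section_def
    by (elim conjE, intro conjI; (erule (1) *)?) (auto intro: continuous_map_from_subtopology_mono)
qed

section \<open>Calculus in a \<open>\<G>\<close>-2-space\<close>

locale g2space = two_grp G for G :: "('a, 'b) two_group" +
  fixes P :: "('p0, 'p1, 'a, 'b) two_space"
  assumes G_2space: "G_2space G P"
begin

abbreviation "P0 \<equiv> topspace (ob_top P)"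
abbreviation "P1 \<equiv> topspace (mor_top P)"
abbreviation "\<d> \<equiv> dom P"
abbreviation "\<c> \<equiv> cod P"
abbreviation "id\<^sub>P \<equiv> idm P"
abbreviation then_cmp (infixr "\<Zsemi>" 60) where "f \<Zsemi> g \<equiv> cmp P f g"
abbreviation oact (infixl "\<triangleleft>" 75) where "p \<triangleleft> x \<equiv> act0 P p x"
abbreviation mact (infixl "\<lhd>" 75) where "f \<lhd> g \<equiv> act1 P f g"

lemma P_category: "top_category (ob_top P) (mor_top P) \<d> \<c> id\<^sub>P (cmp P)"
  using G_2space by (simp add: G_2space_def)

lemma P_closed [simp]: "f \<in> P1 \<Longrightarrow> \<d> f \<in> P0" "f \<in> P1 \<Longrightarrow> \<c> f \<in> P0" "p \<in> P0 \<Longrightarrow> id\<^sub>P p \<in> P1"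
  using P_category continuous_map_image_subset_topspace unfolding top_category_def by blast+

lemma dom_cod_idm [simp]: "p \<in> P0 \<Longrightarrow> \<d> (id\<^sub>P p) = p" "p \<in> P0 \<Longrightarrow> \<c> (id\<^sub>P p) = p"
  and cmp_closed [simp]: "f \<in> P1 \<Longrightarrow> g \<in> P1 \<Longrightarrow> \<c> f = \<d> g \<Longrightarrow> f \<Zsemi> g \<in> P1"
  and dom_cmp [simp]: "f \<in> P1 \<Longrightarrow> g \<in> P1 \<Longrightarrow> \<c> f = \<d> g \<Longrightarrow> \<d> (f \<Zsemi> g) = \<d> f"
  and cod_cmp [simp]: "f \<in> P1 \<Longrightarrow> g \<in> P1 \<Longrightarrow> \<c> f = \<d> g \<Longrightarrow> \<c> (f \<Zsemi> g) = \<c> g"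
  and cmp_assoc: "f \<in> P1 \<Longrightarrow> g \<in> P1 \<Longrightarrow> h \<in> P1 \<Longrightarrow> \<c> f = \<d> g \<Longrightarrow> \<c> g = \<d> h \<Longrightarrow>
     (f \<Zsemi> g) \<Zsemi> h = f \<Zsemi> (g \<Zsemi> h)"
  using P_category unfolding top_category_def by blast+

lemma cmp_idm [simp]: "f \<in> P1 \<Longrightarrow> p = \<d> f \<Longrightarrow> id\<^sub>P p \<Zsemi> f = f" "f \<in> P1 \<Longrightarrow> p = \<c> f \<Longrightarrow> f \<Zsemi> id\<^sub>P p = f"
  using P_category unfolding top_category_def by blast+

lemma act_closed [simp]:
  shows "p \<in> P0 \<Longrightarrow> x \<in> C0 \<Longrightarrow> p \<triangleleft> x \<in> P0" and "f \<in> P1 \<Longrightarrow> g \<in> C1 \<Longrightarrow> f \<lhd> g \<in> P1"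
proof -
  have c: "continuous_map (prod_topology (ob_top P) (G0 G)) (ob_top P) (\<lambda>(p, x). p \<triangleleft> x)"
    "continuous_map (prod_topology (mor_top P) (G1 G)) (mor_top P) (\<lambda>(f, g). f \<lhd> g)"
    using G_2space by (simp_all add: G_2space_def)
  show "p \<in> P0 \<Longrightarrow> x \<in> C0 \<Longrightarrow> p \<triangleleft> x \<in> P0"
    using continuous_map_image_subset_topspace[OF c(1)] by fastforce
  show "f \<in> P1 \<Longrightarrow> g \<in> C1 \<Longrightarrow> f \<lhd> g \<in> P1"
    using continuous_map_image_subset_topspace[OF c(2)] by fastforce
qed

lemma dom_act [simp]: "f \<in> P1 \<Longrightarrow> g \<in> C1 \<Longrightarrow> \<d> (f \<lhd> g) = \<d> f \<triangleleft> \<s> g"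
  and cod_act [simp]: "f \<in> P1 \<Longrightarrow> g \<in> C1 \<Longrightarrow> \<c> (f \<lhd> g) = \<c> f \<triangleleft> \<t> g"
  and idm_act: "p \<in> P0 \<Longrightarrow> x \<in> C0 \<Longrightarrow> id\<^sub>P p \<lhd> \<iota> x = id\<^sub>P (p \<triangleleft> x)"
  and cmp_act: "f1 \<in> P1 \<Longrightarrow> f2 \<in> P1 \<Longrightarrow> g1 \<in> C1 \<Longrightarrow> g2 \<in> C1 \<Longrightarrow> \<c> f1 = \<d> f2 \<Longrightarrow> \<t> g1 = \<s> g2 \<Longrightarrow>
     (f1 \<Zsemi> f2) \<lhd> (g1 \<star> g2) = (f1 \<lhd> g1 \<Zsemi> f2 \<lhd> g2)"
  and act_one [simp]: "p \<in> P0 \<Longrightarrow> p \<triangleleft> one0 G = p" "f \<in> P1 \<Longrightarrow> f \<lhd> one1 G = f"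
  and act_act [simp]: "p \<in> P0 \<Longrightarrow> x \<in> C0 \<Longrightarrow> y \<in> C0 \<Longrightarrow> p \<triangleleft> x \<triangleleft> y = p \<triangleleft> (x \<cdot> y)"
    "f \<in> P1 \<Longrightarrow> g \<in> C1 \<Longrightarrow> h \<in> C1 \<Longrightarrow> f \<lhd> g \<lhd> h = f \<lhd> (g \<odot> h)"
  using G_2space unfolding G_2space_def by blast+

lemma cmp_act_ident:
  "f \<in> P1 \<Longrightarrow> g \<in> P1 \<Longrightarrow> \<c> f = \<d> g \<Longrightarrow> x \<in> C0 \<Longrightarrow> (f \<Zsemi> g) \<lhd> \<iota> x = (f \<lhd> \<iota> x \<Zsemi> g \<lhd> \<iota> x)"
  using cmp_act[of f g "\<iota> x" "\<iota> x"] star_ident(1)[of "\<iota> x"] by simp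

lemma idm_act_star:
  "p \<in> P0 \<Longrightarrow> g \<in> C1 \<Longrightarrow> h \<in> C1 \<Longrightarrow> \<t> g = \<s> h \<Longrightarrow> id\<^sub>P p \<lhd> (g \<star> h) = (id\<^sub>P p \<lhd> g \<Zsemi> id\<^sub>P p \<lhd> h)"
  using cmp_act[of "id\<^sub>P p" "id\<^sub>P p" g h] by simp

lemma idm_oact: "p \<in> P0 \<Longrightarrow> x \<in> C0 \<Longrightarrow> g \<in> C1 \<Longrightarrow> id\<^sub>P (p \<triangleleft> x) \<lhd> g = id\<^sub>P p \<lhd> (\<iota> x \<odot> g)"
  by (simp flip: idm_act)

text \<open>The action is a functor on a product category, so acting by \<open>g\<close> on
  \<open>f\<close> can be done in either order: pad \<open>f\<close> with an identity on one side
  and \<open>g\<close> with an identity on the other. Together the two equations let a morphism of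
  \<open>\<G>\<close> slide past a morphism of \<open>P\<close>.\<close>

lemma act_split:
  assumes "f \<in> P1" "g \<in> C1"
  shows "f \<lhd> \<iota> (\<s> g) \<Zsemi> id\<^sub>P (\<c> f) \<lhd> g = f \<lhd> g" "id\<^sub>P (\<d> f) \<lhd> g \<Zsemi> f \<lhd> \<iota> (\<t> g) = f \<lhd> g"
  using cmp_act[of f "id\<^sub>P (\<c> f)" "\<iota> (\<s> g)" g] cmp_act[of "id\<^sub>P (\<d> f)" f g "\<iota> (\<t> g)"] assms
  by (simp_all add: star_ident)

lemma inverse_pair_cmp_cancel:
  assumes "inverse_pair P f f'" "g \<in> P1"
  shows "\<c> f = \<d> g \<Longrightarrow> f' \<Zsemi> f \<Zsemi> g = g" "\<c> g = \<d> f \<Longrightarrow> (g \<Zsemi> f) \<Zsemi> f' = g"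
  using assms cmp_assoc[of f' f g, symmetric] cmp_assoc[of g f f'] by (simp_all add: inverse_pair_def)

lemma inverse_pair_cancel:
  assumes "inverse_pair P f f'" "g \<in> P1" "h \<in> P1"
  shows "\<c> f = \<d> g \<Longrightarrow> \<c> f = \<d> h \<Longrightarrow> f \<Zsemi> g = f \<Zsemi> h \<Longrightarrow> g = h"
    and "\<c> g = \<d> f \<Longrightarrow> \<c> h = \<d> f \<Longrightarrow> g \<Zsemi> f = h \<Zsemi> f \<Longrightarrow> g = h"
  using assms inverse_pair_cmp_cancel by metis+

lemma inverse_pair_idempotent:
  assumes "inverse_pair P f f'" "\<c> f = \<d> f" "f \<Zsemi> f = f"
  shows "f = id\<^sub>P (\<d> f)"
  using assms inverse_pair_cancel(1)[OF assms(1), of f "id\<^sub>P (\<d> f)"] by (auto simp: inverse_pair_def)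

lemma inverse_pair_cmp:
  assumes "inverse_pair P f f'" "inverse_pair P g g'" "\<c> f = \<d> g"
  shows "inverse_pair P (f \<Zsemi> g) (g' \<Zsemi> f')"
proof -
  have f: "f \<in> P1" "f' \<in> P1" "\<d> f' = \<c> f" "\<c> f' = \<d> f" "f \<Zsemi> f' = id\<^sub>P (\<d> f)" "f' \<Zsemi> f = id\<^sub>P (\<c> f)"
    and g: "g \<in> P1" "g' \<in> P1" "\<d> g' = \<c> g" "\<c> g' = \<d> g" "g \<Zsemi> g' = id\<^sub>P (\<d> g)" "g' \<Zsemi> g = id\<^sub>P (\<c> g)"
    using assms by (auto simp: inverse_pair_def)
  have "(f \<Zsemi> g) \<Zsemi> g' \<Zsemi> f' = f \<Zsemi> (g \<Zsemi> g') \<Zsemi> f'"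
    using f g(1-4) assms(3) by (simp add: cmp_assoc)
  moreover have "(g' \<Zsemi> f') \<Zsemi> f \<Zsemi> g = g' \<Zsemi> (f' \<Zsemi> f) \<Zsemi> g"
    using f(1-4) g assms(3) by (simp add: cmp_assoc)
  ultimately show ?thesis using f g assms(3) by (simp add: inverse_pair_def)
qed

lemma inverse_pair_act:
  assumes "inverse_pair P f f'" "g \<in> C1"
  shows "inverse_pair P (f \<lhd> g) (f' \<lhd> ginv g)"
  using assms cmp_act[of f f' g "ginv g"] cmp_act[of f' f "ginv g" g]
  by (auto simp: inverse_pair_def idm_act)

lemma inverse_pair_idm: "p \<in> P0 \<Longrightarrow> inverse_pair P (id\<^sub>P p) (id\<^sub>P p)"
  by (simp add: inverse_pair_def)

lemma continuous_dom: "continuous_map Z (mor_top P) f \<Longrightarrow> continuous_map Z (ob_top P) (\<lambda>z. \<d> (f z))"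
  and continuous_cod: "continuous_map Z (mor_top P) f \<Longrightarrow> continuous_map Z (ob_top P) (\<lambda>z. \<c> (f z))"
  and continuous_idm: "continuous_map Z (ob_top P) h \<Longrightarrow> continuous_map Z (mor_top P) (\<lambda>z. id\<^sub>P (h z))"
  using P_category unfolding top_category_def by (metis continuous_map_compose_at)+

lemma continuous_cmp:
  assumes "continuous_map Z (mor_top P) f" "continuous_map Z (mor_top P) g"
    and "\<And>z. z \<in> topspace Z \<Longrightarrow> \<c> (f z) = \<d> (g z)"
  shows "continuous_map Z (mor_top P) (\<lambda>z. f z \<Zsemi> g z)"
proof -
  have "continuous_map Z (subtopology (prod_topology (mor_top P) (mor_top P))
      (composable_pairs (ob_top P) (mor_top P) \<d> \<c>)) (\<lambda>z. (f z, g z))"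
    using assms continuous_map_image_subset_topspace[OF assms(1)] continuous_map_image_subset_topspace[OF assms(2)]
    by (auto simp: continuous_map_in_subtopology continuous_map_paired composable_pairs_def)
  from continuous_map_compose_at[OF _ this, of "mor_top P" "\<lambda>(f, g). f \<Zsemi> g"] show ?thesis
    using P_category unfolding top_category_def by simp
qed

lemma continuous_act:
  shows "continuous_map Z (ob_top P) p \<Longrightarrow> continuous_map Z (G0 G) x \<Longrightarrow> continuous_map Z (ob_top P) (\<lambda>z. p z \<triangleleft> x z)"
    and "continuous_map Z (mor_top P) f \<Longrightarrow> continuous_map Z (G1 G) g \<Longrightarrow> continuous_map Z (mor_top P) (\<lambda>z. f z \<lhd> g z)"
  using continuous_map_compose_at[of "prod_topology (ob_top P) (G0 G)" "ob_top P" "\<lambda>(p, x). p \<triangleleft> x" Z "\<lambda>z. (p z, x z)"]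
    continuous_map_compose_at[of "prod_topology (mor_top P) (G1 G)" "mor_top P" "\<lambda>(f, g). f \<lhd> g" Z "\<lambda>z. (f z, g z)"]
    G_2space
  by (simp_all add: G_2space_def continuous_map_paired)

text \<open>The section is the image under \<open>\<psi>0\<close> of the unit section of the trivial
  bundle. The isomorphism \<open>\<alpha>\<close> from \<open>\<psi>\<phi>\<close> to the identity
  compares any \<open>p\<close> with a translate of \<open>q\<close>; the isomorphism
  \<open>\<beta>\<close> from \<open>\<phi>\<psi>\<close> to the identity makes
  \<open>\<psi>\<close> full and faithful. This is the standard argument for equivalences of
  categories, with every choice given by a continuous formula.\<close>

lemma chart_section_of_equiv:
  fixes X :: "'x topology" and \<pi> :: "'p0 \<Rightarrow> 'x"
  assumes U: "U \<subseteq> topspace X"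
    and over: "\<And>f. f \<in> P1 \<Longrightarrow> \<pi> (\<d> f) = \<pi> (\<c> f)" "\<And>p x. p \<in> P0 \<Longrightarrow> x \<in> C0 \<Longrightarrow> \<pi> (p \<triangleleft> x) = \<pi> p"
    and equiv: "G_equiv_over G (restrict_space P \<pi> U) \<pi> (trivial_space G X U) fst"
  shows "\<exists>q. chart_section G X P \<pi> U q"
proof -
  let ?P = "restrict_space P \<pi> U" and ?Q = "trivial_space G X U"
  obtain \<phi>0 \<phi>1 \<psi>0 \<psi>1 \<alpha> \<alpha>' \<beta> \<beta>' where \<phi>: "G_functor G ?P ?Q \<phi>0 \<phi>1" and \<psi>: "G_functor G ?Q ?P \<psi>0 \<psi>1"
    and \<phi>_over: "\<And>p. p \<in> P0 \<Longrightarrow> \<pi> p \<in> U \<Longrightarrow> fst (\<phi>0 p) = \<pi> p"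
    and \<psi>_over: "\<And>u x. u \<in> U \<Longrightarrow> x \<in> C0 \<Longrightarrow> \<pi> (\<psi>0 (u, x)) = u"
    and \<alpha>: "G0_nat_trans G ?P ?P (\<psi>0 \<circ> \<phi>0) (\<psi>1 \<circ> \<phi>1) id id \<alpha>"
    and \<alpha>': "G0_nat_trans G ?P ?P id id (\<psi>0 \<circ> \<phi>0) (\<psi>1 \<circ> \<phi>1) \<alpha>'"
    and \<alpha>\<alpha>': "\<And>p. p \<in> P0 \<Longrightarrow> \<pi> p \<in> U \<Longrightarrow> \<alpha> p \<Zsemi> \<alpha>' p = id\<^sub>P (\<psi>0 (\<phi>0 p)) \<and> \<alpha>' p \<Zsemi> \<alpha> p = id\<^sub>P p"
    and \<beta>: "G0_nat_trans G ?Q ?Q (\<phi>0 \<circ> \<psi>0) (\<phi>1 \<circ> \<psi>1) id id \<beta>"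
    and \<beta>': "G0_nat_trans G ?Q ?Q id id (\<phi>0 \<circ> \<psi>0) (\<phi>1 \<circ> \<psi>1) \<beta>'"
    and \<beta>\<beta>': "\<And>b. b \<in> U \<times> C0 \<Longrightarrow> cmp ?Q (\<beta> b) (\<beta>' b) = idm ?Q (\<phi>0 (\<psi>0 b)) \<and> cmp ?Q (\<beta>' b) (\<beta> b) = idm ?Q b"
    using equiv U unfolding G_equiv_over_def G0_nat_iso_def by (auto simp: Int_absorb1)
  note \<phi>D = G_functorD[OF \<phi>, simplified] and \<psi>D = G_functorD[OF \<psi>, simplified]
    and \<alpha>D = G0_nat_transD[OF \<alpha>, simplified] and \<alpha>'D = G0_nat_transD[OF \<alpha>', simplified]
    and \<beta>D = G0_nat_transD[OF \<beta>, simplified] and \<beta>'D = G0_nat_transD[OF \<beta>', simplified]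
  define q where "q u = \<psi>0 (u, one0 G)" for u
  have UX: "u \<in> U \<Longrightarrow> u \<in> topspace X" for u using U by auto
  have q [simp]: "q u \<in> P0" "\<pi> (q u) = u" if "u \<in> U" for u
    using \<psi>D(9)[of "(u, one0 G)"] \<psi>_over[of u "one0 G"] that UX by (auto simp: q_def)
  have q_act: "\<psi>0 (u, x) = q u \<triangleleft> x" if "u \<in> U" "x \<in> C0" for u x
    using \<psi>D(7)[of "(u, one0 G)" x] that UX by (simp add: q_def)
  have id_act: "\<psi>1 (u, g) = id\<^sub>P (q u) \<lhd> g" if "u \<in> U" "g \<in> C1" for u g
    using \<psi>D(5)[of "(u, one0 G)"] \<psi>D(8)[of "(u, one1 G)" g] that UX by (simp add: q_def)
  \<comment> \<open>Naturality gives \<open>\<alpha> (\<d> f) \<Zsemi> f\<close> in terms of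
    \<open>\<psi>1 (\<phi>1 f)\<close> alone, and \<open>\<alpha> (\<d> f)\<close> can be
    cancelled.\<close>
  have \<phi>_faithful: "f = f'" if f: "f \<in> P1" "f' \<in> P1" "\<pi> (\<d> f) \<in> U" "\<d> f = \<d> f'" "\<c> f = \<c> f'" "\<phi>1 f = \<phi>1 f'" for f f'
  proof -
    have "inverse_pair P (\<alpha> (\<d> f)) (\<alpha>' (\<d> f))"
      using f \<alpha>D(2-4) \<alpha>'D(2-4) \<alpha>\<alpha>' by (simp add: inverse_pair_def)
    moreover have "\<alpha> (\<d> f) \<Zsemi> f = \<alpha> (\<d> f) \<Zsemi> f'"
      using \<alpha>D(5)[of f] \<alpha>D(5)[of f'] f by simp
    ultimately show ?thesis
      using f \<alpha>D(4) by (intro inverse_pair_cancel(1)[of "\<alpha> (\<d> f)" "\<alpha>' (\<d> f)" f f']) simp_all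
  qed
  have B: "fst (\<beta> (u, x)) = u" "snd (\<beta> (u, x)) \<in> C1" "\<s> (snd (\<beta> (u, x))) = snd (\<phi>0 (q u \<triangleleft> x))"
      "\<t> (snd (\<beta> (u, x))) = x"
      "fst (\<beta>' (u, x)) = u" "snd (\<beta>' (u, x)) \<in> C1" "\<t> (snd (\<beta>' (u, x))) = snd (\<phi>0 (q u \<triangleleft> x))"
      "\<s> (snd (\<beta>' (u, x))) = x" "snd (\<beta> (u, x)) \<star> snd (\<beta>' (u, x)) = \<iota> (snd (\<phi>0 (q u \<triangleleft> x)))"
    if "u \<in> U" "x \<in> C0" for u x
    using \<beta>D(2-4)[of "(u, x)"] \<beta>'D(2-4)[of "(u, x)"] \<beta>\<beta>'[of "(u, x)"] that UX
    by (auto simp: q_act mem_Times_iff prod_eq_iff)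
  have \<beta>_nat: "snd (\<phi>1 (id\<^sub>P (q u) \<lhd> g)) \<star> snd (\<beta> (u, \<t> g)) = snd (\<beta> (u, \<s> g)) \<star> g" if "u \<in> U" "g \<in> C1" for u g
    using \<beta>D(5)[of "(u, g)"] that UX by (simp add: id_act)
  have \<phi>1: "fst (\<phi>1 f) = \<pi> (\<d> f)" "snd (\<phi>1 f) \<in> C1" "\<s> (snd (\<phi>1 f)) = snd (\<phi>0 (\<d> f))"
      "\<t> (snd (\<phi>1 f)) = snd (\<phi>0 (\<c> f))"
    if "f \<in> P1" "\<pi> (\<d> f) \<in> U" for f
    using \<phi>D(3,4,10)[of f] \<phi>_over[of "\<d> f"] that by (auto simp: mem_Times_iff prod_eq_iff)
  have "chart_section G X P \<pi> U q"
    unfolding chart_section_def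
  proof (intro conjI allI impI ballI)
    show "U \<subseteq> topspace X" by (fact U)
    have "continuous_map (prod_topology (subtopology X U) (G0 G)) (ob_top P) \<psi>0"
      using \<psi>D(1) by (simp add: continuous_map_in_subtopology)
    then show "continuous_map (subtopology X U) (ob_top P) q"
      unfolding q_def by (rule continuous_map_compose_at) (simp add: continuous_map_paired)
    show "\<pi> (q u) = u" if "u \<in> U" for u using that by simp
    show "\<exists>x s s'. continuous_map (subtopology X S) (G0 G) x \<and> continuous_map (subtopology X S) (mor_top P) s \<and>
           continuous_map (subtopology X S) (mor_top P) s' \<and>
           (\<forall>v\<in>S. inverse_pair P (s v) (s' v) \<and> \<d> (s v) = q v \<triangleleft> x v \<and> \<c> (s v) = p v)"
      if S: "S \<subseteq> U" and p: "continuous_map (subtopology X S) (ob_top P) p" "\<forall>v\<in>S. \<pi> (p v) = v" for S p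
    proof (intro exI conjI ballI)
      have p': "continuous_map (subtopology X S) (subtopology (ob_top P) {p. \<pi> p \<in> U}) p"
        using p S by (auto simp: continuous_map_in_subtopology)
      show "continuous_map (subtopology X S) (G0 G) (\<lambda>v. snd (\<phi>0 (p v)))"
        using continuous_map_compose_at[OF \<phi>D(1) p'] by (rule continuous_map_snd_at)
      show "continuous_map (subtopology X S) (mor_top P) (\<lambda>v. \<alpha> (p v))" "continuous_map (subtopology X S) (mor_top P) (\<lambda>v. \<alpha>' (p v))"
        using continuous_map_compose_at[OF \<alpha>D(1) p'] continuous_map_compose_at[OF \<alpha>'D(1) p']
        by (auto simp: continuous_map_in_subtopology)
      fix v assume v: "v \<in> S"
      have pv: "p v \<in> P0" "\<pi> (p v) = v" "v \<in> U"
        using continuous_map_closed[OF p(1), of v] p(2) v S UX by auto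
      show "inverse_pair P (\<alpha> (p v)) (\<alpha>' (p v))" "\<c> (\<alpha> (p v)) = p v"
        using pv \<alpha>D(2-4) \<alpha>'D(2-4) \<alpha>\<alpha>' by (simp_all add: inverse_pair_def)
      have "\<phi>0 (p v) = (v, snd (\<phi>0 (p v)))" "snd (\<phi>0 (p v)) \<in> C0"
        using \<phi>_over[of "p v"] \<phi>D(9)[of "p v"] pv by (auto simp: prod_eq_iff mem_Times_iff)
      then show "\<d> (\<alpha> (p v)) = q v \<triangleleft> snd (\<phi>0 (p v))"
        using \<alpha>D(3)[of "p v"] pv q_act[of v "snd (\<phi>0 (p v))"] by simp
    qed
    show "\<exists>g. continuous_map (subtopology X S) (G1 G) g \<and>
           (\<forall>v\<in>S. \<s> (g v) = x v \<and> \<t> (g v) = y v \<and> id\<^sub>P (q v) \<lhd> g v = f v)"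
      if S: "S \<subseteq> U" and c: "continuous_map (subtopology X S) (G0 G) x" "continuous_map (subtopology X S) (G0 G) y"
        "continuous_map (subtopology X S) (mor_top P) f" and f: "\<forall>v\<in>S. \<d> (f v) = q v \<triangleleft> x v \<and> \<c> (f v) = q v \<triangleleft> y v"
      for S x y f
    proof -
      have v: "v \<in> U" "x v \<in> C0" "y v \<in> C0" "f v \<in> P1" "\<d> (f v) = q v \<triangleleft> x v" "\<c> (f v) = q v \<triangleleft> y v" "\<pi> (\<d> (f v)) = v"
        "v \<in> topspace X" if "v \<in> S" for v
        using continuous_map_closed[OF c(1), of v] continuous_map_closed[OF c(2), of v]
          continuous_map_closed[OF c(3), of v] f S that UX by (auto simp: over subset_iff)
      \<comment> \<open>\<open>\<phi>1 (f v)\<close> runs between the images under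
        \<open>\<phi>0\<close> of \<open>q v \<triangleleft> x v\<close> and
        \<open>q v \<triangleleft> y v\<close>. The components of \<open>\<beta>'\<close> and
        \<open>\<beta>\<close> move its ends to \<open>x v\<close> and \<open>y v\<close>.\<close>
      define g where "g v = snd (\<beta>' (v, x v)) \<star> (snd (\<phi>1 (f v)) \<star> snd (\<beta> (v, y v)))" for v
      have st: "\<t> (snd (\<beta>' (v, x v))) = \<s> (snd (\<phi>1 (f v)))" "\<t> (snd (\<phi>1 (f v))) = \<s> (snd (\<beta> (v, y v)))" if "v \<in> S" for v
        using that by (simp_all add: B \<phi>1 v over(2))
      have idS: "continuous_map (subtopology X S) (subtopology X U) (\<lambda>v. v)"
        using S by (auto simp: continuous_map_in_subtopology)
      have cx: "continuous_map (subtopology X S) (prod_topology (subtopology X U) (G0 G)) (\<lambda>v. (v, x v))"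
         "continuous_map (subtopology X S) (prod_topology (subtopology X U) (G0 G)) (\<lambda>v. (v, y v))"
        using idS c by (simp_all add: continuous_map_paired)
      have cf: "continuous_map (subtopology X S) (subtopology (mor_top P) {f. \<pi> (\<d> f) \<in> U}) f"
        using c(3) v by (auto simp: continuous_map_in_subtopology)
      have "continuous_map (subtopology X S) (G1 G) g"
        unfolding g_def
      proof (intro continuous_star)
        show "continuous_map (subtopology X S) (G1 G) (\<lambda>v. snd (\<beta>' (v, x v)))"
          using continuous_map_compose_at[OF \<beta>'D(1) cx(1)] by (rule continuous_map_snd_at)
        show "continuous_map (subtopology X S) (G1 G) (\<lambda>v. snd (\<beta> (v, y v)))"
          using continuous_map_compose_at[OF \<beta>D(1) cx(2)] by (rule continuous_map_snd_at)
        show "continuous_map (subtopology X S) (G1 G) (\<lambda>v. snd (\<phi>1 (f v)))"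
          using continuous_map_compose_at[OF \<phi>D(2) cf] by (rule continuous_map_snd_at)
      qed (use st in \<open>simp_all add: B \<phi>1 v over(2)\<close>)
      moreover have "\<s> (g v) = x v \<and> \<t> (g v) = y v \<and> id\<^sub>P (q v) \<lhd> g v = f v" if vS: "v \<in> S" for v
      proof (intro conjI)
        note [simp] = v[OF vS] st[OF vS] B \<phi>1 over(2)
        have g1: "g v \<in> C1" by (simp add: g_def)
        show s: "\<s> (g v) = x v" and t: "\<t> (g v) = y v" by (simp_all add: g_def)
        \<comment> \<open>Naturality of \<open>\<beta>\<close> at \<open>g v\<close> shows that
          \<open>id\<^sub>P (q v) \<lhd> g v\<close> and \<open>f v\<close> have the same image
          under \<open>\<phi>1\<close>, after cancelling \<open>\<beta>\<close>; faithfulness of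
          \<open>\<phi>\<close> then identifies them.\<close>
        have "snd (\<phi>1 (id\<^sub>P (q v) \<lhd> g v)) \<star> snd (\<beta> (v, y v)) = snd (\<beta> (v, x v)) \<star> g v"
          using \<beta>_nat[of v "g v"] g1 s t by simp
        also have "\<dots> = (snd (\<beta> (v, x v)) \<star> snd (\<beta>' (v, x v))) \<star> (snd (\<phi>1 (f v)) \<star> snd (\<beta> (v, y v)))"
          unfolding g_def by (subst star_assoc) simp_all
        also have "\<dots> = snd (\<phi>1 (f v)) \<star> snd (\<beta> (v, y v))"
          using star_ident(1)[of "snd (\<phi>1 (f v)) \<star> snd (\<beta> (v, y v))"] by simp
        finally have "snd (\<phi>1 (id\<^sub>P (q v) \<lhd> g v)) = snd (\<phi>1 (f v))"
          by (rule star_cancel(2)[rotated 5]) (use g1 s t in \<open>simp_all\<close>)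
        then have "\<phi>1 (id\<^sub>P (q v) \<lhd> g v) = \<phi>1 (f v)"
          using g1 s by (simp add: prod_eq_iff)
        then show "id\<^sub>P (q v) \<lhd> g v = f v"
          by (rule \<phi>_faithful[rotated 5]) (use g1 s t in \<open>simp_all\<close>)
      qed
      ultimately show ?thesis by blast
    qed
    \<comment> \<open>By naturality \<open>\<beta> (u, \<s> g)\<close> composed with
      \<open>g\<close> depends only on \<open>id\<^sub>P (q u) \<lhd> g\<close> and
      \<open>\<t> g\<close>.\<close>
    show "g = h" if "u \<in> U" "g \<in> C1" "h \<in> C1" "\<s> g = \<s> h" "\<t> g = \<t> h" "id\<^sub>P (q u) \<lhd> g = id\<^sub>P (q u) \<lhd> h" for u g h
      by (rule star_cancel(1)[of "snd (\<beta> (u, \<s> g))"])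
        (use that \<beta>_nat[of u g] \<beta>_nat[of u h] B in auto)
  qed
  then show ?thesis by blast
qed

end

lemma principal_bundle_chart_section:
  assumes "top_2group G" and b: "principal_bundle G X P \<pi>" and u: "u \<in> topspace X"
  shows "\<exists>U q. openin X U \<and> u \<in> U \<and> chart_section G X P \<pi> U q"
proof -
  interpret g2space G P
    using assms by unfold_locales (simp_all add: principal_bundle_def)
  obtain \<U> where \<U>: "open_cover X \<U>" "\<And>U. U \<in> \<U> \<Longrightarrow> G_equiv_over G (restrict_space P \<pi> U) \<pi> (trivial_space G X U) fst"
    using b unfolding principal_bundle_def by blast
  then obtain U where U: "U \<in> \<U>" "u \<in> U" "openin X U" using u unfolding open_cover_def by blast
  have "\<exists>q. chart_section G X P \<pi> U q"
    using b by (intro chart_section_of_equiv \<U>(2) U(1) openin_subset[OF U(3)])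
      (auto simp: principal_bundle_def functor_to_discrete_def)
  then show ?thesis using U by blast
qed

section \<open>The cocycle of a bundle\<close>

text \<open>\<open>s\<^sub>i\<^sub>j \<colon> q\<^sub>i \<triangleleft> x\<^sub>i\<^sub>j \<rightarrow> q\<^sub>j\<close> compares the sections, and \<open>e\<^sub>i\<^sub>j\<^sub>k\<close> measures its failure to be transitive.\<close>
definition transition_data :: "('a, 'b) two_group \<Rightarrow> 'x topology \<Rightarrow> ('p0, 'p1, 'a, 'b) two_space \<Rightarrow> 'x set set
    \<Rightarrow> ('x set \<Rightarrow> 'x \<Rightarrow> 'p0) \<Rightarrow> ('x, 'a, 'b) cech_cochain \<Rightarrow> ('x set \<Rightarrow> 'x set \<Rightarrow> 'x \<Rightarrow> 'p1) \<Rightarrow> bool" where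
  "transition_data G X P \<V> q c s \<longleftrightarrow> cech_cocycle G X \<V> c \<and>
     (\<forall>i\<in>\<V>. \<forall>j\<in>\<V>. continuous_map (subtopology X (i \<inter> j)) (mor_top P) (s i j)) \<and>
     (\<forall>i\<in>\<V>. \<forall>j\<in>\<V>. \<forall>v\<in>i \<inter> j. (\<exists>s'. inverse_pair P (s i j v) s') \<and>
        dom P (s i j v) = act0 P (q i v) (fst c i j v) \<and> cod P (s i j v) = q j v) \<and>
     (\<forall>i\<in>\<V>. \<forall>j\<in>\<V>. \<forall>k\<in>\<V>. \<forall>v\<in>i \<inter> j \<inter> k.
        cmp P (act1 P (idm P (q i v)) (mult1 G (snd c i j k v) (ident G (mult0 G (fst c i j v) (fst c j k v))))) (s i k v)
        = cmp P (act1 P (s i j v) (ident G (fst c j k v))) (s j k v))"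

context g2space
begin

text \<open>The tetrahedron on \<open>i j k l\<close>. Both sides are the path along
  \<open>sij\<close>, \<open>sjk\<close>, \<open>skl\<close>, suitably translated, contracted once
  through the face \<open>ijk\<close> and once through the face \<open>jkl\<close>.\<close>

lemma transition_associative:
  assumes q: "qi \<in> P0" "qj \<in> P0" "qk \<in> P0" "ql \<in> P0"
    and x: "xij \<in> C0" "xjk \<in> C0" "xkl \<in> C0" "xik \<in> C0" "xil \<in> C0" "xjl \<in> C0"
    and s: "sij \<in> P1" "sjk \<in> P1" "skl \<in> P1" "sik \<in> P1" "sil \<in> P1" "sjl \<in> P1"
    and d: "\<d> sij = qi \<triangleleft> xij" "\<d> sjk = qj \<triangleleft> xjk" "\<d> skl = qk \<triangleleft> xkl" "\<d> sik = qi \<triangleleft> xik"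
      "\<d> sil = qi \<triangleleft> xil" "\<d> sjl = qj \<triangleleft> xjl"
    and c: "\<c> sij = qj" "\<c> sjk = qk" "\<c> skl = ql" "\<c> sik = qk" "\<c> sil = ql" "\<c> sjl = ql"
    and g: "gijk \<in> C1" "gikl \<in> C1" "gijl \<in> C1" "gjkl \<in> C1"
    and gs: "\<s> gijk = xij \<cdot> xjk" "\<s> gikl = xik \<cdot> xkl" "\<s> gijl = xij \<cdot> xjl" "\<s> gjkl = xjk \<cdot> xkl"
    and gt: "\<t> gijk = xik" "\<t> gikl = xil" "\<t> gijl = xil" "\<t> gjkl = xjl"
    and R: "id\<^sub>P qi \<lhd> gijk \<Zsemi> sik = (sij \<lhd> \<iota> xjk \<Zsemi> sjk)" "id\<^sub>P qi \<lhd> gikl \<Zsemi> sil = (sik \<lhd> \<iota> xkl \<Zsemi> skl)"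
      "id\<^sub>P qi \<lhd> gijl \<Zsemi> sil = (sij \<lhd> \<iota> xjl \<Zsemi> sjl)" "id\<^sub>P qj \<lhd> gjkl \<Zsemi> sjl = (sjk \<lhd> \<iota> xkl \<Zsemi> skl)"
  shows "id\<^sub>P qi \<lhd> ((gijk \<odot> \<iota> xkl) \<star> gikl) \<Zsemi> sil = id\<^sub>P qi \<lhd> ((\<iota> xij \<odot> gjkl) \<star> gijl) \<Zsemi> sil"
proof -
  note [simp] = q x s d c g gs gt
  have "id\<^sub>P qi \<lhd> ((gijk \<odot> \<iota> xkl) \<star> gikl) \<Zsemi> sil = id\<^sub>P qi \<lhd> (gijk \<odot> \<iota> xkl) \<Zsemi> (id\<^sub>P qi \<lhd> gikl \<Zsemi> sil)"
    by (simp add: idm_act_star cmp_assoc)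
  also have "\<dots> = (id\<^sub>P qi \<lhd> gijk \<Zsemi> sik) \<lhd> \<iota> xkl \<Zsemi> skl"
    unfolding R(2) by (simp add: cmp_act_ident cmp_assoc)
  also have "\<dots> = sij \<lhd> \<iota> (xjk \<cdot> xkl) \<Zsemi> (sjk \<lhd> \<iota> xkl \<Zsemi> skl)"
    unfolding R(1) by (simp add: cmp_act_ident cmp_assoc)
  also have "\<dots> = (sij \<lhd> \<iota> (\<s> gjkl) \<Zsemi> id\<^sub>P (\<c> sij) \<lhd> gjkl) \<Zsemi> sjl"
    unfolding R(4)[symmetric] by (simp add: cmp_assoc)
  \<comment> \<open>The only step that is not reassociation or a relation of a face:
    \<open>gjkl\<close> acts over \<open>qj\<close> and has to be carried across \<open>sij\<close>
    to act over \<open>qi\<close>, where it appears as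
    \<open>\<iota> xij \<odot> gjkl\<close>.\<close>
  also have "\<dots> = (id\<^sub>P (\<d> sij) \<lhd> gjkl \<Zsemi> sij \<lhd> \<iota> (\<t> gjkl)) \<Zsemi> sjl"
    using act_split[of sij gjkl] by (simp only: s g)
  also have "\<dots> = id\<^sub>P qi \<lhd> (\<iota> xij \<odot> gjkl) \<Zsemi> (sij \<lhd> \<iota> xjl \<Zsemi> sjl)"
    by (simp add: cmp_assoc idm_oact)
  also have "\<dots> = id\<^sub>P qi \<lhd> ((\<iota> xij \<odot> gjkl) \<star> gijl) \<Zsemi> sil"
    unfolding R(3)[symmetric] by (simp add: idm_act_star cmp_assoc)
  finally show ?thesis .
qed

lemma transition_data_exists:
  fixes X :: "'x topology" and \<pi> :: "'p0 \<Rightarrow> 'x"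
  assumes charts: "\<And>V. V \<in> \<V> \<Longrightarrow> chart_section G X P \<pi> V (q V)"
  shows "\<exists>c s. transition_data G X P \<V> q c s"
proof -
  have VX: "v \<in> topspace X" if "v \<in> i" "i \<in> \<V>" for v i
    using charts[OF that(2)] that(1) by (auto simp: chart_section_def)
  have qc: "continuous_map (subtopology X i) (ob_top P) (q i)" if "i \<in> \<V>" for i
    using charts[OF that] by (simp add: chart_section_def)
  have q [simp]: "q i v \<in> P0" "\<pi> (q i v) = v" if "i \<in> \<V>" "v \<in> i" for i v
    using charts[OF that(1)] continuous_map_closed[OF qc[OF that(1)], of v] VX that
    by (auto simp: chart_section_def)
  \<comment> \<open>The object clause of the chart of \<open>i\<close>, over
    \<open>S = i \<inter> j\<close> and with the section \<open>q j\<close> in the role of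
    \<open>p\<close>.\<close>
  have ex_s: "\<exists>x s s'. continuous_map (subtopology X (i \<inter> j)) (G0 G) x \<and> continuous_map (subtopology X (i \<inter> j)) (mor_top P) s \<and>
       continuous_map (subtopology X (i \<inter> j)) (mor_top P) s' \<and>
       (\<forall>v\<in>i \<inter> j. inverse_pair P (s v) (s' v) \<and> \<d> (s v) = q i v \<triangleleft> x v \<and> \<c> (s v) = q j v)"
    if ij: "i \<in> \<V>" "j \<in> \<V>" for i j
  proof -
    have "continuous_map (subtopology X (i \<inter> j)) (ob_top P) (q j)"
      using qc[OF ij(2)] by (rule continuous_map_from_subtopology_mono) auto
    moreover have "\<forall>v\<in>i \<inter> j. \<pi> (q j v) = v" using ij by simp
    moreover have "i \<inter> j \<subseteq> i" by auto
    ultimately show ?thesis using charts[OF ij(1)] unfolding chart_section_def by metis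
  qed
  define Q where "Q i j x s s' \<longleftrightarrow>
       continuous_map (subtopology X (i \<inter> j)) (G0 G) x \<and> continuous_map (subtopology X (i \<inter> j)) (mor_top P) s \<and>
       continuous_map (subtopology X (i \<inter> j)) (mor_top P) s' \<and>
       (\<forall>v\<in>i \<inter> j. inverse_pair P (s v) (s' v) \<and> \<d> (s v) = q i v \<triangleleft> x v \<and> \<c> (s v) = q j v)" for i j x s s'
  have "\<forall>i\<in>\<V>. \<forall>j\<in>\<V>. \<exists>x s s'. Q i j x s s'"
    unfolding Q_def using ex_s by simp
  then obtain x s s' where "\<And>i j. i \<in> \<V> \<Longrightarrow> j \<in> \<V> \<Longrightarrow> Q i j (x i j) (s i j) (s' i j)"
    by metis
  then have xc: "\<And>i j. i \<in> \<V> \<Longrightarrow> j \<in> \<V> \<Longrightarrow> continuous_map (subtopology X (i \<inter> j)) (G0 G) (x i j)"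
    and sc: "\<And>i j. i \<in> \<V> \<Longrightarrow> j \<in> \<V> \<Longrightarrow> continuous_map (subtopology X (i \<inter> j)) (mor_top P) (s i j)"
    and s'c: "\<And>i j. i \<in> \<V> \<Longrightarrow> j \<in> \<V> \<Longrightarrow> continuous_map (subtopology X (i \<inter> j)) (mor_top P) (s' i j)"
    and ss': "\<And>i j v. i \<in> \<V> \<Longrightarrow> j \<in> \<V> \<Longrightarrow> v \<in> i \<Longrightarrow> v \<in> j \<Longrightarrow> inverse_pair P (s i j v) (s' i j v)"
    and sd: "\<And>i j v. i \<in> \<V> \<Longrightarrow> j \<in> \<V> \<Longrightarrow> v \<in> i \<Longrightarrow> v \<in> j \<Longrightarrow> \<d> (s i j v) = q i v \<triangleleft> x i j v"
    and scod: "\<And>i j v. i \<in> \<V> \<Longrightarrow> j \<in> \<V> \<Longrightarrow> v \<in> i \<Longrightarrow> v \<in> j \<Longrightarrow> \<c> (s i j v) = q j v"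
    unfolding Q_def by simp_all
  have x: "x i j v \<in> C0" if "i \<in> \<V>" "j \<in> \<V>" "v \<in> i" "v \<in> j" for i j v
    using continuous_map_closed[OF xc[OF that(1,2)], of v] VX that by simp
  have s: "s i j v \<in> P1" "s' i j v \<in> P1" "\<d> (s' i j v) = q j v" "\<c> (s' i j v) = q i v \<triangleleft> x i j v"
    if "i \<in> \<V>" "j \<in> \<V>" "v \<in> i" "v \<in> j" for i j v
    using ss'[OF that] sd[OF that] scod[OF that] by (auto simp: inverse_pair_def)
  note [simp] = x s sd scod VX
  \<comment> \<open>The morphism clause of the chart of \<open>i\<close>, applied to the loop along
    \<open>s i j\<close>, \<open>s j k\<close> and back along the inverse of \<open>s i k\<close>.
    Its ends are translates of \<open>q i v\<close>.\<close>
  have ex_g: "\<exists>g. continuous_map (subtopology X (i \<inter> j \<inter> k)) (G1 G) g \<and>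
      (\<forall>v\<in>i \<inter> j \<inter> k. \<s> (g v) = x i j v \<cdot> x j k v \<and> \<t> (g v) = x i k v \<and>
        id\<^sub>P (q i v) \<lhd> g v = (s i j v \<lhd> \<iota> (x j k v) \<Zsemi> s j k v) \<Zsemi> s' i k v)"
    if ijk: "i \<in> \<V>" "j \<in> \<V>" "k \<in> \<V>" for i j k
  proof -
    let ?T = "subtopology X (i \<inter> j \<inter> k)"
    have c: "continuous_map ?T (G0 G) (x i j)" "continuous_map ?T (G0 G) (x j k)" "continuous_map ?T (G0 G) (x i k)"
       "continuous_map ?T (mor_top P) (s i j)" "continuous_map ?T (mor_top P) (s j k)" "continuous_map ?T (mor_top P) (s' i k)"
      using ijk by (auto intro: continuous_map_from_subtopology_mono[OF xc] continuous_map_from_subtopology_mono[OF sc]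
          continuous_map_from_subtopology_mono[OF s'c])
    have "continuous_map ?T (G0 G) (\<lambda>v. x i j v \<cdot> x j k v)"
      using c by (intro continuous_rules)
    moreover have "continuous_map ?T (mor_top P) (\<lambda>v. (s i j v \<lhd> \<iota> (x j k v) \<Zsemi> s j k v) \<Zsemi> s' i k v)"
      using c ijk by (intro continuous_cmp continuous_act continuous_rules) auto
    moreover have "\<forall>v\<in>i \<inter> j \<inter> k. \<d> ((s i j v \<lhd> \<iota> (x j k v) \<Zsemi> s j k v) \<Zsemi> s' i k v) = q i v \<triangleleft> (x i j v \<cdot> x j k v) \<and>
         \<c> ((s i j v \<lhd> \<iota> (x j k v) \<Zsemi> s j k v) \<Zsemi> s' i k v) = q i v \<triangleleft> x i k v"
      using ijk by simp
    moreover have "i \<inter> j \<inter> k \<subseteq> i" by auto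
    moreover have "\<forall>S\<subseteq>i. \<forall>x y f. continuous_map (subtopology X S) (G0 G) x \<longrightarrow> continuous_map (subtopology X S) (G0 G) y \<longrightarrow>
        continuous_map (subtopology X S) (mor_top P) f \<longrightarrow>
        (\<forall>v\<in>S. \<d> (f v) = q i v \<triangleleft> x v \<and> \<c> (f v) = q i v \<triangleleft> y v) \<longrightarrow>
        (\<exists>g. continuous_map (subtopology X S) (G1 G) g \<and>
           (\<forall>v\<in>S. \<s> (g v) = x v \<and> \<t> (g v) = y v \<and> id\<^sub>P (q i v) \<lhd> g v = f v))"
      using charts[OF ijk(1)] by (simp add: chart_section_def)
    ultimately show ?thesis
      using c(3) by (elim allE[of _ "i \<inter> j \<inter> k"] impE) blast+
  qed
  define R where "R i j k g \<longleftrightarrow> continuous_map (subtopology X (i \<inter> j \<inter> k)) (G1 G) g \<and>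
      (\<forall>v\<in>i \<inter> j \<inter> k. \<s> (g v) = x i j v \<cdot> x j k v \<and> \<t> (g v) = x i k v \<and>
        id\<^sub>P (q i v) \<lhd> g v = (s i j v \<lhd> \<iota> (x j k v) \<Zsemi> s j k v) \<Zsemi> s' i k v)" for i j k g
  have "\<forall>i\<in>\<V>. \<forall>j\<in>\<V>. \<forall>k\<in>\<V>. \<exists>g. R i j k g"
    unfolding R_def using ex_g by simp
  then obtain g where "\<And>i j k. i \<in> \<V> \<Longrightarrow> j \<in> \<V> \<Longrightarrow> k \<in> \<V> \<Longrightarrow> R i j k (g i j k)"
    by metis
  then have gc: "\<And>i j k. i \<in> \<V> \<Longrightarrow> j \<in> \<V> \<Longrightarrow> k \<in> \<V> \<Longrightarrow> continuous_map (subtopology X (i \<inter> j \<inter> k)) (G1 G) (g i j k)"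
    and gP: "\<And>i j k v. i \<in> \<V> \<Longrightarrow> j \<in> \<V> \<Longrightarrow> k \<in> \<V> \<Longrightarrow> v \<in> i \<Longrightarrow> v \<in> j \<Longrightarrow> v \<in> k \<Longrightarrow>
      \<s> (g i j k v) = x i j v \<cdot> x j k v \<and> \<t> (g i j k v) = x i k v \<and>
        id\<^sub>P (q i v) \<lhd> g i j k v = (s i j v \<lhd> \<iota> (x j k v) \<Zsemi> s j k v) \<Zsemi> s' i k v"
    unfolding R_def by simp_all
  have g: "g i j k v \<in> C1" "\<s> (g i j k v) = x i j v \<cdot> x j k v" "\<t> (g i j k v) = x i k v"
    "id\<^sub>P (q i v) \<lhd> g i j k v \<Zsemi> s i k v = (s i j v \<lhd> \<iota> (x j k v) \<Zsemi> s j k v)"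
    if ijk: "i \<in> \<V>" "j \<in> \<V>" "k \<in> \<V>" and v: "v \<in> i" "v \<in> j" "v \<in> k" for i j k v
  proof -
    show "g i j k v \<in> C1" using continuous_map_closed[OF gc[OF ijk], of v] ijk v by simp
    show "\<s> (g i j k v) = x i j v \<cdot> x j k v" "\<t> (g i j k v) = x i k v" using gP[OF ijk v] by auto
    have "(s i j v \<lhd> \<iota> (x j k v) \<Zsemi> s j k v) \<Zsemi> s' i k v \<Zsemi> s i k v = (s i j v \<lhd> \<iota> (x j k v) \<Zsemi> s j k v)"
      using ss'[of i k v] ijk v by (simp add: inverse_pair_def)
    then show "id\<^sub>P (q i v) \<lhd> g i j k v \<Zsemi> s i k v = (s i j v \<lhd> \<iota> (x j k v) \<Zsemi> s j k v)"
      using gP[OF ijk v] ijk v by (simp add: cmp_assoc)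
  qed
  \<comment> \<open>Dividing by the identity of the source moves the source to the unit, which puts
    \<open>e\<close> into \<open>\<E>\<close>, and turns the target \<open>x i k v\<close> into the
    defect of multiplicativity of \<open>x\<close>.\<close>
  define e where "e i j k v = g i j k v \<odot> i1 (\<iota> (x i j v \<cdot> x j k v))" for i j k v
  have e_eq: "e i j k v \<odot> \<iota> (x i j v \<cdot> x j k v) = g i j k v" and e: "e i j k v \<in> C1"
    if "i \<in> \<V>" "j \<in> \<V>" "k \<in> \<V>" "v \<in> i" "v \<in> j" "v \<in> k" for i j k v
    using that g[OF that] by (simp_all add: e_def)
  have "cech_cocycle G X \<V> (x, e)"
    unfolding cech_cocycle_def prod.case continuous_E_top
  proof (intro conjI ballI)
    show "continuous_map (subtopology X (i \<inter> j)) (G0 G) (x i j)" if "i \<in> \<V>" "j \<in> \<V>" for i j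
      by (rule xc[OF that])
    show "continuous_map (subtopology X (i \<inter> j \<inter> k)) (G1 G) (e i j k)" if "i \<in> \<V>" "j \<in> \<V>" "k \<in> \<V>" for i j k
      unfolding e_def using that
      by (intro continuous_rules gc) (auto intro: continuous_map_from_subtopology_mono[OF xc])
    show "\<s> (e i j k v) = one0 G" if "i \<in> \<V>" "j \<in> \<V>" "k \<in> \<V>" "v \<in> topspace (subtopology X (i \<inter> j \<inter> k))" for i j k v
      using that g[of i j k v] by (simp add: e_def)
    show "mult0 G (mult0 G (\<t> (e i j k v)) (x i j v)) (x j k v) = x i k v"
      if "i \<in> \<V>" "j \<in> \<V>" "k \<in> \<V>" "v \<in> topspace X \<inter> i \<inter> j \<inter> k" for i j k v
      using that g[of i j k v] by (simp add: e_def)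
    show "e i k l v \<odot> e i j k v = e i j l v \<odot> conjE G (x i j v) (e j k l v)"
      if ijkl: "i \<in> \<V>" "j \<in> \<V>" "k \<in> \<V>" "l \<in> \<V>" and v: "v \<in> topspace X \<inter> i \<inter> j \<inter> k \<inter> l" for i j k l v
    proof -
      have v': "v \<in> i" "v \<in> j" "v \<in> k" "v \<in> l" using v by auto
      note [simp] = ijkl v' g(1-3)
      have "id\<^sub>P (q i v) \<lhd> ((g i j k v \<odot> \<iota> (x k l v)) \<star> g i k l v) \<Zsemi> s i l v
          = id\<^sub>P (q i v) \<lhd> ((\<iota> (x i j v) \<odot> g j k l v) \<star> g i j l v) \<Zsemi> s i l v"
        by (rule transition_associative[where qj = "q j v" and qk = "q k v" and ql = "q l v" and xjk = "x j k v"
              and sij = "s i j v" and sjk = "s j k v" and skl = "s k l v" and sik = "s i k v" and sjl = "s j l v"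
              and xik = "x i k v" and xjl = "x j l v" and xil = "x i l v"])
          (simp_all add: g(4))
      then have "id\<^sub>P (q i v) \<lhd> ((g i j k v \<odot> \<iota> (x k l v)) \<star> g i k l v)
          = id\<^sub>P (q i v) \<lhd> ((\<iota> (x i j v) \<odot> g j k l v) \<star> g i j l v)"
        by (rule inverse_pair_cancel(2)[OF ss'[of i l v], rotated -1]) simp_all
      \<comment> \<open>After \<open>s i l v\<close> has been cancelled, the uniqueness clause of
        the chart of \<open>i\<close> turns an equality of morphisms over \<open>q i v\<close> into
        one in \<open>\<G>\<close>. Dividing by the identity of the common source then gives the
        cocycle identity.\<close>
      then have G: "(g i j k v \<odot> \<iota> (x k l v)) \<star> g i k l v = (\<iota> (x i j v) \<odot> g j k l v) \<star> g i j l v"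
        using charts[OF ijkl(1)] v'(1) unfolding chart_section_def by (elim conjE ballE[of _ _ v]) auto
      show ?thesis
        using arg_cong[OF G, of "\<lambda>w. w \<odot> i1 (\<iota> (x i j v \<cdot> x j k v \<cdot> x k l v))"]
        unfolding e_def conjE_def by (simp add: star_eq)
    qed
  qed
  moreover have "\<forall>i\<in>\<V>. \<forall>j\<in>\<V>. \<forall>v\<in>i \<inter> j. (\<exists>s'. inverse_pair P (s i j v) s') \<and>
        \<d> (s i j v) = q i v \<triangleleft> x i j v \<and> \<c> (s i j v) = q j v"
    using ss' by auto
  moreover have "\<forall>i\<in>\<V>. \<forall>j\<in>\<V>. \<forall>k\<in>\<V>. \<forall>v\<in>i \<inter> j \<inter> k.
      id\<^sub>P (q i v) \<lhd> (e i j k v \<odot> \<iota> (x i j v \<cdot> x j k v)) \<Zsemi> s i k v = (s i j v \<lhd> \<iota> (x j k v) \<Zsemi> s j k v)"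
    using e_eq g(4) by auto
  ultimately have "transition_data G X P \<V> q (x, e) s"
    using sc by (simp add: transition_data_def)
  then show ?thesis by blast
qed

end

section \<open>The bundle of a cocycle\<close>

text \<open>Continuity of composition is asked for pairs of continuous maps from a test space. This
  suits the piecewise arguments below; the space of composable pairs with its two projections is the
  instance that matters, which fixes the type of \<open>Z\<close>.\<close>

lemma top_categoryI:
  fixes T1 :: "'m topology"
  assumes "continuous_map T1 T0 s" "continuous_map T1 T0 t" "continuous_map T0 T1 u"
    and cmp: "\<And>Z :: ('m \<times> 'm) topology. \<And>f g. continuous_map Z T1 f \<Longrightarrow> continuous_map Z T1 g \<Longrightarrow>
      (\<And>z. z \<in> topspace Z \<Longrightarrow> t (f z) = s (g z)) \<Longrightarrow> continuous_map Z T1 (\<lambda>z. c (f z) (g z))"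
    and "\<And>x. x \<in> topspace T0 \<Longrightarrow> s (u x) = x \<and> t (u x) = x"
    and "\<And>f g. f \<in> topspace T1 \<Longrightarrow> g \<in> topspace T1 \<Longrightarrow> t f = s g \<Longrightarrow>
         c f g \<in> topspace T1 \<and> s (c f g) = s f \<and> t (c f g) = t g"
    and "\<And>f. f \<in> topspace T1 \<Longrightarrow> c (u (s f)) f = f \<and> c f (u (t f)) = f"
    and "\<And>f g h. f \<in> topspace T1 \<Longrightarrow> g \<in> topspace T1 \<Longrightarrow> h \<in> topspace T1 \<Longrightarrow> t f = s g \<Longrightarrow> t g = s h \<Longrightarrow>
         c (c f g) h = c f (c g h)"
  shows "top_category T0 T1 s t u c"
proof -
  let ?Z = "subtopology (prod_topology T1 T1) (composable_pairs T0 T1 s t)"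
  have "continuous_map ?Z T1 (\<lambda>z. c (fst z) (snd z))"
    by (rule cmp)
      (auto simp: composable_pairs_def intro: continuous_map_from_subtopology continuous_map_fst continuous_map_snd)
  then show ?thesis
    using assms unfolding top_category_def by (simp add: case_prod_unfold)
qed

lemma G_2spaceI:
  assumes "top_category (ob_top P) (mor_top P) (dom P) (cod P) (idm P) (cmp P)"
    and "continuous_map (prod_topology (ob_top P) (G0 G)) (ob_top P) (\<lambda>z. act0 P (fst z) (snd z))"
    and "continuous_map (prod_topology (mor_top P) (G1 G)) (mor_top P) (\<lambda>z. act1 P (fst z) (snd z))"
    and "\<And>f g. f \<in> topspace (mor_top P) \<Longrightarrow> g \<in> topspace (G1 G) \<Longrightarrow>
        dom P (act1 P f g) = act0 P (dom P f) (src G g) \<and> cod P (act1 P f g) = act0 P (cod P f) (tgt G g)"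
    and "\<And>p x. p \<in> topspace (ob_top P) \<Longrightarrow> x \<in> topspace (G0 G) \<Longrightarrow> act1 P (idm P p) (ident G x) = idm P (act0 P p x)"
    and "\<And>f1 f2 g1 g2. f1 \<in> topspace (mor_top P) \<Longrightarrow> f2 \<in> topspace (mor_top P) \<Longrightarrow> g1 \<in> topspace (G1 G) \<Longrightarrow>
        g2 \<in> topspace (G1 G) \<Longrightarrow> cod P f1 = dom P f2 \<Longrightarrow> tgt G g1 = src G g2 \<Longrightarrow>
        act1 P (cmp P f1 f2) (gcomp G g1 g2) = cmp P (act1 P f1 g1) (act1 P f2 g2)"
    and "\<And>p. p \<in> topspace (ob_top P) \<Longrightarrow> act0 P p (one0 G) = p"
    and "\<And>p x y. p \<in> topspace (ob_top P) \<Longrightarrow> x \<in> topspace (G0 G) \<Longrightarrow> y \<in> topspace (G0 G) \<Longrightarrow>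
        act0 P (act0 P p x) y = act0 P p (mult0 G x y)"
    and "\<And>f. f \<in> topspace (mor_top P) \<Longrightarrow> act1 P f (one1 G) = f"
    and "\<And>f g h. f \<in> topspace (mor_top P) \<Longrightarrow> g \<in> topspace (G1 G) \<Longrightarrow> h \<in> topspace (G1 G) \<Longrightarrow>
        act1 P (act1 P f g) h = act1 P f (mult1 G g h)"
  shows "G_2space G P"
  using assms unfolding G_2space_def by (simp add: case_prod_unfold)

lemma (in two_grp) G_2space_trivial: "G_2space G (trivial_space G X U)"
proof -
  note [continuous_intros] = continuous_map_fst_at continuous_map_snd_at continuous_rules
  have id: "continuous_map T T (\<lambda>z. z)" for T :: "'z topology" by simp
  show ?thesis
  proof (rule G_2spaceI)
    show "top_category (ob_top (trivial_space G X U)) (mor_top (trivial_space G X U)) (dom (trivial_space G X U))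
       (cod (trivial_space G X U)) (idm (trivial_space G X U)) (cmp (trivial_space G X U))"
      unfolding trivial_space_simps
      by (rule top_categoryI; (intro continuous_map_pairedI continuous_intros continuous_star)?)
        (auto simp: star_ident star_assoc mem_Times_iff intro: continuous_map_fst continuous_map_snd
          continuous_src continuous_tgt continuous_ident)
  qed (auto simp: mem_Times_iff interchange intro!: continuous_map_pairedI continuous_rules
      continuous_map_fst_at continuous_map_snd_at id)
qed

context g2space
begin

lemma G_2space_restrict:
  fixes \<pi> :: "'p0 \<Rightarrow> 'x"
  assumes over: "\<And>f. f \<in> P1 \<Longrightarrow> \<pi> (\<d> f) = \<pi> (\<c> f)" "\<And>p x. p \<in> P0 \<Longrightarrow> x \<in> C0 \<Longrightarrow> \<pi> (p \<triangleleft> x) = \<pi> p"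
  shows "G_2space G (restrict_space P \<pi> U)"
proof (rule G_2spaceI)
  let ?R = "restrict_space P \<pi> U"
  have sub: "continuous_map (subtopology (ob_top P) S) (ob_top P) (\<lambda>z. z)"
    "continuous_map (subtopology (mor_top P) T) (mor_top P) (\<lambda>z. z)" for S T
    by (rule continuous_map_from_subtopology, simp)+
  show "top_category (ob_top ?R) (mor_top ?R) (dom ?R) (cod ?R) (idm ?R) (cmp ?R)"
    unfolding restrict_space_simps
  proof (rule top_categoryI)
    show "continuous_map (subtopology (mor_top P) {f. \<pi> (\<d> f) \<in> U}) (subtopology (ob_top P) {p. \<pi> p \<in> U}) \<d>"
      "continuous_map (subtopology (mor_top P) {f. \<pi> (\<d> f) \<in> U}) (subtopology (ob_top P) {p. \<pi> p \<in> U}) \<c>"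
      "continuous_map (subtopology (ob_top P) {p. \<pi> p \<in> U}) (subtopology (mor_top P) {f. \<pi> (\<d> f) \<in> U}) id\<^sub>P"
      using continuous_dom[OF sub(2)] continuous_cod[OF sub(2)] continuous_idm[OF sub(1)]
      by (auto simp: continuous_map_in_subtopology over(1))
    show "continuous_map Z (subtopology (mor_top P) {f. \<pi> (\<d> f) \<in> U}) (\<lambda>z. f z \<Zsemi> g z)"
      if "continuous_map Z (subtopology (mor_top P) {f. \<pi> (\<d> f) \<in> U}) f"
        "continuous_map Z (subtopology (mor_top P) {f. \<pi> (\<d> f) \<in> U}) g"
        "\<And>z. z \<in> topspace Z \<Longrightarrow> \<c> (f z) = \<d> (g z)" for Z :: "('p1 \<times> 'p1) topology" and f g
      using that continuous_cmp[of Z f g] continuous_map_closed[OF that(1)] continuous_map_closed[OF that(2)]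
      by (auto simp: continuous_map_in_subtopology)
  qed (auto simp: cmp_assoc over)
  show "continuous_map (prod_topology (ob_top ?R) (G0 G)) (ob_top ?R) (\<lambda>z. act0 ?R (fst z) (snd z))"
    using continuous_act(1)[OF continuous_map_compose_at[OF sub(1) continuous_map_fst] continuous_map_snd]
    by (auto simp: continuous_map_in_subtopology over)
  show "continuous_map (prod_topology (mor_top ?R) (G1 G)) (mor_top ?R) (\<lambda>z. act1 ?R (fst z) (snd z))"
    using continuous_act(2)[OF continuous_map_compose_at[OF sub(2) continuous_map_fst] continuous_map_snd]
    by (auto simp: continuous_map_in_subtopology over)
qed (auto simp: idm_act cmp_act)

lemma inverse_pair_unique:
  assumes g: "inverse_pair P f g" and h: "inverse_pair P f h"
  shows "g = h"
proof (rule inverse_pair_cancel(1)[OF g])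
  show "f \<Zsemi> g = f \<Zsemi> h" using g h unfolding inverse_pair_def by (elim conjE) (rule trans[OF _ sym])
qed (use g h in \<open>simp_all add: inverse_pair_def\<close>)

end

lemma G_functor_comp:
  assumes "G_functor G P Q F0 F1" "G_functor G Q R H0 H1"
  shows "G_functor G P R (H0 \<circ> F0) (H1 \<circ> F1)"
proof -
  note F = G_functorD[OF assms(1)] and H = G_functorD[OF assms(2)]
  show ?thesis
    unfolding G_functor_def
    using continuous_map_compose[OF F(1) H(1)] continuous_map_compose[OF F(2) H(2)] by (simp add: F H)
qed

lemma G_functor_id: "G_functor G P P id id"
  by (simp add: G_functor_def id_def)

text \<open>Naturality of the pointwise inverse follows by conjugating the square of
  \<open>\<alpha>\<close>. Its equivariance follows from uniqueness of inverses, since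
  \<open>ginv\<close> fixes identities of \<open>\<G>\<close>.\<close>

lemma G0_nat_isoI:
  assumes "top_2group G" "G_2space G P" "G_2space G Q" "G_functor G P Q F0 F1" "G_functor G P Q F0' F1'"
    and \<alpha>: "G0_nat_trans G P Q F0 F1 F0' F1' \<alpha>"
    and \<beta>: "continuous_map (ob_top P) (mor_top Q) \<beta>" "\<And>p. p \<in> topspace (ob_top P) \<Longrightarrow> inverse_pair Q (\<alpha> p) (\<beta> p)"
  shows "G0_nat_iso G P Q F0 F1 F0' F1'"
proof -
  interpret P: g2space G P using assms by unfold_locales
  interpret Q: g2space G Q using assms by unfold_locales
  note F = G_functorD[OF assms(4)] and F' = G_functorD[OF assms(5)] and A = G0_nat_transD[OF \<alpha>]
  have B: "\<beta> p \<in> topspace (mor_top Q)" "dom Q (\<beta> p) = F0' p" "cod Q (\<beta> p) = F0 p"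
    "cmp Q (\<alpha> p) (\<beta> p) = idm Q (F0 p)" "cmp Q (\<beta> p) (\<alpha> p) = idm Q (F0' p)" if "p \<in> topspace (ob_top P)" for p
    using \<beta>(2)[OF that] A(3,4)[OF that] by (auto simp: inverse_pair_def)
  have "G0_nat_trans G P Q F0' F1' F0 F1 \<beta>"
    unfolding G0_nat_trans_def
  proof (intro conjI ballI)
    fix f assume f [simp]: "f \<in> topspace (mor_top P)"
    note [simp] = A(2-4) B(1-3) F F'
    have "cmp Q (F1' f) (\<beta> (cod P f)) = cmp Q (cmp Q (\<beta> (dom P f)) (\<alpha> (dom P f))) (cmp Q (F1' f) (\<beta> (cod P f)))"
      by (simp add: B)
    also have "\<dots> = cmp Q (\<beta> (dom P f)) (cmp Q (cmp Q (\<alpha> (dom P f)) (F1' f)) (\<beta> (cod P f)))"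
      by (simp add: Q.cmp_assoc)
    also have "\<dots> = cmp Q (\<beta> (dom P f)) (cmp Q (F1 f) (cmp Q (\<alpha> (cod P f)) (\<beta> (cod P f))))"
      by (simp add: Q.cmp_assoc flip: A(5))
    also have "\<dots> = cmp Q (\<beta> (dom P f)) (F1 f)" by (simp add: B)
    finally show "cmp Q (F1' f) (\<beta> (cod P f)) = cmp Q (\<beta> (dom P f)) (F1 f)" .
  next
    fix p x assume p: "p \<in> topspace (ob_top P)" and x: "x \<in> topspace (G0 G)"
    have "inverse_pair Q (act1 Q (\<alpha> p) (ident G x)) (act1 Q (\<beta> p) (P.ginv (ident G x)))"
      using \<beta>(2)[OF p] x by (intro Q.inverse_pair_act) simp_all
    moreover have "P.ginv (ident G x) = ident G x" using x by (simp add: P.ginv_def)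
    moreover have "act1 Q (\<alpha> p) (ident G x) = \<alpha> (act0 P p x)" using \<alpha> p x by (simp add: G0_nat_trans_def)
    ultimately show "\<beta> (act0 P p x) = act1 Q (\<beta> p) (ident G x)"
      using \<beta>(2)[of "act0 P p x"] p x Q.inverse_pair_unique by (metis P.act_closed(1))
  qed (use \<beta>(1) B in auto)
  then show ?thesis unfolding G0_nat_iso_def using \<alpha> B by blast
qed

section \<open>The topological category \<open>P_c\<close> and its comparison with
  \<open>\<G>\<close>\<close>

locale cocycle = two_grp G for G :: "('a, 'b) two_group" +
  fixes X :: "'x topology" and \<U> :: "'x set set"
    and x :: "'x set \<Rightarrow> 'x set \<Rightarrow> 'x \<Rightarrow> 'a" and e :: "'x set \<Rightarrow> 'x set \<Rightarrow> 'x set \<Rightarrow> 'x \<Rightarrow> 'b"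
  assumes cover: "open_cover X \<U>" and cech_cocycle: "cech_cocycle G X \<U> (x, e)"
begin

abbreviation "Pc' \<equiv> Pc G X \<U> (x, e)"

lemma in_X: "i \<in> \<U> \<Longrightarrow> v \<in> i \<Longrightarrow> v \<in> topspace X"
  using cover by (auto simp: open_cover_def)

lemma continuous_x: "i \<in> \<U> \<Longrightarrow> j \<in> \<U> \<Longrightarrow> continuous_map (subtopology X (i \<inter> j)) (G0 G) (x i j)"
  and continuous_e: "i \<in> \<U> \<Longrightarrow> j \<in> \<U> \<Longrightarrow> k \<in> \<U> \<Longrightarrow> continuous_map (subtopology X (i \<inter> j \<inter> k)) (E_top G) (e i j k)"
  using cech_cocycle by (simp_all add: cech_cocycle_def)

lemma continuous_x_at:
  "i \<in> \<U> \<Longrightarrow> j \<in> \<U> \<Longrightarrow> continuous_map Z X v \<Longrightarrow> (\<And>z. z \<in> topspace Z \<Longrightarrow> v z \<in> i \<and> v z \<in> j) \<Longrightarrow>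
    continuous_map Z (G0 G) (\<lambda>z. x i j (v z))"
  by (rule continuous_map_compose_at[OF continuous_x]) (auto simp: continuous_map_in_subtopology)

lemma continuous_e_at:
  "i \<in> \<U> \<Longrightarrow> j \<in> \<U> \<Longrightarrow> k \<in> \<U> \<Longrightarrow> continuous_map Z X v \<Longrightarrow> (\<And>z. z \<in> topspace Z \<Longrightarrow> v z \<in> i \<and> v z \<in> j \<and> v z \<in> k) \<Longrightarrow>
    continuous_map Z (G1 G) (\<lambda>z. e i j k (v z))"
  using continuous_map_compose_at[OF continuous_e, of i j k Z v] by (auto simp: continuous_map_in_subtopology continuous_E_top)

lemma x_closed [simp]: "i \<in> \<U> \<Longrightarrow> j \<in> \<U> \<Longrightarrow> v \<in> i \<Longrightarrow> v \<in> j \<Longrightarrow> x i j v \<in> C0"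
  using continuous_map_closed[OF continuous_x[of i j], of v] in_X[of i v] by simp

lemma e_closed [simp]:
  assumes "i \<in> \<U>" "j \<in> \<U>" "k \<in> \<U>" "v \<in> i" "v \<in> j" "v \<in> k"
  shows "e i j k v \<in> C1" "\<s> (e i j k v) = one0 G"
  using continuous_map_closed[OF continuous_e[of i j k], of v] in_X[of i v] assms by (simp_all add: E_top_def)

lemma x_cocycle: "i \<in> \<U> \<Longrightarrow> j \<in> \<U> \<Longrightarrow> k \<in> \<U> \<Longrightarrow> v \<in> i \<Longrightarrow> v \<in> j \<Longrightarrow> v \<in> k \<Longrightarrow> \<t> (e i j k v) \<cdot> x i j v \<cdot> x j k v = x i k v"
  using cech_cocycle in_X[of i v] by (simp add: cech_cocycle_def)

lemma e_cocycle: "i \<in> \<U> \<Longrightarrow> j \<in> \<U> \<Longrightarrow> k \<in> \<U> \<Longrightarrow> l \<in> \<U> \<Longrightarrow> v \<in> i \<Longrightarrow> v \<in> j \<Longrightarrow> v \<in> k \<Longrightarrow> v \<in> l \<Longrightarrow>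
   e i k l v \<odot> e i j k v = e i j l v \<odot> \<iota> (x i j v) \<odot> e j k l v \<odot> i1 (\<iota> (x i j v))"
  using cech_cocycle in_X[of i v] by (simp add: cech_cocycle_def conjE_def)

lemma tgt_e: "i \<in> \<U> \<Longrightarrow> j \<in> \<U> \<Longrightarrow> k \<in> \<U> \<Longrightarrow> v \<in> i \<Longrightarrow> v \<in> j \<Longrightarrow> v \<in> k \<Longrightarrow>
   \<t> (e i j k v) = x i k v \<cdot> i0 (x j k v) \<cdot> i0 (x i j v)"
  by (simp flip: x_cocycle[of i j k v])

text \<open>The cocycle identity for \<open>i i i m\<close> reduces to \<open>e i i i v\<close>
  being the conjugate of \<open>e i i m v\<close> by \<open>x i i v\<close>. As this holds for every
  \<open>m\<close>, and conjugation is injective, \<open>e i i m v\<close> does not depend on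
  \<open>m\<close>.\<close>

lemma e_diagonal:
  assumes [simp]: "i \<in> \<U>" "l \<in> \<U>" "v \<in> i" "v \<in> l"
  shows "e i i l v = e i i i v"
proof -
  have *: "e i i i v = \<iota> (x i i v) \<odot> e i i m v \<odot> i1 (\<iota> (x i i v))" if "m \<in> \<U>" "v \<in> m" for m
    using e_cocycle[of i i i m v] that by simp
  show ?thesis
    using arg_cong[OF trans[OF *[of l, symmetric] *[of i]], of "\<lambda>w. i1 (\<iota> (x i i v)) \<odot> w \<odot> \<iota> (x i i v)"] by simp
qed

lemma Pc_simps [simp]: "ob_top Pc' = Pc_obtop G X \<U>" "mor_top Pc' = Pc_mortop G X \<U>"
  "idm Pc' = Pc_idm G X \<U> (x, e)"
  "dom Pc' ((i, j), (v, g)) = (i, (v, \<s> g))"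
  "cod Pc' ((i, j), (v, g)) = (j, (v, i0 (x i j v) \<cdot> \<t> g))"
  "cmp Pc' ((i, j), (v, g)) ((j', k), (v', h)) = ((i, k), (v, e i j k v \<odot> (g \<star> (\<iota> (x i j v) \<odot> h))))"
  "act0 Pc' (i, (v, a)) y = (i, (v, a \<cdot> y))" "act1 Pc' ((i, j), (v, g)) h = ((i, j), (v, g \<odot> h))"
  by (simp_all add: Pc_def Pc_dom_def Pc_cod_def Pc_cmp_def)

lemma Pc_ob_mem [simp]: "(i, (v, a)) \<in> topspace (Pc_obtop G X \<U>) \<longleftrightarrow> i \<in> \<U> \<and> v \<in> i \<and> a \<in> C0"
  and Pc_mor_mem [simp]: "((i, j), (v, g)) \<in> topspace (Pc_mortop G X \<U>) \<longleftrightarrow> i \<in> \<U> \<and> j \<in> \<U> \<and> v \<in> i \<and> v \<in> j \<and> g \<in> C1"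
  by (auto simp: Pc_obtop_def Pc_mortop_def in_X)

text \<open>\<open>\<Phi> i\<close> embeds \<open>P\<^sub>c|\<^sub>U\<^sub>i\<close> fully faithfully into \<open>\<G>\<close>; all categorical identities in \<open>P\<^sub>c\<close> are checked through it.\<close>
definition \<Phi> :: "'x set \<Rightarrow> ('x, 'b) Pc_mor \<Rightarrow> 'b" where
  "\<Phi> i = (\<lambda>((j, k), (v, g)). e i j k v \<odot> \<iota> (x i j v) \<odot> g)"

lemma \<Phi>:
  assumes "i \<in> \<U>" "j \<in> \<U>" "k \<in> \<U>" "v \<in> i" "v \<in> j" "v \<in> k" "g \<in> C1"
  shows "\<Phi> i ((j, k), (v, g)) \<in> C1" "\<s> (\<Phi> i ((j, k), (v, g))) = x i j v \<cdot> \<s> g"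
    "\<t> (\<Phi> i ((j, k), (v, g))) = x i k v \<cdot> i0 (x j k v) \<cdot> \<t> g"
  using assms by (simp_all add: \<Phi>_def tgt_e)

lemma \<Phi>_cmp:
  assumes [simp]: "i \<in> \<U>" "j \<in> \<U>" "k \<in> \<U>" "l \<in> \<U>" "v \<in> i" "v \<in> j" "v \<in> k" "v \<in> l" "g \<in> C1" "h \<in> C1"
    and gh: "i0 (x j k v) \<cdot> \<t> g = \<s> h"
  shows "\<Phi> i (cmp Pc' ((j, k), (v, g)) ((k, l), (v, h))) = \<Phi> i ((j, k), (v, g)) \<star> \<Phi> i ((k, l), (v, h))"
proof -
  have "\<t> g = x j k v \<cdot> \<s> h" by (simp flip: gh)
  then show ?thesis
    using cocycle_functorial[of "e i j k v" "e i k l v" "e i j l v" "e j k l v" "x i j v" "x j k v" g h "x i k v"]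
      e_cocycle[of i j k l v] x_cocycle[of i j k v] by (simp add: \<Phi>_def)
qed

lemma \<Phi>_inject:
  "i \<in> \<U> \<Longrightarrow> j \<in> \<U> \<Longrightarrow> k \<in> \<U> \<Longrightarrow> v \<in> i \<Longrightarrow> v \<in> j \<Longrightarrow> v \<in> k \<Longrightarrow> g \<in> C1 \<Longrightarrow> h \<in> C1 \<Longrightarrow>
    \<Phi> i ((j, k), (v, g)) = \<Phi> i ((j, k), (v, h)) \<longleftrightarrow> g = h"
  by (simp add: \<Phi>_def)

text \<open>Reduces continuity of anything built from \<open>k\<close> to pieces with constant
  indices, on which \<open>k\<close> is a pair of continuous maps \<open>v\<close> and
  \<open>g\<close>. Preimages under \<open>k\<close> of the summands are open, so the pieces
  suffice.\<close>

lemma Pc_mor_cases: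
  assumes k: "continuous_map Z (Pc_mortop G X \<U>) k"
    and F: "\<And>i j Z' v g. i \<in> \<U> \<Longrightarrow> j \<in> \<U> \<Longrightarrow> Z' = subtopology Z {z. fst (k z) = (i, j)} \<Longrightarrow>
       continuous_map Z' X v \<Longrightarrow> continuous_map Z' (G1 G) g \<Longrightarrow>
       (\<And>z. z \<in> topspace Z' \<Longrightarrow> k z = ((i, j), (v z, g z)) \<and> v z \<in> i \<and> v z \<in> j \<and> g z \<in> C1) \<Longrightarrow> continuous_map Z' Y F"
  shows "continuous_map Z Y F"
proof (rule continuous_map_from_sum_pieces[OF k[unfolded Pc_mortop_def]], clarify)
  fix i j assume ij: "i \<in> \<U>" "j \<in> \<U>"
  let ?Z = "subtopology Z {z. fst (k z) = (i, j)}"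
  have "continuous_map ?Z (case (i, j) of (i, j) \<Rightarrow> prod_topology (subtopology X (i \<inter> j)) (G1 G)) (\<lambda>z. snd (k z))"
    by (rule continuous_map_sum_component[OF continuous_map_from_subtopology[OF k[unfolded Pc_mortop_def]]])
      (use ij in auto)
  then have "continuous_map ?Z (subtopology X (i \<inter> j)) (\<lambda>z. fst (snd (k z)))" and g: "continuous_map ?Z (G1 G) (\<lambda>z. snd (snd (k z)))"
    by (auto intro: continuous_map_fst_at continuous_map_snd_at)
  then have v: "continuous_map ?Z X (\<lambda>z. fst (snd (k z)))" and vij: "\<And>z. z \<in> topspace ?Z \<Longrightarrow> fst (snd (k z)) \<in> i \<inter> j"
    by (auto simp: continuous_map_in_subtopology)
  show "continuous_map ?Z Y F"
    by (rule F[OF ij refl v g]) (use vij continuous_map_closed[OF g] in \<open>auto simp: prod_eq_iff\<close>)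
qed

lemma Pc_ob_cases:
  assumes k: "continuous_map Z (Pc_obtop G X \<U>) k"
    and F: "\<And>i Z' v a. i \<in> \<U> \<Longrightarrow> Z' = subtopology Z {z. fst (k z) = i} \<Longrightarrow>
       continuous_map Z' X v \<Longrightarrow> continuous_map Z' (G0 G) a \<Longrightarrow>
       (\<And>z. z \<in> topspace Z' \<Longrightarrow> k z = (i, (v z, a z)) \<and> v z \<in> i \<and> a z \<in> C0) \<Longrightarrow> continuous_map Z' Y F"
  shows "continuous_map Z Y F"
proof (rule continuous_map_from_sum_pieces[OF k[unfolded Pc_obtop_def]])
  fix i assume i: "i \<in> \<U>"
  let ?Z = "subtopology Z {z. fst (k z) = i}"
  have "continuous_map ?Z (prod_topology (subtopology X i) (G0 G)) (\<lambda>z. snd (k z))"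
    by (rule continuous_map_sum_component[OF continuous_map_from_subtopology[OF k[unfolded Pc_obtop_def]]])
      (use i in auto)
  then have "continuous_map ?Z (subtopology X i) (\<lambda>z. fst (snd (k z)))" and a: "continuous_map ?Z (G0 G) (\<lambda>z. snd (snd (k z)))"
    by (auto intro: continuous_map_fst_at continuous_map_snd_at)
  then have v: "continuous_map ?Z X (\<lambda>z. fst (snd (k z)))" and vi: "\<And>z. z \<in> topspace ?Z \<Longrightarrow> fst (snd (k z)) \<in> i"
    by (auto simp: continuous_map_in_subtopology)
  show "continuous_map ?Z Y F"
    by (rule F[OF i refl v a]) (use vi continuous_map_closed[OF a] in \<open>auto simp: prod_eq_iff\<close>)
qed

lemma continuous_into_Pc_ob:
  "i \<in> \<U> \<Longrightarrow> continuous_map Z X v \<Longrightarrow> continuous_map Z (G0 G) a \<Longrightarrow> (\<And>z. z \<in> topspace Z \<Longrightarrow> v z \<in> i) \<Longrightarrow>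
    continuous_map Z (Pc_obtop G X \<U>) (\<lambda>z. (i, (v z, a z)))"
  unfolding Pc_obtop_def
  by (rule continuous_map_into_sum) (auto simp: continuous_map_paired continuous_map_in_subtopology)

lemma continuous_into_Pc_mor:
  "i \<in> \<U> \<Longrightarrow> j \<in> \<U> \<Longrightarrow> continuous_map Z X v \<Longrightarrow> continuous_map Z (G1 G) g \<Longrightarrow>
    (\<And>z. z \<in> topspace Z \<Longrightarrow> v z \<in> i \<and> v z \<in> j) \<Longrightarrow> continuous_map Z (Pc_mortop G X \<U>) (\<lambda>z. ((i, j), (v z, g z)))"
  unfolding Pc_mortop_def
  by (rule continuous_map_into_sum) (auto simp: continuous_map_paired continuous_map_in_subtopology)

text \<open>The component of the identity at \<open>(j, (v, one0 G))\<close>. It is the solution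
  \<open>g\<close> of \<open>\<Phi> j ((j, j), (v, g)) = \<iota> (x j j v)\<close>.\<close>

definition \<epsilon> :: "'x set \<Rightarrow> 'x \<Rightarrow> 'b" where
  "\<epsilon> j v = i1 (\<iota> (x j j v)) \<odot> i1 (e j j j v) \<odot> \<iota> (x j j v)"

lemma \<epsilon>:
  assumes [simp]: "j \<in> \<U>" "v \<in> j"
  shows "\<epsilon> j v \<in> C1" "\<s> (\<epsilon> j v) = one0 G" "\<t> (\<epsilon> j v) = x j j v"
  by (simp_all add: \<epsilon>_def tgt_e)

abbreviation Pc_unit :: "('x, 'a) Pc_ob \<Rightarrow> ('x, 'b) Pc_mor" where
  "Pc_unit \<equiv> (\<lambda>(j, (v, a)). ((j, j), (v, \<epsilon> j v \<odot> \<iota> a)))"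

text \<open>For \<open>i = j\<close> this is the choice of \<open>\<epsilon>\<close>. That case and
  the injectivity of \<open>\<Phi> j\<close> make the arrow idempotent in \<open>P_c\<close>; so its
  image under any other \<open>\<Phi> i\<close> is idempotent in \<open>\<G>\<close>, hence an
  identity.\<close>

lemma \<Phi>_unit:
  assumes [simp]: "i \<in> \<U>" "j \<in> \<U>" "v \<in> i" "v \<in> j" "a \<in> C0"
  shows "\<Phi> i ((j, j), (v, \<epsilon> j v \<odot> \<iota> a)) = \<iota> (x i j v \<cdot> a)"
proof -
  note [simp] = \<epsilon>
  let ?m = "((j, j), (v, \<epsilon> j v \<odot> \<iota> a))"
  have jj: "\<Phi> j ?m = \<iota> (x j j v \<cdot> a)" by (simp add: \<Phi>_def \<epsilon>_def)
  have "\<Phi> j (cmp Pc' ?m ?m) = \<Phi> j ?m"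
    using \<Phi>_cmp[of j j j j v "\<epsilon> j v \<odot> \<iota> a" "\<epsilon> j v \<odot> \<iota> a"] star_ident(1)[of "\<iota> (x j j v \<cdot> a)"] by (simp add: jj)
  then have idem: "cmp Pc' ?m ?m = ?m"
    by (simp add: \<Phi>_def)
  have "\<Phi> i ?m \<star> \<Phi> i ?m = \<Phi> i ?m"
    using \<Phi>_cmp[of i j j j v "\<epsilon> j v \<odot> \<iota> a" "\<epsilon> j v \<odot> \<iota> a"] by (simp add: idem del: Pc_simps)
  then show ?thesis
    using star_idempotent[of "\<Phi> i ?m"] by (simp add: \<Phi>)
qed

lemma cmp_closed:
  assumes [simp]: "i \<in> \<U>" "j \<in> \<U>" "k \<in> \<U>" "v \<in> i" "v \<in> j" "v \<in> k" "g \<in> C1" "h \<in> C1" and gh: "i0 (x i j v) \<cdot> \<t> g = \<s> h"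
  shows "e i j k v \<odot> (g \<star> (\<iota> (x i j v) \<odot> h)) \<in> C1" "\<s> (e i j k v \<odot> (g \<star> (\<iota> (x i j v) \<odot> h))) = \<s> g"
    "i0 (x i k v) \<cdot> \<t> (e i j k v \<odot> (g \<star> (\<iota> (x i j v) \<odot> h))) = i0 (x j k v) \<cdot> \<t> h"
proof -
  have c: "\<t> g = x i j v \<cdot> \<s> h" by (simp add: gh[symmetric])
  then show "e i j k v \<odot> (g \<star> (\<iota> (x i j v) \<odot> h)) \<in> C1" "\<s> (e i j k v \<odot> (g \<star> (\<iota> (x i j v) \<odot> h))) = \<s> g"
    "i0 (x i k v) \<cdot> \<t> (e i j k v \<odot> (g \<star> (\<iota> (x i j v) \<odot> h))) = i0 (x j k v) \<cdot> \<t> h"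
    by (simp_all add: tgt_e)
qed

text \<open>\<open>\<Phi> i\<close>, with \<open>i\<close> the index of the common source, turns
  both sides into triple compositions in \<open>\<G>\<close> and is injective on the arrows from
  index \<open>i\<close> to index \<open>l\<close> over \<open>v\<close>.\<close>

lemma Pc_assoc:
  assumes [simp]: "i \<in> \<U>" "j \<in> \<U>" "k \<in> \<U>" "l \<in> \<U>" "v \<in> i" "v \<in> j" "v \<in> k" "v \<in> l" "f \<in> C1" "g \<in> C1" "h \<in> C1"
    and fg: "i0 (x i j v) \<cdot> \<t> f = \<s> g" and gh: "i0 (x j k v) \<cdot> \<t> g = \<s> h"
  shows "cmp Pc' (cmp Pc' ((i, j), (v, f)) ((j, k), (v, g))) ((k, l), (v, h))
    = cmp Pc' ((i, j), (v, f)) (cmp Pc' ((j, k), (v, g)) ((k, l), (v, h)))"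
proof -
  define c where "c = e i j k v \<odot> (f \<star> (\<iota> (x i j v) \<odot> g))"
  define d where "d = e j k l v \<odot> (g \<star> (\<iota> (x j k v) \<odot> h))"
  have c: "c \<in> C1" "i0 (x i k v) \<cdot> \<t> c = \<s> h" and d: "d \<in> C1" "\<s> d = \<s> g"
    using cmp_closed[OF _ _ _ _ _ _ _ _ fg] cmp_closed[OF _ _ _ _ _ _ _ _ gh] gh by (simp_all only: c_def d_def assms(1-11))
  have \<Phi>c: "\<Phi> i ((i, k), (v, c)) = \<Phi> i ((i, j), (v, f)) \<star> \<Phi> i ((j, k), (v, g))"
    using \<Phi>_cmp[OF _ _ _ _ _ _ _ _ _ _ fg, of i] by (simp only: c_def assms(1-11) Pc_simps(6))
  have \<Phi>d: "\<Phi> i ((j, l), (v, d)) = \<Phi> i ((j, k), (v, g)) \<star> \<Phi> i ((k, l), (v, h))"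
    using \<Phi>_cmp[OF _ _ _ _ _ _ _ _ _ _ gh, of i] by (simp only: d_def assms(1-11) Pc_simps(6))
  have fd: "i0 (x i j v) \<cdot> \<t> f = \<s> d" using fg d by simp
  have "\<Phi> i (cmp Pc' ((i, k), (v, c)) ((k, l), (v, h)))
      = (\<Phi> i ((i, j), (v, f)) \<star> \<Phi> i ((j, k), (v, g))) \<star> \<Phi> i ((k, l), (v, h))"
    unfolding \<Phi>c[symmetric] using c by (intro \<Phi>_cmp) simp_all
  also have "\<dots> = \<Phi> i ((i, j), (v, f)) \<star> (\<Phi> i ((j, k), (v, g)) \<star> \<Phi> i ((k, l), (v, h)))"
    by (rule star_assoc) (simp_all add: \<Phi> flip: fg gh)
  also have "\<dots> = \<Phi> i (cmp Pc' ((i, j), (v, f)) ((j, l), (v, d)))"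
    unfolding \<Phi>d[symmetric] using d fd by (intro \<Phi>_cmp[symmetric]) simp_all
  finally have "\<Phi> i ((i, l), (v, e i k l v \<odot> (c \<star> (\<iota> (x i k v) \<odot> h)))) = \<Phi> i ((i, l), (v, e i j l v \<odot> (f \<star> (\<iota> (x i j v) \<odot> d))))"
    by (simp only: Pc_simps)
  moreover have "e i k l v \<odot> (c \<star> (\<iota> (x i k v) \<odot> h)) \<in> C1" "e i j l v \<odot> (f \<star> (\<iota> (x i j v) \<odot> d)) \<in> C1"
    using c d fd by (intro cmp_closed(1); simp)+
  ultimately have "e i k l v \<odot> (c \<star> (\<iota> (x i k v) \<odot> h)) = e i j l v \<odot> (f \<star> (\<iota> (x i j v) \<odot> d))"
    by (subst (asm) \<Phi>_inject) simp_all
  then show ?thesis by (simp only: Pc_simps flip: c_def d_def)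
qed

text \<open>Under \<open>\<Phi> j\<close> both equations become composition with an identity of
  \<open>\<G>\<close>.\<close>

lemma Pc_unit_cmp:
  assumes [simp]: "j \<in> \<U>" "k \<in> \<U>" "v \<in> j" "v \<in> k" "g \<in> C1"
  shows "cmp Pc' (Pc_unit (j, (v, \<s> g))) ((j, k), (v, g)) = ((j, k), (v, g))"
    and "cmp Pc' ((j, k), (v, g)) (Pc_unit (k, (v, i0 (x j k v) \<cdot> \<t> g))) = ((j, k), (v, g))"
proof -
  note [simp] = \<epsilon>
  have "\<Phi> j (cmp Pc' (Pc_unit (j, (v, \<s> g))) ((j, k), (v, g))) = \<Phi> j ((j, k), (v, g))"
    using \<Phi>_cmp[of j j j k v "\<epsilon> j v \<odot> \<iota> (\<s> g)" g] star_ident(1)[of "\<Phi> j ((j, k), (v, g))"] by (simp add: \<Phi>_unit \<Phi>)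
  then show "cmp Pc' (Pc_unit (j, (v, \<s> g))) ((j, k), (v, g)) = ((j, k), (v, g))"
    using cmp_closed[of j j k v "\<epsilon> j v \<odot> \<iota> (\<s> g)" g] by (simp add: \<Phi>_inject)
  let ?b = "i0 (x j k v) \<cdot> \<t> g"
  have "\<Phi> j (cmp Pc' ((j, k), (v, g)) (Pc_unit (k, (v, ?b)))) = \<Phi> j ((j, k), (v, g))"
    using \<Phi>_cmp[of j j k k v g "\<epsilon> k v \<odot> \<iota> ?b"] \<Phi>_unit[of j k v ?b] star_ident(2)[of "\<Phi> j ((j, k), (v, g))"] by (simp add: \<Phi>_unit \<Phi>)
  then show "cmp Pc' ((j, k), (v, g)) (Pc_unit (k, (v, ?b))) = ((j, k), (v, g))"
    using cmp_closed[of j k k v g "\<epsilon> k v \<odot> \<iota> ?b"] by (simp add: \<Phi>_inject)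
qed

lemma Pc_idm:
  assumes p: "p \<in> topspace (Pc_obtop G X \<U>)"
  shows "Pc_idm G X \<U> (x, e) p = Pc_unit p"
proof -
  obtain j v a where [simp]: "p = (j, (v, a))" "j \<in> \<U>" "v \<in> j" "a \<in> C0" using p by (cases p) auto
  let ?Q = "\<lambda>f. f \<in> topspace (Pc_mortop G X \<U>) \<and> dom Pc' f = p \<and> cod Pc' f = p \<and>
      (\<forall>g\<in>topspace (Pc_mortop G X \<U>). dom Pc' g = p \<longrightarrow> cmp Pc' f g = g) \<and>
      (\<forall>g\<in>topspace (Pc_mortop G X \<U>). cod Pc' g = p \<longrightarrow> cmp Pc' g f = g)"
  have "?Q (Pc_unit p)"
  proof (intro conjI ballI impI)
    fix m assume m: "m \<in> topspace (Pc_mortop G X \<U>)"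
    obtain i k w g where mk: "m = ((i, k), (w, g))" by (metis surj_pair)
    show "cmp Pc' (Pc_unit p) m = m" if "dom Pc' m = p"
      using that m Pc_unit_cmp(1)[of j k v g] unfolding mk by (auto simp del: Pc_simps(6))
    show "cmp Pc' m (Pc_unit p) = m" if "cod Pc' m = p"
      using that m Pc_unit_cmp(2)[of i j v g] unfolding mk by (auto simp del: Pc_simps(6))
  qed (simp_all add: \<epsilon>)
  \<comment> \<open>Two two-sided identities at \<open>p\<close> both equal their composite; so the
    choice operator has only one candidate.\<close>
  moreover have "f = g" if "?Q f" "?Q g" for f g
    using that by metis
  ultimately have "(SOME f. ?Q f) = Pc_unit p" by (intro some_equality) blast+
  then show ?thesis by (simp add: Pc_idm_def Pc_def)
qed

lemma Pc_idm_at [simp]: "j \<in> \<U> \<Longrightarrow> v \<in> j \<Longrightarrow> a \<in> C0 \<Longrightarrow> Pc_idm G X \<U> (x, e) (j, (v, a)) = ((j, j), (v, \<epsilon> j v \<odot> \<iota> a))"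
  by (simp add: Pc_idm)

lemmas continuous_cocycle_rules = continuous_rules continuous_x_at continuous_e_at

lemma continuous_\<epsilon>:
  "j \<in> \<U> \<Longrightarrow> continuous_map Z X v \<Longrightarrow> (\<And>z. z \<in> topspace Z \<Longrightarrow> v z \<in> j) \<Longrightarrow> continuous_map Z (G1 G) (\<lambda>z. \<epsilon> j (v z))"
  unfolding \<epsilon>_def by (intro continuous_cocycle_rules) auto

lemma continuous_Pc_dom:
  "continuous_map Z (Pc_mortop G X \<U>) k \<Longrightarrow> continuous_map Z (Pc_obtop G X \<U>) (\<lambda>z. dom Pc' (k z))"
proof (erule Pc_mor_cases)
  fix i j Z' v g
  assume h: "i \<in> \<U>" "j \<in> \<U>" "continuous_map Z' X v" "continuous_map Z' (G1 G) g"
    "\<And>z. z \<in> topspace Z' \<Longrightarrow> k z = ((i, j), (v z, g z)) \<and> v z \<in> i \<and> v z \<in> j \<and> g z \<in> C1"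
  show "continuous_map Z' (Pc_obtop G X \<U>) (\<lambda>z. dom Pc' (k z))"
    by (rule continuous_map_eq[where f = "\<lambda>z. (i, (v z, \<s> (g z)))"])
      (use h in \<open>auto intro!: continuous_into_Pc_ob continuous_rules\<close>)
qed

lemma continuous_Pc_cod:
  "continuous_map Z (Pc_mortop G X \<U>) k \<Longrightarrow> continuous_map Z (Pc_obtop G X \<U>) (\<lambda>z. cod Pc' (k z))"
proof (erule Pc_mor_cases)
  fix i j Z' v g
  assume h: "i \<in> \<U>" "j \<in> \<U>" "continuous_map Z' X v" "continuous_map Z' (G1 G) g"
    "\<And>z. z \<in> topspace Z' \<Longrightarrow> k z = ((i, j), (v z, g z)) \<and> v z \<in> i \<and> v z \<in> j \<and> g z \<in> C1"
  show "continuous_map Z' (Pc_obtop G X \<U>) (\<lambda>z. cod Pc' (k z))"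
    by (rule continuous_map_eq[where f = "\<lambda>z. (j, (v z, i0 (x i j (v z)) \<cdot> \<t> (g z)))"])
      (use h in \<open>auto intro!: continuous_into_Pc_ob continuous_cocycle_rules\<close>)
qed

lemma continuous_Pc_idm:
  "continuous_map Z (Pc_obtop G X \<U>) k \<Longrightarrow> continuous_map Z (Pc_mortop G X \<U>) (\<lambda>z. idm Pc' (k z))"
proof (erule Pc_ob_cases)
  fix i Z' v a
  assume h: "i \<in> \<U>" "continuous_map Z' X v" "continuous_map Z' (G0 G) a"
    "\<And>z. z \<in> topspace Z' \<Longrightarrow> k z = (i, (v z, a z)) \<and> v z \<in> i \<and> a z \<in> C0"
  show "continuous_map Z' (Pc_mortop G X \<U>) (\<lambda>z. idm Pc' (k z))"
    by (rule continuous_map_eq[where f = "\<lambda>z. ((i, i), (v z, \<epsilon> i (v z) \<odot> \<iota> (a z)))"])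
      (use h in \<open>auto intro!: continuous_into_Pc_mor continuous_rules continuous_\<epsilon>\<close>)
qed

lemma continuous_Pc_cmp:
  assumes k: "continuous_map Z (Pc_mortop G X \<U>) k" and l: "continuous_map Z (Pc_mortop G X \<U>) l"
    and kl: "\<And>z. z \<in> topspace Z \<Longrightarrow> cod Pc' (k z) = dom Pc' (l z)"
  shows "continuous_map Z (Pc_mortop G X \<U>) (\<lambda>z. cmp Pc' (k z) (l z))"
  using k
proof (rule Pc_mor_cases)
  fix i j Z' v g
  assume h: "i \<in> \<U>" "j \<in> \<U>" "Z' = subtopology Z {z. fst (k z) = (i, j)}" "continuous_map Z' X v" "continuous_map Z' (G1 G) g"
    "\<And>z. z \<in> topspace Z' \<Longrightarrow> k z = ((i, j), (v z, g z)) \<and> v z \<in> i \<and> v z \<in> j \<and> g z \<in> C1"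
  have "continuous_map Z' (Pc_mortop G X \<U>) l"
    unfolding h(3) using l by (rule continuous_map_from_subtopology)
  then show "continuous_map Z' (Pc_mortop G X \<U>) (\<lambda>z. cmp Pc' (k z) (l z))"
  proof (rule Pc_mor_cases)
    fix j' m Z'' w f
    assume h': "j' \<in> \<U>" "m \<in> \<U>" "Z'' = subtopology Z' {z. fst (l z) = (j', m)}" "continuous_map Z'' X w"
      "continuous_map Z'' (G1 G) f"
      "\<And>z. z \<in> topspace Z'' \<Longrightarrow> l z = ((j', m), (w z, f z)) \<and> w z \<in> j' \<and> w z \<in> m \<and> f z \<in> C1"
    have c: "continuous_map Z'' X v" "continuous_map Z'' (G1 G) g"
      unfolding h'(3) using h(4,5) by (auto intro: continuous_map_from_subtopology)
    have z: "k z = ((i, j), (v z, g z))" "v z \<in> i" "v z \<in> j" "g z \<in> C1" "l z = ((j', m), (w z, f z))" "w z \<in> j'" "w z \<in> m"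
      "f z \<in> C1" "cod Pc' (k z) = dom Pc' (l z)" if "z \<in> topspace Z''" for z
      using that h(6)[of z] h'(6)[of z] kl[of z] unfolding h'(3) h(3) by auto
    have z': "j' = j" "v z \<in> m" "w z = v z" "\<t> (g z) = x i j (v z) \<cdot> \<s> (f z)" if "z \<in> topspace Z''" for z
    proof -
      have eq: "j = j'" "v z = w z" "i0 (x i j (v z)) \<cdot> \<t> (g z) = \<s> (f z)"
        using z(9)[OF that] unfolding z(1)[OF that] z(5)[OF that] Pc_simps prod.inject by blast+
      then show "j' = j" "v z \<in> m" "w z = v z" using z(7)[OF that] by simp_all
      show "\<t> (g z) = x i j (v z) \<cdot> \<s> (f z)"
        using z(1-4)[OF that] h(1,2) by (simp flip: eq(3))
    qed
    show "continuous_map Z'' (Pc_mortop G X \<U>) (\<lambda>z. cmp Pc' (k z) (l z))"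
    \<comment> \<open>Composability at a point forces the middle indices \<open>j\<close> and
      \<open>j'\<close> to agree, so a piece with different ones is empty.\<close>
    proof (cases "topspace Z'' = {}")
      case True
      then show ?thesis by (simp add: continuous_map_on_empty)
    next
      case False
      then obtain z0 where "z0 \<in> topspace Z''" by blast
      then have j': "j' = j" by (rule z'(1))
      show ?thesis
      proof (rule continuous_map_eq[where f = "\<lambda>z. ((i, m), (v z, e i j m (v z) \<odot> (g z \<star> (\<iota> (x i j (v z)) \<odot> f z))))"])
        show "continuous_map Z'' (Pc_mortop G X \<U>) (\<lambda>z. ((i, m), (v z, e i j m (v z) \<odot> (g z \<star> (\<iota> (x i j (v z)) \<odot> f z)))))"
          by (intro continuous_into_Pc_mor continuous_cocycle_rules continuous_star)
            (simp_all add: h(1,2) h'(2,5) c z(2-4,8) z'(2,4))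
        show "((i, m), (v z, e i j m (v z) \<odot> (g z \<star> (\<iota> (x i j (v z)) \<odot> f z)))) = cmp Pc' (k z) (l z)"
          if "z \<in> topspace Z''" for z
          unfolding z(1)[OF that] z(5)[OF that] z'(3)[OF that] j' Pc_simps ..
      qed
    qed
  qed
qed

lemma continuous_Pc_act0:
  assumes k: "continuous_map Z (Pc_obtop G X \<U>) k" and y: "continuous_map Z (G0 G) y"
  shows "continuous_map Z (Pc_obtop G X \<U>) (\<lambda>z. act0 Pc' (k z) (y z))"
  using k
proof (rule Pc_ob_cases)
  fix i Z' v a
  assume h: "i \<in> \<U>" "Z' = subtopology Z {z. fst (k z) = i}" "continuous_map Z' X v" "continuous_map Z' (G0 G) a"
    "\<And>z. z \<in> topspace Z' \<Longrightarrow> k z = (i, (v z, a z)) \<and> v z \<in> i \<and> a z \<in> C0"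
  have "continuous_map Z' (G0 G) y" unfolding h(2) using y by (rule continuous_map_from_subtopology)
  then show "continuous_map Z' (Pc_obtop G X \<U>) (\<lambda>z. act0 Pc' (k z) (y z))"
    by (intro continuous_map_eq[where f = "\<lambda>z. (i, (v z, a z \<cdot> y z))" and g = "\<lambda>z. act0 Pc' (k z) (y z)"])
      (use h(1,3-5) in \<open>auto intro!: continuous_into_Pc_ob continuous_rules\<close>)
qed

lemma continuous_Pc_act1:
  assumes k: "continuous_map Z (Pc_mortop G X \<U>) k" and y: "continuous_map Z (G1 G) y"
  shows "continuous_map Z (Pc_mortop G X \<U>) (\<lambda>z. act1 Pc' (k z) (y z))"
  using k
proof (rule Pc_mor_cases)
  fix i j Z' v g
  assume h: "i \<in> \<U>" "j \<in> \<U>" "Z' = subtopology Z {z. fst (k z) = (i, j)}" "continuous_map Z' X v" "continuous_map Z' (G1 G) g"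
    "\<And>z. z \<in> topspace Z' \<Longrightarrow> k z = ((i, j), (v z, g z)) \<and> v z \<in> i \<and> v z \<in> j \<and> g z \<in> C1"
  have "continuous_map Z' (G1 G) y" unfolding h(3) using y by (rule continuous_map_from_subtopology)
  then show "continuous_map Z' (Pc_mortop G X \<U>) (\<lambda>z. act1 Pc' (k z) (y z))"
    by (intro continuous_map_eq[where f = "\<lambda>z. ((i, j), (v z, g z \<odot> y z))" and g = "\<lambda>z. act1 Pc' (k z) (y z)"])
      (use h(1,2,4-6) in \<open>auto intro!: continuous_into_Pc_mor continuous_rules\<close>)
qed

lemma Pc_obE:
  assumes "p \<in> topspace (Pc_obtop G X \<U>)"
  obtains j v a where "p = (j, (v, a))" "j \<in> \<U>" "v \<in> j" "a \<in> C0"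
  using assms by (cases p) auto

lemma Pc_morE:
  assumes "m \<in> topspace (Pc_mortop G X \<U>)"
  obtains j k v g where "m = ((j, k), (v, g))" "j \<in> \<U>" "k \<in> \<U>" "v \<in> j" "v \<in> k" "g \<in> C1"
proof -
  obtain j k v g where m: "m = ((j, k), (v, g))" by (metis surj_pair)
  show thesis by (rule that[OF m]) (use assms m in auto)
qed

lemma Pc_category: "top_category (Pc_obtop G X \<U>) (Pc_mortop G X \<U>) (dom Pc') (cod Pc') (idm Pc') (cmp Pc')"
proof (rule top_categoryI)
  show "continuous_map (Pc_mortop G X \<U>) (Pc_obtop G X \<U>) (dom Pc')" "continuous_map (Pc_mortop G X \<U>) (Pc_obtop G X \<U>) (cod Pc')"
    "continuous_map (Pc_obtop G X \<U>) (Pc_mortop G X \<U>) (idm Pc')"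
    using continuous_Pc_dom[OF continuous_map_id] continuous_Pc_cod[OF continuous_map_id] continuous_Pc_idm[OF continuous_map_id]
    by simp_all
  show "continuous_map Z (Pc_mortop G X \<U>) (\<lambda>z. cmp Pc' (f z) (g z))"
    if "continuous_map Z (Pc_mortop G X \<U>) f" "continuous_map Z (Pc_mortop G X \<U>) g" "\<And>z. z \<in> topspace Z \<Longrightarrow> cod Pc' (f z) = dom Pc' (g z)"
    for Z :: "(('x, 'b) Pc_mor \<times> ('x, 'b) Pc_mor) topology" and f g
    using that by (rule continuous_Pc_cmp)
  show "dom Pc' (idm Pc' p) = p \<and> cod Pc' (idm Pc' p) = p" if "p \<in> topspace (Pc_obtop G X \<U>)" for p
    using that by (rule Pc_obE) (simp add: \<epsilon>)
  show "cmp Pc' f g \<in> topspace (Pc_mortop G X \<U>) \<and> dom Pc' (cmp Pc' f g) = dom Pc' f \<and> cod Pc' (cmp Pc' f g) = cod Pc' g"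
    if f: "f \<in> topspace (Pc_mortop G X \<U>)" and g: "g \<in> topspace (Pc_mortop G X \<U>)" and c: "cod Pc' f = dom Pc' g" for f g
  proof -
    obtain i j v f' where f': "f = ((i, j), (v, f'))" "i \<in> \<U>" "j \<in> \<U>" "v \<in> i" "v \<in> j" "f' \<in> C1" using f by (rule Pc_morE)
    obtain j' k v' g' where g': "g = ((j', k), (v', g'))" "j' \<in> \<U>" "k \<in> \<U>" "v' \<in> j'" "v' \<in> k" "g' \<in> C1" using g by (rule Pc_morE)
    have eq: "j' = j" "v' = v" "i0 (x i j v) \<cdot> \<t> f' = \<s> g'" using c unfolding f'(1) g'(1) by auto
    show ?thesis
      using cmp_closed[OF f'(2,3) g'(3) f'(4,5) _ f'(6) g'(6) eq(3)] f' g' unfolding f'(1) g'(1) eq Pc_simps by simp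
  qed
  show "cmp Pc' (idm Pc' (dom Pc' f)) f = f \<and> cmp Pc' f (idm Pc' (cod Pc' f)) = f" if "f \<in> topspace (Pc_mortop G X \<U>)" for f
    using that
  proof (rule Pc_morE)
    fix j k v g assume m: "f = ((j, k), (v, g))" "j \<in> \<U>" "k \<in> \<U>" "v \<in> j" "v \<in> k" "g \<in> C1"
    then have "Pc_idm G X \<U> (x, e) (k, (v, i0 (x j k v) \<cdot> \<t> g)) = Pc_unit (k, (v, i0 (x j k v) \<cdot> \<t> g))"
      "Pc_idm G X \<U> (x, e) (j, (v, \<s> g)) = Pc_unit (j, (v, \<s> g))" by simp_all
    then show ?thesis
      unfolding m(1) Pc_simps(3-5) using Pc_unit_cmp[OF m(2-6)] by (simp only:)
  qed
  show "cmp Pc' (cmp Pc' f g) h = cmp Pc' f (cmp Pc' g h)"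
    if f: "f \<in> topspace (Pc_mortop G X \<U>)" and g: "g \<in> topspace (Pc_mortop G X \<U>)" and h: "h \<in> topspace (Pc_mortop G X \<U>)"
      and c: "cod Pc' f = dom Pc' g" "cod Pc' g = dom Pc' h" for f g h
  proof -
    obtain i j v f' where f': "f = ((i, j), (v, f'))" "i \<in> \<U>" "j \<in> \<U>" "v \<in> i" "v \<in> j" "f' \<in> C1" using f by (rule Pc_morE)
    obtain j' k v' g' where g': "g = ((j', k), (v', g'))" "j' \<in> \<U>" "k \<in> \<U>" "v' \<in> j'" "v' \<in> k" "g' \<in> C1" using g by (rule Pc_morE)
    obtain k' l v'' h' where h': "h = ((k', l), (v'', h'))" "k' \<in> \<U>" "l \<in> \<U>" "v'' \<in> k'" "v'' \<in> l" "h' \<in> C1" using h by (rule Pc_morE)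
    have eq: "j' = j" "v' = v" "i0 (x i j v) \<cdot> \<t> f' = \<s> g'" using c(1) unfolding f'(1) g'(1) by auto
    have eq': "k' = k" "v'' = v" "i0 (x j k v) \<cdot> \<t> g' = \<s> h'" using c(2) unfolding g'(1) h'(1) eq(1,2) by auto
    show ?thesis
      unfolding f'(1) g'(1) h'(1) eq(1,2) eq'(1,2)
      by (rule Pc_assoc) (use f' g' h' eq eq' in simp_all)
  qed
qed

lemma Pc_G_2space: "G_2space G Pc'"
proof (rule G_2spaceI)
  show "top_category (ob_top Pc') (mor_top Pc') (dom Pc') (cod Pc') (idm Pc') (cmp Pc')"
    using Pc_category by simp
  show "continuous_map (prod_topology (ob_top Pc') (G0 G)) (ob_top Pc') (\<lambda>z. act0 Pc' (fst z) (snd z))"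
    unfolding Pc_simps by (rule continuous_Pc_act0[OF continuous_map_fst continuous_map_snd])
  show "continuous_map (prod_topology (mor_top Pc') (G1 G)) (mor_top Pc') (\<lambda>z. act1 Pc' (fst z) (snd z))"
    unfolding Pc_simps by (rule continuous_Pc_act1[OF continuous_map_fst continuous_map_snd])
  show "act1 Pc' (cmp Pc' f1 f2) (gcomp G g1 g2) = cmp Pc' (act1 Pc' f1 g1) (act1 Pc' f2 g2)"
    if f: "f1 \<in> topspace (mor_top Pc')" and g: "f2 \<in> topspace (mor_top Pc')" and gg: "g1 \<in> C1" "g2 \<in> C1"
      and c: "cod Pc' f1 = dom Pc' f2" "\<t> g1 = \<s> g2" for f1 f2 g1 g2
  proof -
    obtain i j v f' where f': "f1 = ((i, j), (v, f'))" "i \<in> \<U>" "j \<in> \<U>" "v \<in> i" "v \<in> j" "f' \<in> C1"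
      using f unfolding Pc_simps by (rule Pc_morE)
    obtain j' k v' g' where g': "f2 = ((j', k), (v', g'))" "j' \<in> \<U>" "k \<in> \<U>" "v' \<in> j'" "v' \<in> k" "g' \<in> C1"
      using g unfolding Pc_simps by (rule Pc_morE)
    have eq: "j' = j" "v' = v" "i0 (x i j v) \<cdot> \<t> f' = \<s> g'" using c(1) unfolding f'(1) g'(1) by auto
    have t: "\<t> f' = x i j v \<cdot> \<s> g'" using f' by (simp flip: eq(3))
    show ?thesis
      using interchange[of f' g1 "\<iota> (x i j v) \<odot> g'" g2] f'(2-) g'(2-) t gg c(2)
      unfolding f'(1) g'(1) eq(1,2) Pc_simps by simp
  qed
qed (auto elim!: Pc_morE Pc_obE simp: \<epsilon>)

sublocale Pc: g2space G Pc'
  by unfold_locales (rule Pc_G_2space)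

text \<open>The third component solves \<open>\<Phi> j (Pc_inv m) = ginv (\<Phi> j m)\<close> for
  the unknown component, with \<open>j\<close> the source index of \<open>m\<close>. Being an
  inverse is then inherited from \<open>\<G>\<close> through \<open>\<Phi> j\<close>.\<close>

definition Pc_inv :: "('x, 'b) Pc_mor \<Rightarrow> ('x, 'b) Pc_mor" where
  "Pc_inv = (\<lambda>((j, k), (v, g)). ((k, j), (v, i1 (\<iota> (x j k v)) \<odot> i1 (e j k j v) \<odot> ginv (\<Phi> j ((j, k), (v, g))))))"

lemma Pc_inv:
  assumes "m \<in> topspace (Pc_mortop G X \<U>)"
  shows "inverse_pair Pc' m (Pc_inv m)"
proof -
  obtain j k v g where m: "m = ((j, k), (v, g))" and [simp]: "j \<in> \<U>" "k \<in> \<U>" "v \<in> j" "v \<in> k" "g \<in> C1"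
    using assms by (rule Pc_morE)
  note [simp] = \<Phi> \<epsilon>
  define h where "h = i1 (\<iota> (x j k v)) \<odot> i1 (e j k j v) \<odot> ginv (\<Phi> j ((j, k), (v, g)))"
  have h [simp]: "h \<in> C1" "\<s> h = i0 (x j k v) \<cdot> \<t> g" "\<t> h = x k j v \<cdot> \<s> g"
    by (simp_all add: h_def tgt_e)
  have inv: "Pc_inv m = ((k, j), (v, h))" by (simp add: Pc_inv_def m h_def)
  have \<Phi>h: "\<Phi> j ((k, j), (v, h)) = ginv (\<Phi> j ((j, k), (v, g)))"
    unfolding \<Phi>_def[of j] prod.case by (simp add: h_def \<Phi>_def)
  have "\<Phi> j (cmp Pc' ((j, k), (v, g)) ((k, j), (v, h))) = \<Phi> j (Pc_unit (j, (v, \<s> g)))"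
    using \<Phi>_cmp[of j j k j v g h] by (simp only: \<Phi>h prod.case) (simp add: \<Phi>_unit)
  then have 1: "cmp Pc' ((j, k), (v, g)) ((k, j), (v, h)) = Pc_unit (j, (v, \<s> g))"
    using cmp_closed[of j k j v g h] by (simp add: \<Phi>_inject)
  have "\<Phi> j (cmp Pc' ((k, j), (v, h)) ((j, k), (v, g))) = \<Phi> j (Pc_unit (k, (v, i0 (x j k v) \<cdot> \<t> g)))"
    using \<Phi>_cmp[of j k j k v h g] \<Phi>_unit[of j k v "i0 (x j k v) \<cdot> \<t> g"]
    by (simp only: \<Phi>h prod.case) simp
  then have 2: "cmp Pc' ((k, j), (v, h)) ((j, k), (v, g)) = Pc_unit (k, (v, i0 (x j k v) \<cdot> \<t> g))"
    using cmp_closed[of k j k v h g] by (simp add: \<Phi>_inject)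
  show ?thesis
    unfolding inverse_pair_def inv unfolding m using 1 2 by (simp del: Pc_simps(6))
qed

section \<open>Local triviality of \<open>P_c\<close>\<close>

lemma Pc_proj_simps [simp]: "Pc_proj (i, (u, a)) = u"
  by (simp add: Pc_proj_def)

lemma Pc_proj_dom: "f \<in> topspace (Pc_mortop G X \<U>) \<Longrightarrow> Pc_proj (dom Pc' f) = Pc_proj (cod Pc' f)"
  by (auto elim!: Pc_morE)

lemma continuous_Pc_proj: "continuous_map Z (Pc_obtop G X \<U>) k \<Longrightarrow> continuous_map Z X (\<lambda>z. Pc_proj (k z))"
proof (erule Pc_ob_cases)
  fix i Z' v a
  assume h: "continuous_map Z' X v" "\<And>z. z \<in> topspace Z' \<Longrightarrow> k z = (i, (v z, a z)) \<and> v z \<in> i \<and> a z \<in> C0"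
  show "continuous_map Z' X (\<lambda>z. Pc_proj (k z))"
    by (rule continuous_map_eq[OF h(1)]) (use h(2) in simp)
qed

lemma continuous_\<Phi>:
  assumes "i \<in> \<U>" and k: "continuous_map Z (Pc_mortop G X \<U>) k" and i: "\<And>z. z \<in> topspace Z \<Longrightarrow> Pc_proj (dom Pc' (k z)) \<in> i"
  shows "continuous_map Z (G1 G) (\<lambda>z. \<Phi> i (k z))"
  using k
proof (rule Pc_mor_cases)
  fix j l Z' v g
  assume h: "j \<in> \<U>" "l \<in> \<U>" "Z' = subtopology Z {z. fst (k z) = (j, l)}" "continuous_map Z' X v" "continuous_map Z' (G1 G) g"
    "\<And>z. z \<in> topspace Z' \<Longrightarrow> k z = ((j, l), (v z, g z)) \<and> v z \<in> j \<and> v z \<in> l \<and> g z \<in> C1"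
  have vi: "v z \<in> i" if "z \<in> topspace Z'" for z
    using i[of z] h(6)[OF that] that unfolding h(3) by auto
  show "continuous_map Z' (G1 G) (\<lambda>z. \<Phi> i (k z))"
  proof (rule continuous_map_eq[where f = "\<lambda>z. e i j l (v z) \<odot> \<iota> (x i j (v z)) \<odot> g z"])
    show "continuous_map Z' (G1 G) (\<lambda>z. e i j l (v z) \<odot> \<iota> (x i j (v z)) \<odot> g z)"
      by (intro continuous_cocycle_rules) (use assms(1) h(1,2,4-6) vi in auto)
  qed (use h(6) in \<open>simp add: \<Phi>_def\<close>)
qed

text \<open>The reason is that \<open>c \<odot> \<iota> y \<in> Ker t\<close> commutes with \<open>\<E>\<close>.\<close>
lemma star_commute:
  assumes [simp]: "c \<in> C1" "y \<in> C0" "g \<in> C1" "\<s> c = one0 G" and t: "\<t> c = i0 y"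
  shows "(\<iota> y \<odot> g) \<star> (c \<odot> \<iota> (y \<cdot> \<t> g)) = (c \<odot> \<iota> (y \<cdot> \<s> g)) \<star> g"
proof -
  have "(c \<odot> \<iota> y) \<odot> (g \<odot> i1 (\<iota> (\<s> g))) = (g \<odot> i1 (\<iota> (\<s> g))) \<odot> (c \<odot> \<iota> y)"
    by (rule ker_commute) (simp_all add: t)
  from arg_cong[OF this, of "\<lambda>w. w \<odot> \<iota> (\<s> g)"] show ?thesis
    by (simp add: star_eq t)
qed

lemma continuous_Pc_inv:
  "continuous_map Z (Pc_mortop G X \<U>) k \<Longrightarrow> continuous_map Z (Pc_mortop G X \<U>) (\<lambda>z. Pc_inv (k z))"
proof (erule Pc_mor_cases)
  fix i j Z' v g
  assume h: "i \<in> \<U>" "j \<in> \<U>" "continuous_map Z' X v" "continuous_map Z' (G1 G) g"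
    "\<And>z. z \<in> topspace Z' \<Longrightarrow> k z = ((i, j), (v z, g z)) \<and> v z \<in> i \<and> v z \<in> j \<and> g z \<in> C1"
  show "continuous_map Z' (Pc_mortop G X \<U>) (\<lambda>z. Pc_inv (k z))"
  proof (rule continuous_map_eq[where f = "\<lambda>z. ((j, i), (v z, i1 (\<iota> (x i j (v z))) \<odot> i1 (e i j i (v z)) \<odot>
       ginv (e i i j (v z) \<odot> \<iota> (x i i (v z)) \<odot> g z)))"])
    show "continuous_map Z' (Pc_mortop G X \<U>) (\<lambda>z. ((j, i), (v z, i1 (\<iota> (x i j (v z))) \<odot> i1 (e i j i (v z)) \<odot>
       ginv (e i i j (v z) \<odot> \<iota> (x i i (v z)) \<odot> g z))))"
      by (intro continuous_into_Pc_mor continuous_cocycle_rules continuous_ginv) (use h in auto)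
  qed (use h(5) in \<open>simp add: Pc_inv_def \<Phi>_def\<close>)
qed

text \<open>Over \<open>i\<close> the chart is \<open>\<Phi> i\<close> on morphisms and left
  multiplication by \<open>x i j\<close> on objects. Its quasi-inverse \<open>\<psi>\<close> embeds
  the trivial bundle as the summand \<open>i\<close>. Both composites differ from the identity,
  already because \<open>x i i\<close> need not be trivial.\<close>

lemma Pc_principal_bundle: "principal_bundle G X Pc' Pc_proj"
  unfolding principal_bundle_def
proof (intro conjI exI ballI)
  show "G_2space G Pc'" by (rule Pc_G_2space)
  show "functor_to_discrete X Pc' Pc_proj"
    using continuous_Pc_proj[OF continuous_map_id] Pc_proj_dom by (simp add: functor_to_discrete_def o_def id_def)
  show over: "Pc_proj (act0 Pc' p y) = Pc_proj p" if "p \<in> topspace (ob_top Pc')" for p y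
    using that unfolding Pc_simps by (rule Pc_obE) simp
  show "open_cover X \<U>" by (rule cover)
  fix i assume i [simp]: "i \<in> \<U>"
  let ?R = "restrict_space Pc' Pc_proj i" and ?Q = "trivial_space G X i"
  have iX: "topspace X \<inter> i = i" using in_X[OF i] by auto
  have R: "G_2space G ?R" by (rule Pc.G_2space_restrict) (use over Pc_proj_dom in simp_all)
  have Q: "G_2space G ?Q" by (rule G_2space_trivial)
  interpret Q: g2space G ?Q using Q by unfold_locales
  interpret R: g2space G ?R using R by unfold_locales
  define \<phi>0 where "\<phi>0 = (\<lambda>(j, (v, a)). (v, x i j v \<cdot> a))"
  define \<phi>1 where "\<phi>1 m = (Pc_proj (dom Pc' m), \<Phi> i m)" for m
  define \<psi>0 :: "'x \<times> 'a \<Rightarrow> ('x, 'a) Pc_ob" where "\<psi>0 b = (i, b)" for b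
  define \<psi>1 where "\<psi>1 b = ((i, i), (fst b, \<epsilon> i (fst b) \<odot> snd b))" for b
  have [simp]: "\<phi>0 (j, (v, a)) = (v, x i j v \<cdot> a)" "\<phi>1 ((j, k), (v, g)) = (v, \<Phi> i ((j, k), (v, g)))"
    "\<psi>0 b = (i, b)" "\<psi>1 (u, g) = ((i, i), (u, \<epsilon> i u \<odot> g))" for j k v a g b u
    by (simp_all add: \<phi>0_def \<phi>1_def \<psi>0_def \<psi>1_def)
  note [simp] = \<epsilon> \<Phi>_unit \<Phi>
  have \<Phi>_act: "\<Phi> i ((j, k), (v, g \<odot> h)) = \<Phi> i ((j, k), (v, g)) \<odot> h"
    if "j \<in> \<U>" "k \<in> \<U>" "v \<in> i" "v \<in> j" "v \<in> k" "g \<in> C1" "h \<in> C1" for j k v g h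
    using that by (simp add: \<Phi>_def)
  have subR: "continuous_map (ob_top ?R) (Pc_obtop G X \<U>) (\<lambda>z. z)" "continuous_map (mor_top ?R) (Pc_mortop G X \<U>) (\<lambda>z. z)"
    by (simp_all add: continuous_map_from_subtopology)
  have R0E: thesis if "p \<in> topspace (ob_top ?R)"
    "\<And>j v a. p = (j, (v, a)) \<Longrightarrow> j \<in> \<U> \<Longrightarrow> v \<in> i \<Longrightarrow> v \<in> j \<Longrightarrow> a \<in> C0 \<Longrightarrow> thesis" for p thesis
    using that by (auto elim!: Pc_obE)
  have R1E: thesis if "m \<in> topspace (mor_top ?R)"
    "\<And>j k v g. m = ((j, k), (v, g)) \<Longrightarrow> j \<in> \<U> \<Longrightarrow> k \<in> \<U> \<Longrightarrow> v \<in> i \<Longrightarrow> v \<in> j \<Longrightarrow> v \<in> k \<Longrightarrow> g \<in> C1 \<Longrightarrow> thesis" for m thesis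
    using that by (auto elim!: Pc_morE)
  have \<phi>: "G_functor G ?R ?Q \<phi>0 \<phi>1"
    unfolding G_functor_def
  proof (intro conjI ballI impI)
    show "continuous_map (ob_top ?R) (ob_top ?Q) \<phi>0"
      using subR(1)
    proof (rule Pc_ob_cases)
      fix j Z' v a
      assume h: "j \<in> \<U>" "Z' = subtopology (ob_top ?R) {z. fst z = j}" "continuous_map Z' X v" "continuous_map Z' (G0 G) a"
        "\<And>z. z \<in> topspace Z' \<Longrightarrow> z = (j, (v z, a z)) \<and> v z \<in> j \<and> a z \<in> C0"
      have vi: "v z \<in> i" if z: "z \<in> topspace Z'" for z
      proof -
        have "Pc_proj z \<in> i" using z unfolding h(2) by simp
        then show ?thesis by (subst (asm) h(5)[OF z, THEN conjunct1]) simp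
      qed
      show "continuous_map Z' (ob_top ?Q) \<phi>0"
      proof (rule continuous_map_eq[where f = "\<lambda>z. (v z, x i j (v z) \<cdot> a z)"])
        show "continuous_map Z' (ob_top ?Q) (\<lambda>z. (v z, x i j (v z) \<cdot> a z))"
          unfolding trivial_space_simps
          by (intro continuous_map_pairedI continuous_cocycle_rules) (use h(1,3,4) h(5) vi in \<open>auto simp: continuous_map_in_subtopology\<close>)
        show "(v z, x i j (v z) \<cdot> a z) = \<phi>0 z" if "z \<in> topspace Z'" for z
          by (subst (3) h(5)[OF that, THEN conjunct1]) simp
      qed
    qed
    have "continuous_map (mor_top ?R) (G1 G) (\<Phi> i)"
      by (rule continuous_\<Phi>[OF i subR(2)]) simp
    moreover have "continuous_map (mor_top ?R) X (\<lambda>m. Pc_proj (dom Pc' m))"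
      by (intro continuous_Pc_proj continuous_Pc_dom subR(2))
    ultimately show "continuous_map (mor_top ?R) (mor_top ?Q) \<phi>1"
      unfolding \<phi>1_def trivial_space_simps
      by (intro continuous_map_pairedI) (auto simp: continuous_map_in_subtopology)
    fix f assume "f \<in> topspace (mor_top ?R)"
    then obtain j k v g where f: "f = ((j, k), (v, g))" "j \<in> \<U>" "k \<in> \<U>" "v \<in> i" "v \<in> j" "v \<in> k" "g \<in> C1" by (rule R1E)
    show "dom ?Q (\<phi>1 f) = \<phi>0 (dom ?R f)" "cod ?Q (\<phi>1 f) = \<phi>0 (cod ?R f)" using f by simp_all
    show "\<phi>1 (act1 ?R f h) = act1 ?Q (\<phi>1 f) h" if "h \<in> C1" for h using f that by (simp add: \<Phi>_act)
    fix f2 assume "f2 \<in> topspace (mor_top ?R)"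
    then obtain k' l v' h where f2: "f2 = ((k', l), (v', h))" "k' \<in> \<U>" "l \<in> \<U>" "v' \<in> i" "v' \<in> k'" "v' \<in> l" "h \<in> C1" by (rule R1E)
    assume "cod ?R f = dom ?R f2"
    then have eq: "k' = k" "v' = v" "i0 (x j k v) \<cdot> \<t> g = \<s> h" unfolding f(1) f2(1) by auto
    show "\<phi>1 (cmp ?R f f2) = cmp ?Q (\<phi>1 f) (\<phi>1 f2)"
      using \<Phi>_cmp[OF i f(2,3) f2(3) f(4-6) _ f(7) f2(7) eq(3)] f2(6) unfolding f(1) f2(1) eq(1,2) by simp
  next
    fix p assume "p \<in> topspace (ob_top ?R)"
    then obtain j v a where p: "p = (j, (v, a))" "j \<in> \<U>" "v \<in> i" "v \<in> j" "a \<in> C0" by (rule R0E)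
    show "\<phi>1 (idm ?R p) = idm ?Q (\<phi>0 p)" using p by simp
    show "\<phi>0 (act0 ?R p y) = act0 ?Q (\<phi>0 p) y" if "y \<in> C0" for y using p that by simp
  qed
  \<comment> \<open>\<open>\<psi>1 (u, g)\<close> is the identity of \<open>(i, (u, one0 G))\<close>
    acted on by \<open>g\<close>, so compatibility with composition is a property of any
    \<open>\<G>\<close>-2-space.\<close>
  have \<psi>_cmp: "cmp Pc' ((i, i), (u, \<epsilon> i u \<odot> g)) ((i, i), (u, \<epsilon> i u \<odot> h)) = ((i, i), (u, \<epsilon> i u \<odot> (g \<star> h)))"
    if "u \<in> i" "g \<in> C1" "h \<in> C1" "\<t> g = \<s> h" for u g h
    using Pc.idm_act_star[of "(i, (u, one0 G))" g h] that by (simp del: Pc_simps(6))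
  have subQ: "continuous_map (ob_top ?Q) (subtopology X i) fst" "continuous_map (mor_top ?Q) (subtopology X i) fst"
    "continuous_map (ob_top ?Q) (G0 G) snd" "continuous_map (mor_top ?Q) (G1 G) snd"
    by (simp_all add: continuous_map_fst continuous_map_snd)
  then have subQ': "continuous_map (ob_top ?Q) X fst" "continuous_map (mor_top ?Q) X fst"
    by (simp_all add: continuous_map_in_subtopology)
  have \<psi>: "G_functor G ?Q ?R \<psi>0 \<psi>1"
    unfolding G_functor_def
  proof (intro conjI ballI impI)
    have "continuous_map (ob_top ?Q) (Pc_obtop G X \<U>) (\<lambda>z. (i, (fst z, snd z)))"
      by (intro continuous_into_Pc_ob) (use subQ subQ' in \<open>auto simp: iX\<close>)
    then show "continuous_map (ob_top ?Q) (ob_top ?R) \<psi>0"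
      unfolding \<psi>0_def[abs_def] by (auto simp: continuous_map_in_subtopology)
    have "continuous_map (mor_top ?Q) (Pc_mortop G X \<U>) \<psi>1"
      unfolding \<psi>1_def
      by (intro continuous_into_Pc_mor continuous_rules continuous_\<epsilon>) (use subQ subQ' in \<open>auto simp: iX\<close>)
    then show "continuous_map (mor_top ?Q) (mor_top ?R) \<psi>1"
      by (auto simp: continuous_map_in_subtopology)
  qed (auto simp: iX \<psi>_cmp simp del: Pc_simps(6))
  \<comment> \<open>The arrow from \<open>(i, (v, x i j v \<cdot> a))\<close>, which is
    \<open>\<psi>0 (\<phi>0 p)\<close>, to \<open>p = (j, (v, a))\<close> whose component is an
    identity of \<open>\<G>\<close>.\<close>
  define \<alpha> where "\<alpha> = (\<lambda>(j, (v, a)). ((i, j), (v, \<iota> (x i j v \<cdot> a))))"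
  have [simp]: "\<alpha> (j, (v, a)) = ((i, j), (v, \<iota> (x i j v \<cdot> a)))" for j v a by (simp add: \<alpha>_def)
  show "G_equiv_over G ?R Pc_proj ?Q fst"
    unfolding G_equiv_over_def
  proof (intro exI conjI ballI)
    show "G_functor G ?R ?Q \<phi>0 \<phi>1" "G_functor G ?Q ?R \<psi>0 \<psi>1" by (fact \<phi> \<psi>)+
    show "fst (\<phi>0 p) = Pc_proj p" if "p \<in> topspace (ob_top ?R)" for p using that by (rule R0E) simp
    show "Pc_proj (\<psi>0 b) = fst b" for b by (cases b) simp
    have R\<alpha>: "\<alpha> p \<in> topspace (Pc_mortop G X \<U>)" "dom Pc' (\<alpha> p) = \<psi>0 (\<phi>0 p)" "cod Pc' (\<alpha> p) = p" "Pc_proj (\<psi>0 (\<phi>0 p)) \<in> i"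
      "Pc_proj p \<in> i"
      if "p \<in> topspace (ob_top ?R)" for p
      using that by (rule R0E, simp)+
    have c\<alpha>: "continuous_map (ob_top ?R) (Pc_mortop G X \<U>) \<alpha>"
      using subR(1)
    proof (rule Pc_ob_cases)
      fix j Z' v a
      assume h: "j \<in> \<U>" "Z' = subtopology (ob_top ?R) {z. fst z = j}" "continuous_map Z' X v" "continuous_map Z' (G0 G) a"
        "\<And>z. z \<in> topspace Z' \<Longrightarrow> z = (j, (v z, a z)) \<and> v z \<in> j \<and> a z \<in> C0"
      have vi: "v z \<in> i" if z: "z \<in> topspace Z'" for z
      proof -
        have "Pc_proj z \<in> i" using z unfolding h(2) by simp
        then show ?thesis by (subst (asm) h(5)[OF z, THEN conjunct1]) simp
      qed
      show "continuous_map Z' (Pc_mortop G X \<U>) \<alpha>"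
      proof (rule continuous_map_eq[where f = "\<lambda>z. ((i, j), (v z, \<iota> (x i j (v z) \<cdot> a z)))"])
        show "continuous_map Z' (Pc_mortop G X \<U>) (\<lambda>z. ((i, j), (v z, \<iota> (x i j (v z) \<cdot> a z))))"
          by (intro continuous_into_Pc_mor continuous_cocycle_rules) (use h(1,3-5) vi in auto)
        show "((i, j), (v z, \<iota> (x i j (v z) \<cdot> a z))) = \<alpha> z" if "z \<in> topspace Z'" for z
          by (subst (3) h(5)[OF that, THEN conjunct1]) simp
      qed
    qed
    show "G0_nat_iso G ?R ?R (\<psi>0 \<circ> \<phi>0) (\<psi>1 \<circ> \<phi>1) id id"
    proof (rule G0_nat_isoI[OF top_2group R R G_functor_comp[OF \<phi> \<psi>] G_functor_id])
      show "G0_nat_trans G ?R ?R (\<psi>0 \<circ> \<phi>0) (\<psi>1 \<circ> \<phi>1) id id \<alpha>"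
        unfolding G0_nat_trans_def
      proof (intro conjI ballI)
        show "continuous_map (ob_top ?R) (mor_top ?R) \<alpha>"
          unfolding restrict_space_simps(2) Pc_simps(2)
          by (rule continuous_map_into_subtopology[OF c\<alpha>], rule Pi_I) (simp only: mem_Collect_eq R\<alpha>(2,4))
        show "dom ?R (\<alpha> p) = (\<psi>0 \<circ> \<phi>0) p" "cod ?R (\<alpha> p) = id p" if "p \<in> topspace (ob_top ?R)" for p
          using R\<alpha>[OF that] by simp_all
        show "\<alpha> (act0 ?R p y) = act1 ?R (\<alpha> p) (\<iota> y)" if "p \<in> topspace (ob_top ?R)" "y \<in> C0" for p y
          using that(1) by (rule R0E) (use that(2) in simp)
        fix m assume "m \<in> topspace (mor_top ?R)"
        then obtain j k v g where m: "m = ((j, k), (v, g))" and [simp]: "j \<in> \<U>" "k \<in> \<U>" "v \<in> i" "v \<in> j" "v \<in> k" "g \<in> C1" by (rule R1E)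
        define F where "F = \<Phi> i ((j, k), (v, g))"
        have F [simp]: "F \<in> C1" "\<s> F = x i j v \<cdot> \<s> g" "\<t> F = x i k v \<cdot> i0 (x j k v) \<cdot> \<t> g" by (simp_all add: F_def)
        have \<Phi>F: "\<Phi> i ((i, i), (v, \<epsilon> i v \<odot> F)) = \<iota> (x i i v) \<odot> F"
          using \<Phi>_act[of i i v "\<epsilon> i v" F] \<Phi>_unit[of i i v "one0 G"] by simp
        \<comment> \<open>By \<open>e_diagonal\<close> the factor in front is the same for every
          \<open>l\<close>. The two ends of the naturality square, with indices \<open>j\<close> and
          \<open>k\<close>, therefore carry one common factor \<open>e i i i v\<close>, and
          \<open>star_commute\<close> moves it across \<open>F\<close>.\<close>
        have \<Phi>\<alpha>: "\<Phi> i ((i, l), (v, \<iota> y)) = e i i i v \<odot> \<iota> (x i i v \<cdot> y)" if "l \<in> \<U>" "v \<in> l" "y \<in> C0" for l y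
          using that e_diagonal[of i l v] by (simp add: \<Phi>_def)
        have "\<Phi> i (cmp Pc' ((i, i), (v, \<epsilon> i v \<odot> F)) ((i, k), (v, \<iota> (\<t> F))))
            = (\<iota> (x i i v) \<odot> F) \<star> (e i i i v \<odot> \<iota> (x i i v \<cdot> \<t> F))"
          by (subst \<Phi>_cmp) (use \<Phi>\<alpha>[of k "\<t> F"] in \<open>simp_all add: \<Phi>F\<close>)
        also have "\<dots> = (e i i i v \<odot> \<iota> (x i i v \<cdot> \<s> F)) \<star> F"
          by (rule star_commute) (simp_all add: tgt_e)
        also have "\<dots> = \<Phi> i (cmp Pc' ((i, j), (v, \<iota> (\<s> F))) ((j, k), (v, g)))"
          by (subst \<Phi>_cmp) (use \<Phi>\<alpha>[of j "\<s> F"] in \<open>simp_all flip: F_def\<close>)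
        finally have "cmp Pc' ((i, i), (v, \<epsilon> i v \<odot> F)) ((i, k), (v, \<iota> (\<t> F))) = cmp Pc' ((i, j), (v, \<iota> (\<s> F))) ((j, k), (v, g))"
          using cmp_closed[of i i k v "\<epsilon> i v \<odot> F" "\<iota> (\<t> F)"] cmp_closed[of i j k v "\<iota> (\<s> F)" g] by (simp add: \<Phi>_inject)
        then show "cmp ?R ((\<psi>1 \<circ> \<phi>1) m) (\<alpha> (cod ?R m)) = cmp ?R (\<alpha> (dom ?R m)) (id m)"
          by (simp add: m flip: F_def del: Pc_simps(6))
      qed
      have inv: "Pc_inv (\<alpha> p) \<in> topspace (Pc_mortop G X \<U>)" "dom Pc' (Pc_inv (\<alpha> p)) = p"
        if "p \<in> topspace (ob_top ?R)" for p
        using Pc_inv[OF R\<alpha>(1)[OF that]] R\<alpha>(3)[OF that] by (simp_all add: inverse_pair_def)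
      show "continuous_map (ob_top ?R) (mor_top ?R) (\<lambda>p. Pc_inv (\<alpha> p))"
        unfolding restrict_space_simps(2) Pc_simps(2)
        by (rule continuous_map_into_subtopology[OF continuous_Pc_inv[OF c\<alpha>]], rule Pi_I)
          (simp only: mem_Collect_eq inv(2) R\<alpha>(5))
      show "inverse_pair ?R (\<alpha> p) (Pc_inv (\<alpha> p))" if "p \<in> topspace (ob_top ?R)" for p
        using Pc_inv[OF R\<alpha>(1)[OF that]] R\<alpha>[OF that] inv[OF that] by (simp add: inverse_pair_def)
    qed
    \<comment> \<open>\<open>\<phi>0 (\<psi>0 (u, a))\<close> is
      \<open>(u, x i i u \<cdot> a)\<close>, and \<open>e i i i u\<close> has target
      \<open>i0 (x i i u)\<close>, so this arrow ends at \<open>a\<close> as required.\<close>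
    define \<beta> where "\<beta> b = (fst b, e i i i (fst b) \<odot> \<iota> (x i i (fst b) \<cdot> snd b))" for b
    have c\<beta>: "continuous_map (ob_top ?Q) (G1 G) (\<lambda>b. e i i i (fst b) \<odot> \<iota> (x i i (fst b) \<cdot> snd b))"
      by (intro continuous_cocycle_rules) (use subQ subQ' in \<open>auto simp: iX\<close>)
    show "G0_nat_iso G ?Q ?Q (\<phi>0 \<circ> \<psi>0) (\<phi>1 \<circ> \<psi>1) id id"
    proof (rule G0_nat_isoI[OF top_2group Q Q G_functor_comp[OF \<psi> \<phi>] G_functor_id])
      show "G0_nat_trans G ?Q ?Q (\<phi>0 \<circ> \<psi>0) (\<phi>1 \<circ> \<psi>1) id id \<beta>"
        unfolding G0_nat_trans_def
      proof (intro conjI ballI)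
        show "continuous_map (ob_top ?Q) (mor_top ?Q) \<beta>"
          unfolding \<beta>_def[abs_def] using continuous_map_pairedI[OF subQ(1) c\<beta>] by simp
        fix f assume "f \<in> topspace (mor_top ?Q)"
        then obtain u g where f: "f = (u, g)" and [simp]: "u \<in> i" "g \<in> C1" by (cases f) (auto simp: iX)
        have "\<Phi> i ((i, i), (u, \<epsilon> i u \<odot> g)) = \<iota> (x i i u) \<odot> g"
          using \<Phi>_act[of i i u "\<epsilon> i u" g] \<Phi>_unit[of i i u "one0 G"] by simp
        then show "cmp ?Q ((\<phi>1 \<circ> \<psi>1) f) (\<beta> (cod ?Q f)) = cmp ?Q (\<beta> (dom ?Q f)) (id f)"
          using star_commute[of "e i i i u" "x i i u" g] by (simp add: f \<beta>_def tgt_e)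
      qed (auto simp: \<beta>_def iX tgt_e)
      show "continuous_map (ob_top ?Q) (mor_top ?Q) (\<lambda>b. (fst b, ginv (snd (\<beta> b))))"
        unfolding \<beta>_def snd_conv using continuous_map_pairedI[OF subQ(1) continuous_ginv[OF c\<beta>]] by simp
      show "inverse_pair ?Q (\<beta> b) (fst b, ginv (snd (\<beta> b)))" if "b \<in> topspace (ob_top ?Q)" for b
        using that by (auto simp: inverse_pair_def \<beta>_def iX)
    qed
  qed
qed

end

section \<open>Cohomology from bundle morphisms\<close>

context cocycle
begin

lemma Pc_mor_eqI:
  assumes m: "m \<in> topspace (Pc_mortop G X \<U>)" and d: "dom Pc' m = (i, (v, a))" and c: "cod Pc' m = (j, (w, b))"
  shows "m = ((i, j), (v, snd (snd m)))" "i \<in> \<U>" "j \<in> \<U>" "v \<in> i" "v \<in> j" "w = v" "snd (snd m) \<in> C1"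
    "\<s> (snd (snd m)) = a" "\<t> (snd (snd m)) = x i j v \<cdot> b"
proof -
  obtain j' k v' g where g: "m = ((j', k), (v', g))" "j' \<in> \<U>" "k \<in> \<U>" "v' \<in> j'" "v' \<in> k" "g \<in> C1" using m by (rule Pc_morE)
  have "j' = i" "v' = v" "k = j" "w = v" "\<s> g = a" "b = i0 (x j' k v') \<cdot> \<t> g" using d c unfolding g(1) by auto
  with g show "m = ((i, j), (v, snd (snd m)))" "i \<in> \<U>" "j \<in> \<U>" "v \<in> i" "v \<in> j" "w = v" "snd (snd m) \<in> C1"
    "\<s> (snd (snd m)) = a" "\<t> (snd (snd m)) = x i j v \<cdot> b" by simp_all
qed

text \<open>The left factor is the identity of \<open>(i, (v, one0 G))\<close> acted on by
  \<open>h\<close>. Under \<open>\<Phi> i\<close> the twist of the composition in \<open>P_c\<close>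
  cancels. This computes the images of the morphisms through which a chart section describes a
  bundle.\<close>

lemma cmp_unit_act:
  assumes [simp]: "i \<in> \<U>" "k \<in> \<U>" "v \<in> i" "v \<in> k" "h \<in> C1" "g \<in> C1" and c: "\<t> h = \<s> g"
  shows "cmp Pc' ((i, i), (v, \<epsilon> i v \<odot> h)) ((i, k), (v, g)) = ((i, k), (v, h \<star> g))"
proof -
  note [simp] = \<epsilon>
  have "\<Phi> i ((i, i), (v, \<epsilon> i v \<odot> h)) = \<iota> (x i i v) \<odot> h"
    by (simp add: \<Phi>_def \<epsilon>_def)
  then have "\<Phi> i (cmp Pc' ((i, i), (v, \<epsilon> i v \<odot> h)) ((i, k), (v, g))) = (\<iota> (x i i v) \<odot> h) \<star> (e i i k v \<odot> \<iota> (x i i v) \<odot> g)"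
    by (subst \<Phi>_cmp) (simp_all add: c, simp add: \<Phi>_def)
  also have "\<dots> = \<Phi> i ((i, k), (v, h \<star> g))"
    by (simp add: \<Phi>_def star_eq c)
  finally show ?thesis
    using cmp_closed[of i i k v "\<epsilon> i v \<odot> h" g] by (simp add: \<Phi>_inject c)
qed

text \<open>Since \<open>F0 \<circ> q i\<close> stays in the summand \<open>r i\<close>, it is given
  by a function \<open>b i\<close> into objects of \<open>\<G>\<close>; likewise
  \<open>F1 (s i j v)\<close> is given by a morphism \<open>g i j v\<close> of \<open>\<G>\<close>.
  These are, up to inversion and translation, the cochains \<open>a\<close> and
  \<open>d\<close>.\<close>

lemma cohomologous_transition_data:
  fixes W :: "('w0, 'w1, 'a, 'b) two_space" and \<omega> :: "'w0 \<Rightarrow> 'x"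
  assumes W: "G_2space G W" and \<V>: "open_cover X \<V>" and F: "G_functor G W Pc' F0 F1" and over: "\<And>p. p \<in> topspace (ob_top W) \<Longrightarrow> Pc_proj (F0 p) = \<omega> p"
    and charts: "\<And>V. V \<in> \<V> \<Longrightarrow> chart_section G X W \<omega> V (q V)"
    and piece: "\<And>V v. V \<in> \<V> \<Longrightarrow> v \<in> V \<Longrightarrow> fst (F0 (q V v)) = r V" and r: "\<And>V. V \<in> \<V> \<Longrightarrow> r V \<in> \<U>"
    and td: "transition_data G X W \<V> q (y, f) s"
  shows "cohomologous G X \<V> (restrict_cochain r (x, e)) (y, f)"
proof -
  interpret W: g2space G W using W by unfold_locales
  note FD = G_functorD[OF F]
  have VX: "v \<in> topspace X" if "v \<in> i" "i \<in> \<V>" for v i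
    using charts[OF that(2)] that(1) by (auto simp: chart_section_def)
  have qc: "continuous_map (subtopology X i) (ob_top W) (q i)" if "i \<in> \<V>" for i
    using charts[OF that] by (simp add: chart_section_def)
  have q [simp]: "q i v \<in> topspace (ob_top W)" "\<omega> (q i v) = v" if "i \<in> \<V>" "v \<in> i" for i v
    using charts[OF that(1)] continuous_map_closed[OF qc[OF that(1)], of v] VX that
    by (auto simp: chart_section_def)
  have cY: "cech_cocycle G X \<V> (y, f)"
    and sc: "\<And>i j. i \<in> \<V> \<Longrightarrow> j \<in> \<V> \<Longrightarrow> continuous_map (subtopology X (i \<inter> j)) (mor_top W) (s i j)"
    and sd: "\<And>i j v. i \<in> \<V> \<Longrightarrow> j \<in> \<V> \<Longrightarrow> v \<in> i \<Longrightarrow> v \<in> j \<Longrightarrow> dom W (s i j v) = act0 W (q i v) (y i j v)"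
    and scod: "\<And>i j v. i \<in> \<V> \<Longrightarrow> j \<in> \<V> \<Longrightarrow> v \<in> i \<Longrightarrow> v \<in> j \<Longrightarrow> cod W (s i j v) = q j v"
    and s: "\<And>i j v. i \<in> \<V> \<Longrightarrow> j \<in> \<V> \<Longrightarrow> v \<in> i \<Longrightarrow> v \<in> j \<Longrightarrow> s i j v \<in> topspace (mor_top W)"
    and sR: "\<And>i j k v. i \<in> \<V> \<Longrightarrow> j \<in> \<V> \<Longrightarrow> k \<in> \<V> \<Longrightarrow> v \<in> i \<Longrightarrow> v \<in> j \<Longrightarrow> v \<in> k \<Longrightarrow>
       cmp W (act1 W (idm W (q i v)) (f i j k v \<odot> \<iota> (y i j v \<cdot> y j k v))) (s i k v) = cmp W (act1 W (s i j v) (\<iota> (y j k v))) (s j k v)"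
    using td by (auto simp: transition_data_def inverse_pair_def)
  interpret Y: cocycle G X \<V> y f using \<V> cY by unfold_locales
  define b where "b i v = snd (snd (F0 (q i v)))" for i v
  define g where "g i j v = snd (snd (F1 (s i j v)))" for i j v
  have F0q: "F0 (q i v) = (r i, (v, b i v))" and rv: "v \<in> r i" and b: "b i v \<in> C0" if "i \<in> \<V>" "v \<in> i" for i v
  proof -
    have "F0 (q i v) \<in> topspace (Pc_obtop G X \<U>)" using FD(9)[of "q i v"] that by simp
    then obtain j w a where "F0 (q i v) = (j, (w, a))" "w \<in> j" "a \<in> C0" by (rule Pc_obE)
    moreover have "Pc_proj (F0 (q i v)) = v" using over that by simp
    ultimately show "F0 (q i v) = (r i, (v, b i v))" "v \<in> r i" "b i v \<in> C0"
      using piece[OF that] by (simp_all add: b_def)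
  qed
  have bc: "continuous_map (subtopology X i) (G0 G) (b i)" if "i \<in> \<V>" for i
  proof -
    have "continuous_map (subtopology X i) (Pc_obtop G X \<U>) (\<lambda>v. F0 (q i v))"
      using continuous_map_compose_at[OF FD(1) qc[OF that]] by simp
    then have "continuous_map (subtopology X i) (prod_topology (subtopology X (r i)) (G0 G)) (\<lambda>v. snd (F0 (q i v)))"
      unfolding Pc_obtop_def by (rule continuous_map_sum_component) (use that piece r in auto)
    then show ?thesis unfolding b_def[abs_def] by (rule continuous_map_snd_at)
  qed
  have g: "F1 (s i j v) = ((r i, r j), (v, g i j v))" "g i j v \<in> C1" "\<s> (g i j v) = b i v \<cdot> y i j v"
      "\<t> (g i j v) = x (r i) (r j) v \<cdot> b j v"
    if ij: "i \<in> \<V>" "j \<in> \<V>" "v \<in> i" "v \<in> j" for i j v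
  proof -
    have "F1 (s i j v) \<in> topspace (Pc_mortop G X \<U>)" using FD(10)[of "s i j v"] s[OF ij] by simp
    moreover have "dom Pc' (F1 (s i j v)) = (r i, (v, b i v \<cdot> y i j v))"
      using FD(3)[OF s[OF ij]] FD(7)[of "q i v" "y i j v"] ij by (simp add: sd F0q)
    moreover have "cod Pc' (F1 (s i j v)) = (r j, (v, b j v))"
      using FD(4)[OF s[OF ij]] ij by (simp add: scod F0q)
    ultimately show "F1 (s i j v) = ((r i, r j), (v, g i j v))" "g i j v \<in> C1" "\<s> (g i j v) = b i v \<cdot> y i j v"
      "\<t> (g i j v) = x (r i) (r j) v \<cdot> b j v"
      unfolding g_def by (rule Pc_mor_eqI(1,7,8,9))+
  qed
  have gc: "continuous_map (subtopology X (i \<inter> j)) (G1 G) (g i j)" if ij: "i \<in> \<V>" "j \<in> \<V>" for i j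
  proof -
    have "continuous_map (subtopology X (i \<inter> j)) (Pc_mortop G X \<U>) (\<lambda>v. F1 (s i j v))"
      using continuous_map_compose_at[OF FD(2) sc[OF ij]] by simp
    then have "continuous_map (subtopology X (i \<inter> j))
        (case (r i, r j) of (i, j) \<Rightarrow> prod_topology (subtopology X (i \<inter> j)) (G1 G)) (\<lambda>v. snd (F1 (s i j v)))"
      unfolding Pc_mortop_def by (rule continuous_map_sum_component) (use ij r g(1) in auto)
    then show ?thesis unfolding g_def[abs_def] by (auto intro: continuous_map_snd_at)
  qed
  \<comment> \<open>The image under \<open>F1\<close> of the relation between \<open>s i k\<close>,
    \<open>s i j\<close> and \<open>s j k\<close> in \<open>W\<close>, with both sides evaluated in
    the summand indexed by \<open>r i\<close> and \<open>r k\<close>.\<close>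
  have key: "(\<iota> (b i v) \<odot> f i j k v \<odot> \<iota> (y i j v \<cdot> y j k v)) \<star> g i k v
      = e (r i) (r j) (r k) v \<odot> ((g i j v \<odot> \<iota> (y j k v)) \<star> (\<iota> (x (r i) (r j) v) \<odot> g j k v))"
    if ijk: "i \<in> \<V>" "j \<in> \<V>" "k \<in> \<V>" "v \<in> i" "v \<in> j" "v \<in> k" for i j k v
  proof -
    note [simp] = ijk q r rv b s sd scod g(2-4) \<epsilon>
    have ty: "y i k v = \<t> (f i j k v) \<cdot> y i j v \<cdot> y j k v"
      using Y.x_cocycle[OF ijk] by simp
    define h where "h = f i j k v \<odot> \<iota> (y i j v \<cdot> y j k v)"
    have h [simp]: "h \<in> C1" "\<s> h = y i j v \<cdot> y j k v" "\<t> h = y i k v" by (simp_all add: h_def ty)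
    have "F1 (act1 W (idm W (q i v)) h) = ((r i, r i), (v, \<epsilon> (r i) v \<odot> \<iota> (b i v) \<odot> h))"
      using FD(8)[of "idm W (q i v)" h] FD(5)[of "q i v"] by (simp add: F0q)
    then have "F1 (cmp W (act1 W (idm W (q i v)) h) (s i k v))
        = cmp Pc' ((r i, r i), (v, \<epsilon> (r i) v \<odot> (\<iota> (b i v) \<odot> h))) ((r i, r k), (v, g i k v))"
      using FD(6)[of "act1 W (idm W (q i v)) h" "s i k v"] g(1)[of i k v] by (simp del: Pc_simps(6))
    also have "\<dots> = ((r i, r k), (v, (\<iota> (b i v) \<odot> h) \<star> g i k v))"
      by (rule cmp_unit_act) simp_all
    finally have 1: "F1 (cmp W (act1 W (idm W (q i v)) h) (s i k v)) = ((r i, r k), (v, (\<iota> (b i v) \<odot> h) \<star> g i k v))" .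
    have "F1 (act1 W (s i j v) (\<iota> (y j k v))) = ((r i, r j), (v, g i j v \<odot> \<iota> (y j k v)))"
      using FD(8)[of "s i j v" "\<iota> (y j k v)"] g(1)[of i j v] by simp
    then have 2: "F1 (cmp W (act1 W (s i j v) (\<iota> (y j k v))) (s j k v))
        = ((r i, r k), (v, e (r i) (r j) (r k) v \<odot> ((g i j v \<odot> \<iota> (y j k v)) \<star> (\<iota> (x (r i) (r j) v) \<odot> g j k v))))"
      using FD(6)[of "act1 W (s i j v) (\<iota> (y j k v))" "s j k v"] g(1)[of j k v] by simp
    show ?thesis using 1 2 sR[OF ijk] unfolding h_def by simp
  qed
  \<comment> \<open>The choice of \<open>d\<close> is dictated by
    \<open>\<s> (g i j v) = b i v \<cdot> y i j v\<close>, which puts it into \<open>\<E>\<close>.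
    Then \<open>\<t> (g i j v) = x (r i) (r j) v \<cdot> b j v\<close> is exactly the formula for
    \<open>y\<close>.\<close>
  define a where "a i v = i0 (b i v)" for i v
  define d where "d i j v = \<iota> (b i v \<cdot> y i j v) \<odot> i1 (g i j v)" for i j v
  have 1: "y i j v = mult0 G (mult0 G (mult0 G (a i v) (\<t> (d i j v))) (x (r i) (r j) v)) (i0 (a j v))"
    if "i \<in> \<V>" "j \<in> \<V>" "v \<in> topspace X \<inter> i \<inter> j" for i j v
    using that by (simp add: a_def d_def g b r rv)
  have 2: "f i j k v = conjE G (a i v)
        (mult1 G (mult1 G (mult1 G (d i k v) (e (r i) (r j) (r k) v)) (conjE G (x (r i) (r j) v) (i1 (d j k v)))) (i1 (d i j v)))"
    if "i \<in> \<V>" "j \<in> \<V>" "k \<in> \<V>" "v \<in> topspace X \<inter> i \<inter> j \<inter> k" for i j k v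
  proof -
    have [simp]: "i \<in> \<V>" "j \<in> \<V>" "k \<in> \<V>" "v \<in> i" "v \<in> j" "v \<in> k" using that by auto
    note [simp] = g b r rv
    have ty: "y i k v = \<t> (f i j k v) \<cdot> y i j v \<cdot> y j k v"
      using Y.x_cocycle[of i j k v] by simp
    have "g i k v \<odot> i1 (\<iota> (b i v \<cdot> y i k v)) \<odot> \<iota> (b i v) \<odot> f i j k v \<odot> \<iota> (y i j v \<cdot> y j k v)
        = e (r i) (r j) (r k) v \<odot> (\<iota> (x (r i) (r j) v) \<odot> g j k v) \<odot> i1 (\<iota> (x (r i) (r j) v \<cdot> b j v \<cdot> y j k v)) \<odot> g i j v \<odot> \<iota> (y j k v)"
      using key[of i j k v] by (simp add: star_eq ty)
    \<comment> \<open>The left multiplier is \<open>\<iota> (a i v) \<odot> d i k v\<close>;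
      together with the right one it isolates \<open>f i j k v\<close>.\<close>
    from arg_cong[OF this, of "\<lambda>w. i1 (\<iota> (b i v)) \<odot> \<iota> (b i v \<cdot> y i k v) \<odot> i1 (g i k v) \<odot> w \<odot> i1 (\<iota> (y i j v \<cdot> y j k v))"]
    show ?thesis by (simp add: conjE_def a_def d_def)
  qed
  have 3: "continuous_map (subtopology X i) (G0 G) (a i)" if "i \<in> \<V>" for i
    unfolding a_def by (intro continuous_rules bc that)
  have 4: "continuous_map (subtopology X (i \<inter> j)) (E_top G) (d i j)" if ij: "i \<in> \<V>" "j \<in> \<V>" for i j
  proof -
    have "continuous_map (subtopology X (i \<inter> j)) (G0 G) (b i)"
      using bc[OF ij(1)] by (rule continuous_map_from_subtopology_mono) auto
    then have "continuous_map (subtopology X (i \<inter> j)) (G1 G) (d i j)"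
      unfolding d_def using gc[OF ij] Y.continuous_x[OF ij] by (intro continuous_rules)
    then show ?thesis using ij by (simp add: continuous_E_top d_def g b)
  qed
  show ?thesis
    unfolding cohomologous_def restrict_cochain_def prod.case
    by (intro exI[of _ a] exI[of _ d] conjI ballI) (rule 1 2 3 4; assumption)+
qed

end

section \<open>Restriction and comparison of cocycles\<close>

lemma (in two_grp) cech_cocycle_restrict:
  assumes c: "cech_cocycle G X \<U> c" and r: "refinement_map \<V> \<U> r"
  shows "cech_cocycle G X \<V> (restrict_cochain r c)"
proof -
  obtain x e where [simp]: "c = (x, e)" by (cases c)
  have rU: "r i \<in> \<U>" "i \<subseteq> r i" if "i \<in> \<V>" for i using r that by (auto simp: refinement_map_def)
  have xc: "continuous_map (subtopology X (i \<inter> j)) (G0 G) (x (r i) (r j))" if "i \<in> \<V>" "j \<in> \<V>" for i j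
    by (rule continuous_map_from_subtopology_mono[where T = "r i \<inter> r j"])
      (use c rU[OF that(1)] rU[OF that(2)] in \<open>auto simp: cech_cocycle_def\<close>)
  have ec: "continuous_map (subtopology X (i \<inter> j \<inter> k)) (E_top G) (e (r i) (r j) (r k))"
    if "i \<in> \<V>" "j \<in> \<V>" "k \<in> \<V>" for i j k
    by (rule continuous_map_from_subtopology_mono[where T = "r i \<inter> r j \<inter> r k"])
      (use c rU[OF that(1)] rU[OF that(2)] rU[OF that(3)] in \<open>auto simp: cech_cocycle_def\<close>)
  have 1: "mult0 G (mult0 G (\<t> (e i j k v)) (x i j v)) (x j k v) = x i k v"
    if "i \<in> \<U>" "j \<in> \<U>" "k \<in> \<U>" "v \<in> topspace X" "v \<in> i" "v \<in> j" "v \<in> k" for i j k v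
    using c that by (auto simp: cech_cocycle_def)
  have 2: "e i k l v \<odot> e i j k v = e i j l v \<odot> conjE G (x i j v) (e j k l v)"
    if "i \<in> \<U>" "j \<in> \<U>" "k \<in> \<U>" "l \<in> \<U>" "v \<in> topspace X" "v \<in> i" "v \<in> j" "v \<in> k" "v \<in> l" for i j k l v
    using c that by (auto simp: cech_cocycle_def)
  show ?thesis
    unfolding cech_cocycle_def restrict_cochain_def \<open>c = (x, e)\<close> prod.case
    by (intro conjI ballI xc ec; (intro 1 2)?) (use rU in auto)
qed

lemma cohomologousE:
  assumes "cohomologous G X \<V> (x, e) (y, f)"
  obtains a d where "\<And>i. i \<in> \<V> \<Longrightarrow> continuous_map (subtopology X i) (G0 G) (a i)"
    and "\<And>i j. i \<in> \<V> \<Longrightarrow> j \<in> \<V> \<Longrightarrow> continuous_map (subtopology X (i \<inter> j)) (E_top G) (d i j)"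
    and "\<And>i j v. i \<in> \<V> \<Longrightarrow> j \<in> \<V> \<Longrightarrow> v \<in> topspace X \<inter> i \<inter> j \<Longrightarrow>
        y i j v = mult0 G (mult0 G (mult0 G (a i v) (tgt G (d i j v))) (x i j v)) (inv0 G (a j v))"
    and "\<And>i j k v. i \<in> \<V> \<Longrightarrow> j \<in> \<V> \<Longrightarrow> k \<in> \<V> \<Longrightarrow> v \<in> topspace X \<inter> i \<inter> j \<inter> k \<Longrightarrow>
        f i j k v = conjE G (a i v)
          (mult1 G (mult1 G (mult1 G (d i k v) (e i j k v)) (conjE G (x i j v) (inv1 G (d j k v)))) (inv1 G (d i j v)))"
proof -
  from assms show thesis
    unfolding cohomologous_def prod.case
  proof (elim exE conjE, goal_cases)
    case (1 a d)
    then show thesis by (intro that[of a d]) simp_all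
  qed
qed

text \<open>If \<open>(a, d)\<close> and \<open>(a', d')\<close> witness the two hypotheses, then \<open>A = a'\<^sup>-\<^sup>1a\<close> and
  \<open>D = \<^bsup>A\<^sup>-\<^sup>1\<^esup>(d'\<^sup>-\<^sup>1) d\<close> witness the conclusion.\<close>
lemma (in two_grp) cohomologous_euclidean:
  assumes \<V>: "open_cover X \<V>" and c: "cech_cocycle G X \<V> c" and c': "cech_cocycle G X \<V> c'"
    and "cohomologous G X \<V> c b" "cohomologous G X \<V> c' b"
  shows "cohomologous G X \<V> c c'"
proof -
  obtain x e where xe: "c = (x, e)" by (cases c)
  obtain x' e' where xe': "c' = (x', e')" by (cases c')
  obtain y f where yf: "b = (y, f)" by (cases b)
  interpret C: cocycle G X \<V> x e using \<V> c xe by unfold_locales simp_all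
  interpret C': cocycle G X \<V> x' e' using \<V> c' xe' by unfold_locales simp_all
  obtain a d where ac: "\<And>i. i \<in> \<V> \<Longrightarrow> continuous_map (subtopology X i) (G0 G) (a i)"
    and dc: "\<And>i j. i \<in> \<V> \<Longrightarrow> j \<in> \<V> \<Longrightarrow> continuous_map (subtopology X (i \<inter> j)) (E_top G) (d i j)"
    and y: "\<And>i j v. i \<in> \<V> \<Longrightarrow> j \<in> \<V> \<Longrightarrow> v \<in> topspace X \<inter> i \<inter> j \<Longrightarrow>
        y i j v = mult0 G (mult0 G (mult0 G (a i v) (\<t> (d i j v))) (x i j v)) (i0 (a j v))"
    and f: "\<And>i j k v. i \<in> \<V> \<Longrightarrow> j \<in> \<V> \<Longrightarrow> k \<in> \<V> \<Longrightarrow> v \<in> topspace X \<inter> i \<inter> j \<inter> k \<Longrightarrow>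
        f i j k v = conjE G (a i v) (mult1 G (mult1 G (mult1 G (d i k v) (e i j k v)) (conjE G (x i j v) (i1 (d j k v)))) (i1 (d i j v)))"
    by (fact cohomologousE[OF assms(4)[unfolded xe yf]])
  obtain a' d' where ac': "\<And>i. i \<in> \<V> \<Longrightarrow> continuous_map (subtopology X i) (G0 G) (a' i)"
    and dc': "\<And>i j. i \<in> \<V> \<Longrightarrow> j \<in> \<V> \<Longrightarrow> continuous_map (subtopology X (i \<inter> j)) (E_top G) (d' i j)"
    and y': "\<And>i j v. i \<in> \<V> \<Longrightarrow> j \<in> \<V> \<Longrightarrow> v \<in> topspace X \<inter> i \<inter> j \<Longrightarrow>
        y i j v = mult0 G (mult0 G (mult0 G (a' i v) (\<t> (d' i j v))) (x' i j v)) (i0 (a' j v))"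
    and f': "\<And>i j k v. i \<in> \<V> \<Longrightarrow> j \<in> \<V> \<Longrightarrow> k \<in> \<V> \<Longrightarrow> v \<in> topspace X \<inter> i \<inter> j \<inter> k \<Longrightarrow>
        f i j k v = conjE G (a' i v) (mult1 G (mult1 G (mult1 G (d' i k v) (e' i j k v)) (conjE G (x' i j v) (i1 (d' j k v)))) (i1 (d' i j v)))"
    by (fact cohomologousE[OF assms(5)[unfolded xe' yf]])
  have a: "a i v \<in> C0" "a' i v \<in> C0" if "i \<in> \<V>" "v \<in> i" for i v
    using continuous_map_closed[OF ac[OF that(1)], of v] continuous_map_closed[OF ac'[OF that(1)], of v] C.in_X that by auto
  have d: "d i j v \<in> C1" "\<s> (d i j v) = one0 G" "d' i j v \<in> C1" "\<s> (d' i j v) = one0 G"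
    if ij: "i \<in> \<V>" "j \<in> \<V>" "v \<in> i" "v \<in> j" for i j v
    using continuous_map_closed[OF dc[OF ij(1,2)], of v] continuous_map_closed[OF dc'[OF ij(1,2)], of v] C.in_X[OF ij(1,3)] ij
    by (auto simp: E_top_def)
  define A where "A i v = i0 (a' i v) \<cdot> a i v" for i v
  define D where "D i j v = i1 (\<iota> (A i v)) \<odot> i1 (d' i j v) \<odot> \<iota> (A i v) \<odot> d i j v" for i j v
  have x'_eq: "x' i j v = i0 (\<t> (d' i j v)) \<cdot> A i v \<cdot> \<t> (d i j v) \<cdot> x i j v \<cdot> i0 (A j v)"
    if ij [simp]: "i \<in> \<V>" "j \<in> \<V>" "v \<in> i" "v \<in> j" for i j v
  proof -
    note [simp] = a d
    have "a' i v \<cdot> \<t> (d' i j v) \<cdot> x' i j v \<cdot> i0 (a' j v) = a i v \<cdot> \<t> (d i j v) \<cdot> x i j v \<cdot> i0 (a j v)"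
      using y[of i j v] y'[of i j v] C.in_X[of i v] by simp
    from arg_cong[OF this, of "\<lambda>w. i0 (\<t> (d' i j v)) \<cdot> i0 (a' i v) \<cdot> w \<cdot> a' j v"] show ?thesis
      by (simp add: A_def)
  qed
  have 1: "x' i j v = mult0 G (mult0 G (mult0 G (A i v) (\<t> (D i j v))) (x i j v)) (i0 (A j v))"
    if "i \<in> \<V>" "j \<in> \<V>" "v \<in> topspace X \<inter> i \<inter> j" for i j v
    using that x'_eq[of i j v] by (simp add: D_def a d A_def)
  have 2: "e' i j k v = conjE G (A i v)
        (mult1 G (mult1 G (mult1 G (D i k v) (e i j k v)) (conjE G (x i j v) (i1 (D j k v)))) (i1 (D i j v)))"
    if "i \<in> \<V>" "j \<in> \<V>" "k \<in> \<V>" "v \<in> topspace X \<inter> i \<inter> j \<inter> k" for i j k v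
  proof -
    have ijk [simp]: "i \<in> \<V>" "j \<in> \<V>" "k \<in> \<V>" "v \<in> i" "v \<in> j" "v \<in> k" using that by auto
    note [simp] = a d
    have A: "A i v \<in> C0" "A j v \<in> C0" by (simp_all add: A_def)
    note [simp] = A
    have "\<iota> (a' i v) \<odot> d' i k v \<odot> e' i j k v \<odot> \<iota> (x' i j v) \<odot> i1 (d' j k v) \<odot> i1 (\<iota> (x' i j v)) \<odot> i1 (d' i j v) \<odot> i1 (\<iota> (a' i v))
       = \<iota> (a i v) \<odot> d i k v \<odot> e i j k v \<odot> \<iota> (x i j v) \<odot> i1 (d j k v) \<odot> i1 (\<iota> (x i j v)) \<odot> i1 (d i j v) \<odot> i1 (\<iota> (a i v))"
      using f[OF ijk(1-3) that(4)] f'[OF ijk(1-3) that(4)] by (simp add: conjE_def)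
    from arg_cong[OF this, of "\<lambda>w. i1 (d' i k v) \<odot> i1 (\<iota> (a' i v)) \<odot> w \<odot> \<iota> (a' i v) \<odot> d' i j v"]
    have e': "e' i j k v \<odot> (\<iota> (x' i j v) \<odot> i1 (d' j k v) \<odot> i1 (\<iota> (x' i j v)))
       = i1 (d' i k v) \<odot> \<iota> (A i v) \<odot> d i k v \<odot> e i j k v \<odot> \<iota> (x i j v) \<odot> i1 (d j k v) \<odot> i1 (\<iota> (x i j v)) \<odot> i1 (d i j v) \<odot>
          i1 (\<iota> (A i v)) \<odot> d' i j v"
      by (simp add: A_def)
    \<comment> \<open>By \<open>x'_eq\<close>, \<open>x' i j v\<close> is \<open>\<t> u\<close>
      times \<open>A i v \<cdot> x i j v \<cdot> i0 (A j v)\<close>. So conjugating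
      \<open>i1 (d' j k v)\<close> by it is conjugating \<open>w\<close> by \<open>\<t> u\<close>,
      which \<open>peiffer\<close> replaces by conjugation with \<open>u\<close>. Now only words in
      \<open>A\<close>, \<open>x\<close>, \<open>d\<close>, \<open>d'\<close> and \<open>e\<close>
      remain.\<close>
    define u where "u = i1 (d' i j v) \<odot> \<iota> (A i v) \<odot> d i j v \<odot> i1 (\<iota> (A i v))"
    define w where "w = \<iota> (A i v) \<odot> \<iota> (x i j v) \<odot> i1 (\<iota> (A j v)) \<odot> i1 (d' j k v) \<odot> \<iota> (A j v) \<odot> i1 (\<iota> (x i j v)) \<odot> i1 (\<iota> (A i v))"
    have u: "u \<in> C1" "\<s> u = one0 G" "\<t> u = i0 (\<t> (d' i j v)) \<cdot> A i v \<cdot> \<t> (d i j v) \<cdot> i0 (A i v)"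
      and w: "w \<in> C1" "\<s> w = one0 G" by (simp_all add: u_def w_def)
    have "\<iota> (x' i j v) \<odot> i1 (d' j k v) \<odot> i1 (\<iota> (x' i j v)) = (\<iota> (\<t> u) \<odot> w) \<odot> i1 (\<iota> (\<t> u))"
      by (simp add: x'_eq u(3) w_def)
    also have "\<dots> = u \<odot> w \<odot> i1 u"
      by (subst peiffer) (simp_all add: u w)
    finally have e'': "e' i j k v \<odot> (u \<odot> w \<odot> i1 u)
       = i1 (d' i k v) \<odot> \<iota> (A i v) \<odot> d i k v \<odot> e i j k v \<odot> \<iota> (x i j v) \<odot> i1 (d j k v) \<odot> i1 (\<iota> (x i j v)) \<odot> i1 (d i j v) \<odot>
          i1 (\<iota> (A i v)) \<odot> d' i j v"
      using e' by simp
    have "e' i j k v = (e' i j k v \<odot> (u \<odot> w \<odot> i1 u)) \<odot> u \<odot> i1 w \<odot> i1 u"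
      by (simp add: u(1) w(1))
    also have "\<dots> = conjE G (A i v)
        (mult1 G (mult1 G (mult1 G (D i k v) (e i j k v)) (conjE G (x i j v) (i1 (D j k v)))) (i1 (D i j v)))"
      unfolding e'' by (simp add: conjE_def D_def u_def w_def)
    finally show ?thesis .
  qed
  have 3: "continuous_map (subtopology X i) (G0 G) (A i)" if "i \<in> \<V>" for i
    unfolding A_def by (intro continuous_rules ac ac' that)
  have 4: "continuous_map (subtopology X (i \<inter> j)) (E_top G) (D i j)" if ij: "i \<in> \<V>" "j \<in> \<V>" for i j
  proof -
    have "continuous_map (subtopology X (i \<inter> j)) (G0 G) (A i)"
      using 3[OF ij(1)] by (rule continuous_map_from_subtopology_mono) auto
    then have "continuous_map (subtopology X (i \<inter> j)) (G1 G) (D i j)"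
      unfolding D_def using dc[OF ij] dc'[OF ij] by (intro continuous_rules) (auto simp: continuous_E_top)
    then show ?thesis using ij by (simp add: continuous_E_top D_def A_def a d)
  qed
  show ?thesis
    unfolding cohomologous_def xe xe' prod.case
    by (intro exI[of _ A] exI[of _ D] conjI ballI) (rule 1 2 3 4; assumption)+
qed

text \<open>One cover and one choice of sections of \<open>W\<close> must serve both morphisms. The
  cocycle of \<open>W\<close> on that cover is then the common third term to which
  \<open>cohomologous_euclidean\<close> applies.\<close>

lemma bundle_equiv_imp_colim_eq:
  fixes G :: "('a, 'b) two_group" and X :: "'x topology" and W :: "('w0, 'w1, 'a, 'b) two_space" and \<omega> :: "'w0 \<Rightarrow> 'x"
  assumes G: "top_2group G" and \<U>: "open_cover X \<U>" "cech_cocycle G X \<U> c" and \<U>': "open_cover X \<U>'" "cech_cocycle G X \<U>' c'"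
    and eq: "bundle_equiv_via G X W \<omega> (Pc G X \<U> c) Pc_proj (Pc G X \<U>' c') Pc_proj"
  shows "cech_colim_eq G X \<U> c \<U>' c'"
proof -
  obtain x e where xe: "c = (x, e)" by (cases c)
  obtain x' e' where xe': "c' = (x', e')" by (cases c')
  interpret two_grp G using G by unfold_locales
  interpret C: cocycle G X \<U> x e using \<U> xe by unfold_locales simp_all
  interpret C': cocycle G X \<U>' x' e' using \<U>' xe' by unfold_locales simp_all
  have W: "principal_bundle G X W \<omega>" using eq by (simp add: bundle_equiv_via_def)
  interpret W: g2space G W using W by unfold_locales (simp add: principal_bundle_def)
  obtain F0 F1 where F: "G_functor G W C.Pc' F0 F1" "\<And>p. p \<in> topspace (ob_top W) \<Longrightarrow> Pc_proj (F0 p) = \<omega> p"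
    using eq unfolding bundle_equiv_via_def bundle_morphism_def xe by blast
  obtain F0' F1' where F': "G_functor G W C'.Pc' F0' F1'" "\<And>p. p \<in> topspace (ob_top W) \<Longrightarrow> Pc_proj (F0' p) = \<omega> p"
    using eq unfolding bundle_equiv_via_def bundle_morphism_def xe' by blast
  \<comment> \<open>Membership of \<open>V\<close> only asserts that a section and two indices
    exist. They are chosen afterwards for each \<open>V\<close>, and the chosen indices become the
    refinement maps.\<close>
  define \<V> where "\<V> = {V. openin X V \<and> (\<exists>q i i'. chart_section G X W \<omega> V q \<and> i \<in> \<U> \<and> i' \<in> \<U>' \<and>
      (\<forall>v\<in>V. fst (F0 (q v)) = i \<and> fst (F0' (q v)) = i'))}"
  have "\<exists>V\<in>\<V>. u \<in> V" if u: "u \<in> topspace X" for u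
  proof -
    obtain U q where U: "openin X U" "u \<in> U" and q: "chart_section G X W \<omega> U q"
      using principal_bundle_chart_section[OF G W u] by blast
    have UX: "topspace X \<inter> U = U" using openin_subset[OF U(1)] by auto
    have qc: "continuous_map (subtopology X U) (ob_top W) q" using q by (simp add: chart_section_def)
    have k: "continuous_map (subtopology X U) (Pc_obtop G X \<U>) (\<lambda>v. F0 (q v))"
      and k': "continuous_map (subtopology X U) (Pc_obtop G X \<U>') (\<lambda>v. F0' (q v))"
      using continuous_map_compose_at[OF G_functorD(1)[OF F(1)] qc] continuous_map_compose_at[OF G_functorD(1)[OF F'(1)] qc] by simp_all
    \<comment> \<open>The summand that contains the image of \<open>q v\<close> is locally constant
      in \<open>v\<close>, under \<open>F0\<close> as well as under \<open>F0'\<close>. So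
      \<open>V\<close> is an open neighbourhood of \<open>u\<close> inside the domain of the
      chart.\<close>
    define V where "V = {v \<in> U. fst (F0 (q v)) = fst (F0 (q u))} \<inter> {v \<in> U. fst (F0' (q v)) = fst (F0' (q u))}"
    have "openin (subtopology X U) V"
      unfolding V_def
      using openin_sum_component[OF k[unfolded Pc_obtop_def], of "fst (F0 (q u))"]
        openin_sum_component[OF k'[unfolded Pc_obtop_def], of "fst (F0' (q u))"]
      by (simp add: UX openin_Int)
    then have "openin X V" using U(1) by (rule openin_trans_full)
    moreover have "chart_section G X W \<omega> V q" using q by (rule chart_section_mono) (auto simp: V_def)
    moreover have "fst (F0 (q u)) \<in> \<U>" "fst (F0' (q u)) \<in> \<U>'"
      using continuous_map_closed[OF k, of u] continuous_map_closed[OF k', of u] U u by (auto elim!: C.Pc_obE C'.Pc_obE)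
    moreover have "\<forall>v\<in>V. fst (F0 (q v)) = fst (F0 (q u)) \<and> fst (F0' (q v)) = fst (F0' (q u))" by (simp add: V_def)
    ultimately have "V \<in> \<V>"
      unfolding \<V>_def mem_Collect_eq
      by (intro conjI exI[of _ q] exI[of _ "fst (F0 (q u))"] exI[of _ "fst (F0' (q u))"])
    moreover have "u \<in> V" using U by (simp add: V_def)
    ultimately show ?thesis by blast
  qed
  moreover have "openin X V" if "V \<in> \<V>" for V using that by (simp add: \<V>_def)
  ultimately have \<V>: "open_cover X \<V>"
    unfolding open_cover_def by (meson UnionE UnionI openin_subset subsetD subsetI subset_antisym)
  define Q where "Q V q i i' \<longleftrightarrow> chart_section G X W \<omega> V q \<and> i \<in> \<U> \<and> i' \<in> \<U>' \<and>
      (\<forall>v\<in>V. fst (F0 (q v)) = i \<and> fst (F0' (q v)) = i')" for V q i i'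
  have "\<forall>V\<in>\<V>. \<exists>q i i'. Q V q i i'"
    by (simp add: \<V>_def Q_def)
  then obtain q r r' where qr: "\<And>V. V \<in> \<V> \<Longrightarrow> Q V (q V) (r V) (r' V)"
    by metis
  then have q: "\<And>V. V \<in> \<V> \<Longrightarrow> chart_section G X W \<omega> V (q V)"
    and r: "\<And>V. V \<in> \<V> \<Longrightarrow> r V \<in> \<U>" "\<And>V v. V \<in> \<V> \<Longrightarrow> v \<in> V \<Longrightarrow> fst (F0 (q V v)) = r V"
    and r': "\<And>V. V \<in> \<V> \<Longrightarrow> r' V \<in> \<U>'" "\<And>V v. V \<in> \<V> \<Longrightarrow> v \<in> V \<Longrightarrow> fst (F0' (q V v)) = r' V"
    by (simp_all add: Q_def)
  have qW: "q V v \<in> topspace (ob_top W)" "\<omega> (q V v) = v" if V: "V \<in> \<V>" "v \<in> V" for V v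
  proof -
    have "continuous_map (subtopology X V) (ob_top W) (q V)" "V \<subseteq> topspace X" "\<omega> (q V v) = v"
      using q[OF V(1)] V(2) by (simp_all add: chart_section_def)
    then show "q V v \<in> topspace (ob_top W)" "\<omega> (q V v) = v"
      using continuous_map_closed[of "subtopology X V" "ob_top W" "q V" v] V(2) by auto
  qed
  \<comment> \<open>\<open>F0 (q V v)\<close> lies over \<open>v\<close>, and the points of the
    summand \<open>r V\<close> lie over \<open>r V\<close>.\<close>
  have "refinement_map \<V> \<U> r"
    unfolding refinement_map_def
  proof (intro ballI conjI subsetI)
    fix V v assume V: "V \<in> \<V>" "v \<in> V"
    have "F0 (q V v) \<in> topspace (Pc_obtop G X \<U>)" using G_functorD(9)[OF F(1) qW(1)[OF V]] by simp
    then show "v \<in> r V" using F(2)[OF qW(1)[OF V]] r(2)[OF V] qW(2)[OF V] by (elim C.Pc_obE) simp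
  qed (rule r)
  moreover have "refinement_map \<V> \<U>' r'"
    unfolding refinement_map_def
  proof (intro ballI conjI subsetI)
    fix V v assume V: "V \<in> \<V>" "v \<in> V"
    have "F0' (q V v) \<in> topspace (Pc_obtop G X \<U>')" using G_functorD(9)[OF F'(1) qW(1)[OF V]] by simp
    then show "v \<in> r' V" using F'(2)[OF qW(1)[OF V]] r'(2)[OF V] qW(2)[OF V] by (elim C'.Pc_obE) simp
  qed (rule r')
  moreover obtain b s where "transition_data G X W \<V> q b s"
    using W.transition_data_exists[OF q] by blast
  then obtain y f where td: "transition_data G X W \<V> q (y, f) s" by (cases b) auto
  have "cohomologous G X \<V> (restrict_cochain r c) (y, f)"
    unfolding xe by (rule C.cohomologous_transition_data[OF W.G_2space \<V> F q r(2,1) td])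
  moreover have "cohomologous G X \<V> (restrict_cochain r' c') (y, f)"
    unfolding xe' by (rule C'.cohomologous_transition_data[OF W.G_2space \<V> F' q r'(2,1) td])
  ultimately show ?thesis
    using cohomologous_euclidean[OF \<V>] cech_cocycle_restrict \<U>(2) \<U>'(2) \<V> unfolding cech_colim_eq_def by blast
qed

section \<open>Bundle morphisms from cocycles\<close>

context cocycle
begin

text \<open>The functor sends \<open>(v, 1)\<^sub>i\<^sub>j\<close> to the comparison \<open>s\<^sub>i\<^sub>j\<close>. It preserves identities because it sends them
  to invertible idempotents.\<close>
lemma transition_functor:
  fixes P :: "('p0, 'p1, 'a, 'b) two_space" and \<pi> :: "'p0 \<Rightarrow> 'x"
  assumes P: "G_2space G P" and charts: "\<And>i. i \<in> \<U> \<Longrightarrow> chart_section G X P \<pi> i (q i)"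
    and over: "\<And>p y. p \<in> topspace (ob_top P) \<Longrightarrow> y \<in> C0 \<Longrightarrow> \<pi> (act0 P p y) = \<pi> p"
    and td: "transition_data G X P \<U> q (x, e) s"
  shows "bundle_morphism G Pc' Pc_proj P \<pi>"
proof -
  interpret P: g2space G P using P by unfold_locales
  have qc: "continuous_map (subtopology X i) (ob_top P) (q i)" if "i \<in> \<U>" for i
    using charts[OF that] by (simp add: chart_section_def)
  have q [simp]: "q i v \<in> P.P0" "\<pi> (q i v) = v" if "i \<in> \<U>" "v \<in> i" for i v
    using charts[OF that(1)] continuous_map_closed[OF qc[OF that(1)], of v] in_X that
    by (auto simp: chart_section_def)
  have qc': "continuous_map Z (ob_top P) (\<lambda>z. q i (v z))" if "i \<in> \<U>" "continuous_map Z X v" "\<And>z. z \<in> topspace Z \<Longrightarrow> v z \<in> i"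
    for i v and Z :: "'z topology"
    by (rule continuous_map_compose_at[OF qc[OF that(1)]]) (use that in \<open>auto simp: continuous_map_in_subtopology\<close>)
  have sc: "continuous_map (subtopology X (i \<inter> j)) (mor_top P) (s i j)" if "i \<in> \<U>" "j \<in> \<U>" for i j
    using td that by (simp add: transition_data_def)
  have sc': "continuous_map Z (mor_top P) (\<lambda>z. s i j (v z))"
    if "i \<in> \<U>" "j \<in> \<U>" "continuous_map Z X v" "\<And>z. z \<in> topspace Z \<Longrightarrow> v z \<in> i \<and> v z \<in> j"
    for i j v and Z :: "'z topology"
    by (rule continuous_map_compose_at[OF sc[OF that(1,2)]]) (use that in \<open>auto simp: continuous_map_in_subtopology\<close>)
  have sinv: "\<exists>s'. inverse_pair P (s i j v) s'" if "i \<in> \<U>" "j \<in> \<U>" "v \<in> i" "v \<in> j" for i j v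
    using td that by (simp add: transition_data_def)
  have s [simp]: "s i j v \<in> P.P1" "P.\<d> (s i j v) = P.oact (q i v) (x i j v)" "P.\<c> (s i j v) = q j v"
    if "i \<in> \<U>" "j \<in> \<U>" "v \<in> i" "v \<in> j" for i j v
    using td that sinv[OF that] by (auto simp: transition_data_def inverse_pair_def)
  have sR: "cmp P (P.mact (idm P (q i v)) (e i j k v \<odot> \<iota> (x i j v \<cdot> x j k v))) (s i k v) = cmp P (P.mact (s i j v) (\<iota> (x j k v))) (s j k v)"
    if "i \<in> \<U>" "j \<in> \<U>" "k \<in> \<U>" "v \<in> i" "v \<in> j" "v \<in> k" for i j k v
    using td that by (simp add: transition_data_def)
  define F0 where "F0 = (\<lambda>(i, (u, a)). act0 P (q i u) a)"
  \<comment> \<open>This sends the arrow with component \<open>\<iota> (x i j v)\<close> to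
    \<open>s i j v\<close>. For general \<open>g\<close> it is \<open>s i j v\<close> acted on by
    \<open>\<iota> (i0 (x i j v)) \<odot> g\<close>, written by \<open>act_split\<close> as a
    composition so that \<open>g\<close> acts on an identity over \<open>q i v\<close>.\<close>
  define F1 where "F1 = (\<lambda>((i, j), (v, g)). cmp P (act1 P (idm P (q i v)) g) (act1 P (s i j v) (\<iota> (i0 (x i j v) \<cdot> \<t> g))))"
  have F0 [simp]: "F0 (i, (u, a)) = act0 P (q i u) a" for i u a by (simp add: F0_def)
  have F1: "F1 ((i, j), (v, g)) = cmp P (act1 P (idm P (q i v)) g) (act1 P (s i j v) (\<iota> (i0 (x i j v) \<cdot> \<t> g)))" for i j v g
    by (simp add: F1_def)
  have F1_cl: "F1 ((i, j), (v, g)) \<in> P.P1" "P.\<d> (F1 ((i, j), (v, g))) = act0 P (q i v) (\<s> g)"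
    "P.\<c> (F1 ((i, j), (v, g))) = act0 P (q j v) (i0 (x i j v) \<cdot> \<t> g)" "\<exists>f'. inverse_pair P (F1 ((i, j), (v, g))) f'"
    if ij [simp]: "i \<in> \<U>" "j \<in> \<U>" "v \<in> i" "v \<in> j" "g \<in> C1" for i j v g
  proof -
    show "F1 ((i, j), (v, g)) \<in> P.P1" "P.\<d> (F1 ((i, j), (v, g))) = act0 P (q i v) (\<s> g)"
      "P.\<c> (F1 ((i, j), (v, g))) = act0 P (q j v) (i0 (x i j v) \<cdot> \<t> g)" by (simp_all add: F1)
    obtain s' where s': "inverse_pair P (s i j v) s'" using sinv[OF ij(1-4)] by blast
    show "\<exists>f'. inverse_pair P (F1 ((i, j), (v, g))) f'"
      unfolding F1
      by (rule exI, rule P.inverse_pair_cmp[OF P.inverse_pair_act[OF P.inverse_pair_idm] P.inverse_pair_act[OF s']]) simp_all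
  qed
  have F1_cmp: "F1 (cmp Pc' ((i, j), (v, g)) ((j, k), (v, h))) = cmp P (F1 ((i, j), (v, g))) (F1 ((j, k), (v, h)))"
    if [simp]: "i \<in> \<U>" "j \<in> \<U>" "k \<in> \<U>" "v \<in> i" "v \<in> j" "v \<in> k" "g \<in> C1" "h \<in> C1" and c: "i0 (x i j v) \<cdot> \<t> g = \<s> h"
    for i j k v g h
  proof -
    have tg [simp]: "\<t> g = x i j v \<cdot> \<s> h" by (simp flip: c)
    define b where "b = i0 (x j k v) \<cdot> \<t> h"
    have b [simp]: "b \<in> C0" "\<t> h = x j k v \<cdot> b" by (simp_all add: b_def)
    define w where "w = g \<star> (\<iota> (x i j v) \<odot> h)"
    have w [simp]: "w \<in> C1" "\<s> w = \<s> g" "\<t> w = x i j v \<cdot> x j k v \<cdot> b" by (simp_all add: w_def)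
    \<comment> \<open>Composing \<open>w\<close> with \<open>e i j k v\<close> translated to start
      at the target of \<open>w\<close> is left multiplication by \<open>e i j k v\<close>, the
      twist in the composition of \<open>P_c\<close>.\<close>
    have ew: "w \<star> (e i j k v \<odot> \<iota> (x i j v \<cdot> x j k v \<cdot> b)) = e i j k v \<odot> w"
      by (simp add: star_eq)
    have tew: "i0 (x i k v) \<cdot> \<t> (e i j k v \<odot> w) = b"
      by (simp add: tgt_e)
    have "cmp P (F1 ((i, j), (v, g))) (F1 ((j, k), (v, h)))
        = cmp P (act1 P (idm P (q i v)) g) (cmp P (cmp P (act1 P (s i j v) (\<iota> (\<s> h))) (act1 P (idm P (P.\<c> (s i j v))) h)) (act1 P (s j k v) (\<iota> b)))"
      unfolding F1 by (simp add: P.cmp_assoc)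
    \<comment> \<open>\<open>h\<close> acts over \<open>q j v\<close> and separates the two
      comparisons. Sliding it in front of \<open>s i j v\<close> lets it merge with \<open>g\<close>
      into \<open>w\<close> and leaves the comparisons adjacent, ready for
      \<open>sR\<close>.\<close>
    also have "\<dots> = cmp P (act1 P (idm P (q i v)) g) (cmp P (cmp P (act1 P (idm P (P.\<d> (s i j v))) h) (act1 P (s i j v) (\<iota> (\<t> h)))) (act1 P (s j k v) (\<iota> b)))"
      using P.act_split[of "s i j v" h] by (simp only: s that)
    also have "\<dots> = cmp P (act1 P (idm P (q i v)) w) (act1 P (cmp P (act1 P (s i j v) (\<iota> (x j k v))) (s j k v)) (\<iota> b))"
      unfolding w_def by (simp add: P.cmp_assoc P.idm_oact P.idm_act_star P.cmp_act_ident)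
    also have "\<dots> = cmp P (act1 P (idm P (q i v)) w) (act1 P (cmp P (act1 P (idm P (q i v)) (e i j k v \<odot> \<iota> (x i j v \<cdot> x j k v))) (s i k v)) (\<iota> b))"
      by (simp only: sR[OF that(1-6)])
    also have "\<dots> = cmp P (act1 P (idm P (q i v)) (w \<star> (e i j k v \<odot> \<iota> (x i j v \<cdot> x j k v \<cdot> b)))) (act1 P (s i k v) (\<iota> b))"
      by (subst P.idm_act_star) (simp_all add: P.cmp_assoc P.cmp_act_ident tgt_e)
    also have "\<dots> = F1 ((i, k), (v, e i j k v \<odot> w))"
      unfolding ew F1 tew ..
    also have "\<dots> = F1 (cmp Pc' ((i, j), (v, g)) ((j, k), (v, h)))"
      by (simp only: w_def Pc_simps)
    finally show ?thesis ..
  qed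
  have F: "G_functor G Pc' P F0 F1"
    unfolding G_functor_def Pc_simps(1,2)
  proof (intro conjI ballI impI)
    show "continuous_map (Pc_obtop G X \<U>) (ob_top P) F0"
      using continuous_map_id
    proof (rule Pc_ob_cases)
      fix i Z' v a
      assume h: "i \<in> \<U>" "continuous_map Z' X v" "continuous_map Z' (G0 G) a"
        "\<And>z. z \<in> topspace Z' \<Longrightarrow> id z = (i, (v z, a z)) \<and> v z \<in> i \<and> a z \<in> C0"
      show "continuous_map Z' (ob_top P) F0"
      proof (rule continuous_map_eq[where f = "\<lambda>z. act0 P (q i (v z)) (a z)"])
        show "continuous_map Z' (ob_top P) (\<lambda>z. act0 P (q i (v z)) (a z))"
          by (intro P.continuous_act qc') (use h in auto)
        show "act0 P (q i (v z)) (a z) = F0 z" if "z \<in> topspace Z'" for z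
          using h(4)[OF that] by (metis F0 id_apply)
      qed
    qed
    show "continuous_map (Pc_mortop G X \<U>) (mor_top P) F1"
      using continuous_map_id
    proof (rule Pc_mor_cases)
      fix i j Z' v g
      assume h: "i \<in> \<U>" "j \<in> \<U>" "continuous_map Z' X v" "continuous_map Z' (G1 G) g"
        "\<And>z. z \<in> topspace Z' \<Longrightarrow> id z = ((i, j), (v z, g z)) \<and> v z \<in> i \<and> v z \<in> j \<and> g z \<in> C1"
      show "continuous_map Z' (mor_top P) F1"
      proof (rule continuous_map_eq[where f = "\<lambda>z. cmp P (act1 P (idm P (q i (v z))) (g z)) (act1 P (s i j (v z)) (\<iota> (i0 (x i j (v z)) \<cdot> \<t> (g z))))"])
        show "continuous_map Z' (mor_top P) (\<lambda>z. cmp P (act1 P (idm P (q i (v z))) (g z)) (act1 P (s i j (v z)) (\<iota> (i0 (x i j (v z)) \<cdot> \<t> (g z)))))"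
          by (intro P.continuous_cmp P.continuous_act P.continuous_idm qc' sc' continuous_cocycle_rules) (use h in auto)
        show "cmp P (act1 P (idm P (q i (v z))) (g z)) (act1 P (s i j (v z)) (\<iota> (i0 (x i j (v z)) \<cdot> \<t> (g z)))) = F1 z" if "z \<in> topspace Z'" for z
          using h(5)[OF that] by (metis F1 id_apply)
      qed
    qed
    fix f assume f0: "f \<in> topspace (Pc_mortop G X \<U>)"
    then obtain i j v g where f: "f = ((i, j), (v, g))" "i \<in> \<U>" "j \<in> \<U>" "v \<in> i" "v \<in> j" "g \<in> C1" by (rule Pc_morE)
    show "P.\<d> (F1 f) = F0 (dom Pc' f)" "P.\<c> (F1 f) = F0 (cod Pc' f)" using f F1_cl[OF f(2-6)] by simp_all
    show "F1 (act1 Pc' f h) = act1 P (F1 f) h" if [simp]: "h \<in> C1" for h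
    proof -
      note [simp] = f
      \<comment> \<open>Splitting \<open>h\<close> this way matches the two factors of
        \<open>F1 f\<close>: the first is acted on by \<open>h\<close>, the second only by an
        identity.\<close>
      have "act1 P (F1 f) (h \<star> \<iota> (\<t> h)) = F1 (act1 Pc' f h)"
        unfolding f(1) F1 Pc_simps by (subst P.cmp_act) simp_all
      then show ?thesis by (simp add: star_ident)
    qed
    fix f' assume "f' \<in> topspace (Pc_mortop G X \<U>)"
    then obtain j' k v' g' where f': "f' = ((j', k), (v', g'))" "j' \<in> \<U>" "k \<in> \<U>" "v' \<in> j'" "v' \<in> k" "g' \<in> C1" by (rule Pc_morE)
    assume "cod Pc' f = dom Pc' f'"
    then have eq: "j' = j" "v' = v" "i0 (x i j v) \<cdot> \<t> g = \<s> g'" unfolding f(1) f'(1) by auto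
    show "F1 (cmp Pc' f f') = cmp P (F1 f) (F1 f')"
      using F1_cmp[OF f(2,3) f'(3) f(4,5) _ f(6) f'(6) eq(3)] f'(5) unfolding f(1) f'(1) eq(1,2) by blast
  next
    fix p assume p: "p \<in> topspace (Pc_obtop G X \<U>)"
    then obtain j v a where p': "p = (j, (v, a))" "j \<in> \<U>" "v \<in> j" "a \<in> C0" by (rule Pc_obE)
    show "F0 (act0 Pc' p y) = act0 P (F0 p) y" if "y \<in> C0" for y using p' that by simp
    show "F1 (idm Pc' p) = idm P (F0 p)"
    proof -
      define h where "h = \<epsilon> j v \<odot> \<iota> a"
      have id: "idm Pc' p = ((j, j), (v, h))" using p' by (simp add: h_def)
      have h: "h \<in> C1" "\<s> h = a" "i0 (x j j v) \<cdot> \<t> h = a" using p' by (simp_all add: h_def \<epsilon>)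
      have "cmp Pc' (idm Pc' p) (idm Pc' p) = idm Pc' p"
        using p Pc.P_closed(3)[of p] Pc.dom_cod_idm(1)[of p] by (intro Pc.cmp_idm(1)) simp_all
      then have idem: "cmp P (F1 ((j, j), (v, h))) (F1 ((j, j), (v, h))) = F1 ((j, j), (v, h))"
        using F1_cmp[of j j j v h h] h p' unfolding id by simp
      obtain f' where f': "inverse_pair P (F1 ((j, j), (v, h))) f'" using F1_cl(4)[of j j v h] h p' by blast
      have "F1 ((j, j), (v, h)) = idm P (F0 p)"
        using P.inverse_pair_idempotent[OF f' _ idem] F1_cl(2,3)[of j j v h] h p' by simp
      then show ?thesis by (simp only: id)
    qed
  qed
  moreover have "\<pi> (F0 p) = Pc_proj p" if "p \<in> topspace (Pc_obtop G X \<U>)" for p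
    using that by (rule Pc_obE) (simp add: over)
  ultimately show ?thesis unfolding bundle_morphism_def Pc_simps by blast
qed

end

text \<open>Pulling back along \<open>projr\<close> restricted to \<open>range Inr\<close> gives a
  space whose points are exactly the copies \<open>Inr p\<close>; the left summand contributes none,
  and \<open>Inr\<close> becomes a homeomorphism.\<close>

definition inr_topology :: "'p topology \<Rightarrow> ('q + 'p) topology" where
  "inr_topology T = pullback_topology (range Inr) projr T"

text \<open>Moves \<open>P\<^sub>c\<close> to the sum types that carry the intermediate bundle \<open>W\<close> of the theorem.\<close>
definition inr_space :: "('p0, 'p1, 'a, 'b) two_space \<Rightarrow> ('q0 + 'p0, 'q1 + 'p1, 'a, 'b) two_space" where
  "inr_space P = \<lparr> ob_top = inr_topology (ob_top P), mor_top = inr_topology (mor_top P),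
     dom = (\<lambda>f. Inr (dom P (projr f))), cod = (\<lambda>f. Inr (cod P (projr f))), idm = (\<lambda>p. Inr (idm P (projr p))),
     cmp = (\<lambda>f g. Inr (cmp P (projr f) (projr g))),
     act0 = (\<lambda>p x. Inr (act0 P (projr p) x)), act1 = (\<lambda>f g. Inr (act1 P (projr f) g)) \<rparr>"

lemma inr_space_simps [simp]:
  "ob_top (inr_space P) = inr_topology (ob_top P)" "mor_top (inr_space P) = inr_topology (mor_top P)"
  "dom (inr_space P) f = Inr (dom P (projr f))" "cod (inr_space P) f = Inr (cod P (projr f))"
  "idm (inr_space P) p = Inr (idm P (projr p))" "cmp (inr_space P) f g = Inr (cmp P (projr f) (projr g))"
  "act0 (inr_space P) p x = Inr (act0 P (projr p) x)" "act1 (inr_space P) f h = Inr (act1 P (projr f) h)"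
  by (simp_all add: inr_space_def)

lemma topspace_inr [simp]: "topspace (inr_topology T) = Inr ` topspace T"
  by (auto simp: inr_topology_def topspace_pullback_topology)

lemma continuous_into_inr: "continuous_map Z T f \<Longrightarrow> continuous_map Z (inr_topology T) (\<lambda>z. Inr (f z))"
  unfolding inr_topology_def by (rule continuous_map_pullback') (auto simp: o_def)

lemma continuous_projr: "continuous_map Z (inr_topology T) f \<Longrightarrow> continuous_map Z T (\<lambda>z. projr (f z))"
  by (rule continuous_map_compose_at[of "inr_topology T"])
    (use continuous_map_pullback[OF continuous_map_id, where A = "range Inr" and f = projr] in \<open>simp_all add: inr_topology_def o_def\<close>)

text \<open>Makes restriction to an open set commute with the passage to the copy, so that local
  trivialisations can be transported.\<close>

lemma subtopology_inr: "subtopology (inr_topology T) {w. projr w \<in> S} = inr_topology (subtopology T S)"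
  unfolding topology_eq
proof (intro allI iffI)
  fix W assume "openin (subtopology (inr_topology T) {w. projr w \<in> S}) W"
  then obtain U where "openin T U" "W = projr -` U \<inter> range Inr \<inter> {w. projr w \<in> S}"
    by (auto simp: openin_subtopology inr_topology_def openin_pullback_topology)
  then show "openin (inr_topology (subtopology T S)) W"
    unfolding inr_topology_def openin_pullback_topology openin_subtopology by (intro exI[of _ "U \<inter> S"]) auto
next
  fix W assume "openin (inr_topology (subtopology T S)) W"
  then obtain U where "openin T U" "W = projr -` (U \<inter> S) \<inter> range Inr"
    by (auto simp: openin_subtopology inr_topology_def openin_pullback_topology)
  then show "openin (subtopology (inr_topology T) {w. projr w \<in> S}) W"
    unfolding inr_topology_def openin_pullback_topology openin_subtopology
    by (intro exI[of _ "projr -` U \<inter> range Inr"]) auto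
qed

lemma restrict_inr_space: "restrict_space (inr_space P) (\<pi> \<circ> projr) U = inr_space (restrict_space P \<pi> U)"
  using subtopology_inr[of "ob_top P" "{p. \<pi> p \<in> U}"] subtopology_inr[of "mor_top P" "{f. \<pi> (dom P f) \<in> U}"]
  by (simp add: restrict_space_def inr_space_def)

lemma G_2space_inr:
  fixes P :: "('p0, 'p1, 'a, 'b) two_space"
  assumes "top_2group G" "G_2space G P"
  shows "G_2space G (inr_space P :: ('q0 + 'p0, 'q1 + 'p1, 'a, 'b) two_space)"
proof -
  interpret g2space G P using assms by unfold_locales
  let ?W = "inr_space P :: ('q0 + 'p0, 'q1 + 'p1, 'a, 'b) two_space"
  have id: "continuous_map T T (\<lambda>z. z)" for T :: "'z topology" by simp
  show ?thesis
  proof (rule G_2spaceI)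
    show "top_category (ob_top ?W) (mor_top ?W) (dom ?W) (cod ?W) (idm ?W) (cmp ?W)"
    proof (rule top_categoryI)
      show "continuous_map (mor_top ?W) (ob_top ?W) (dom ?W)"
        "continuous_map (mor_top ?W) (ob_top ?W) (cod ?W)"
        "continuous_map (ob_top ?W) (mor_top ?W) (idm ?W)"
        unfolding inr_space_def two_space.simps
        by (intro continuous_into_inr continuous_dom continuous_cod continuous_idm continuous_projr id)+
      fix Z :: "(('q1 + 'p1) \<times> ('q1 + 'p1)) topology" and f g
      assume "continuous_map Z (mor_top ?W) f" "continuous_map Z (mor_top ?W) g"
        "\<And>z. z \<in> topspace Z \<Longrightarrow> cod ?W (f z) = dom ?W (g z)"
      then show "continuous_map Z (mor_top ?W) (\<lambda>z. cmp ?W (f z) (g z))"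
        unfolding inr_space_simps by (intro continuous_into_inr continuous_cmp continuous_projr) auto
    qed (auto simp: cmp_assoc)
  qed (auto simp: idm_act cmp_act intro!: continuous_into_inr continuous_act continuous_projr continuous_map_fst continuous_map_snd)
qed

lemma G_functor_projr: "G_functor G (inr_space P) P projr projr"
  using continuous_projr[of "inr_topology (ob_top P)", OF continuous_map_id]
    continuous_projr[of "inr_topology (mor_top P)", OF continuous_map_id]
  by (auto simp: G_functor_def)

lemma G_functor_inr: "G_functor G P (inr_space P) Inr Inr"
  using continuous_into_inr[OF continuous_map_id, of "ob_top P"] continuous_into_inr[OF continuous_map_id, of "mor_top P"]
  by (auto simp: G_functor_def)

text \<open>The functors on the copy are prescribed only at values of \<open>Inr\<close>. So
  \<open>id\<close> qualifies as well as composites that pass through \<open>projr\<close>, although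
  the two kinds may differ elsewhere on the sum type.\<close>

lemma G0_nat_trans_inr:
  assumes "G0_nat_trans G P P F0 F1 F0' F1' \<alpha>"
    and "\<And>p. p \<in> topspace (ob_top P) \<Longrightarrow> H0 (Inr p) = Inr (F0 p) \<and> H0' (Inr p) = Inr (F0' p)"
    and "\<And>f. f \<in> topspace (mor_top P) \<Longrightarrow> H1 (Inr f) = Inr (F1 f) \<and> H1' (Inr f) = Inr (F1' f)"
  shows "G0_nat_trans G (inr_space P) (inr_space P) H0 H1 H0' H1' (\<lambda>p. Inr (\<alpha> (projr p)))"
  using assms continuous_into_inr[OF continuous_map_compose_at[OF G0_nat_transD(1)[OF assms(1)] continuous_projr[OF continuous_map_id]]]
  by (auto simp: G0_nat_trans_def)

lemma G_equiv_over_inr: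
  assumes "G_equiv_over G P \<pi> Q \<rho>"
  shows "G_equiv_over G (inr_space P) (\<pi> \<circ> projr) Q \<rho>"
proof -
  obtain \<phi>0 \<phi>1 \<psi>0 \<psi>1 where \<phi>: "G_functor G P Q \<phi>0 \<phi>1" and \<psi>: "G_functor G Q P \<psi>0 \<psi>1"
    and over: "\<forall>p\<in>topspace (ob_top P). \<rho> (\<phi>0 p) = \<pi> p" "\<forall>q\<in>topspace (ob_top Q). \<pi> (\<psi>0 q) = \<rho> q"
    and P: "G0_nat_iso G P P (\<psi>0 \<circ> \<phi>0) (\<psi>1 \<circ> \<phi>1) id id" and Q: "G0_nat_iso G Q Q (\<phi>0 \<circ> \<psi>0) (\<phi>1 \<circ> \<psi>1) id id"
    using assms unfolding G_equiv_over_def by blast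
  obtain \<alpha> \<beta> where \<alpha>: "G0_nat_trans G P P (\<psi>0 \<circ> \<phi>0) (\<psi>1 \<circ> \<phi>1) id id \<alpha>" and \<beta>: "G0_nat_trans G P P id id (\<psi>0 \<circ> \<phi>0) (\<psi>1 \<circ> \<phi>1) \<beta>"
    and \<alpha>\<beta>: "\<forall>p\<in>topspace (ob_top P). cmp P (\<alpha> p) (\<beta> p) = idm P ((\<psi>0 \<circ> \<phi>0) p) \<and> cmp P (\<beta> p) (\<alpha> p) = idm P (id p)"
    using P unfolding G0_nat_iso_def by blast
  show ?thesis
    unfolding G_equiv_over_def
  proof (intro exI conjI)
    show "G_functor G (inr_space P) Q (\<phi>0 \<circ> projr) (\<phi>1 \<circ> projr)" by (rule G_functor_comp[OF G_functor_projr \<phi>])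
    show "G_functor G Q (inr_space P) (Inr \<circ> \<psi>0) (Inr \<circ> \<psi>1)" by (rule G_functor_comp[OF \<psi> G_functor_inr])
    show "\<forall>p\<in>topspace (ob_top (inr_space P)). \<rho> ((\<phi>0 \<circ> projr) p) = (\<pi> \<circ> projr) p" using over by auto
    show "\<forall>q\<in>topspace (ob_top Q). (\<pi> \<circ> projr) ((Inr \<circ> \<psi>0) q) = \<rho> q" using over by auto
    show "G0_nat_iso G (inr_space P) (inr_space P) ((Inr \<circ> \<psi>0) \<circ> (\<phi>0 \<circ> projr)) ((Inr \<circ> \<psi>1) \<circ> (\<phi>1 \<circ> projr)) id id"
      unfolding G0_nat_iso_def
      using \<alpha>\<beta>
      by (intro exI[of _ "\<lambda>p. Inr (\<alpha> (projr p))"] exI[of _ "\<lambda>p. Inr (\<beta> (projr p))"] conjI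
          G0_nat_trans_inr[OF \<alpha>] G0_nat_trans_inr[OF \<beta>]) auto
    show "G0_nat_iso G Q Q ((\<phi>0 \<circ> projr) \<circ> (Inr \<circ> \<psi>0)) ((\<phi>1 \<circ> projr) \<circ> (Inr \<circ> \<psi>1)) id id"
      using Q by (simp add: o_def)
  qed
qed

lemma principal_bundle_inr:
  assumes "top_2group G" and b: "principal_bundle G X P \<pi>"
  shows "principal_bundle G X (inr_space P) (\<pi> \<circ> projr)"
proof -
  obtain \<U> where \<U>: "open_cover X \<U>" "\<forall>U\<in>\<U>. G_equiv_over G (restrict_space P \<pi> U) \<pi> (trivial_space G X U) fst"
    and P: "G_2space G P" "functor_to_discrete X P \<pi>" "\<forall>p\<in>topspace (ob_top P). \<forall>x\<in>topspace (G0 G). \<pi> (act0 P p x) = \<pi> p"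
    using b unfolding principal_bundle_def by blast
  have "\<forall>U\<in>\<U>. G_equiv_over G (restrict_space (inr_space P) (\<pi> \<circ> projr) U) (\<pi> \<circ> projr) (trivial_space G X U) fst"
    using \<U>(2) by (simp add: restrict_inr_space G_equiv_over_inr)
  moreover have "functor_to_discrete X (inr_space P) (\<pi> \<circ> projr)"
    using P(2) continuous_map_compose_at[of "ob_top P" X \<pi> "inr_topology (ob_top P)", OF _ continuous_projr[OF continuous_map_id]]
    by (auto simp: functor_to_discrete_def o_def)
  ultimately show ?thesis
    unfolding principal_bundle_def using \<U>(1) P(3) G_2space_inr[OF assms(1) P(1)] by auto
qed

text \<open>The intermediate bundle is the copy of \<open>P_c\<close> in the sum types. One leg is
  \<open>projr\<close> back to \<open>P_c\<close>, the other is \<open>projr\<close> followed by the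
  morphism from \<open>P_c\<close> to \<open>P\<close> that the comparisons define.\<close>

lemma principal_bundle_equiv_Pc:
  fixes G :: "('a, 'b) two_group" and X :: "'x topology" and P :: "('p0, 'p1, 'a, 'b) two_space"
  assumes G: "top_2group G" and P: "principal_bundle G X P \<pi>"
  shows "\<exists>\<U> c (W :: ('p0 + ('x, 'a) Pc_ob, 'p1 + ('x, 'b) Pc_mor, 'a, 'b) two_space) \<omega>.
     open_cover X \<U> \<and> cech_cocycle G X \<U> c \<and> bundle_equiv_via G X W \<omega> (Pc G X \<U> c) Pc_proj P \<pi>"
proof -
  interpret g2space G P using G P by unfold_locales (simp_all add: principal_bundle_def)
  define \<U> where "\<U> = {U. openin X U \<and> (\<exists>q. chart_section G X P \<pi> U q)}"
  have "\<exists>U\<in>\<U>. u \<in> U" if "u \<in> topspace X" for u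
    using principal_bundle_chart_section[OF G P that] unfolding \<U>_def by blast
  moreover have "openin X U" if "U \<in> \<U>" for U using that by (simp add: \<U>_def)
  ultimately have \<U>: "open_cover X \<U>"
    unfolding open_cover_def by (meson UnionE UnionI openin_subset subsetD subsetI subset_antisym)
  have "\<forall>U\<in>\<U>. \<exists>q. chart_section G X P \<pi> U q" by (simp add: \<U>_def)
  then obtain q where q: "\<And>U. U \<in> \<U> \<Longrightarrow> chart_section G X P \<pi> U (q U)" by metis
  obtain c s where td: "transition_data G X P \<U> q c s" using transition_data_exists[OF q] by blast
  obtain x e where c: "c = (x, e)" by (cases c)
  interpret C: cocycle G X \<U> x e
    using \<U> td unfolding c by unfold_locales (simp_all add: transition_data_def)
  have "bundle_morphism G C.Pc' Pc_proj P \<pi>"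
    by (rule C.transition_functor[OF G_2space q]) (use P td c in \<open>auto simp: principal_bundle_def\<close>)
  then obtain F0 F1 where F: "G_functor G C.Pc' P F0 F1" "\<forall>p\<in>topspace (ob_top C.Pc'). \<pi> (F0 p) = Pc_proj p"
    unfolding bundle_morphism_def by blast
  let ?W = "inr_space C.Pc' :: ('p0 + ('x, 'a) Pc_ob, 'p1 + ('x, 'b) Pc_mor, 'a, 'b) two_space"
  have "bundle_morphism G ?W (Pc_proj \<circ> projr) C.Pc' Pc_proj"
    unfolding bundle_morphism_def by (intro exI conjI, rule G_functor_projr) simp
  moreover have "bundle_morphism G ?W (Pc_proj \<circ> projr) P \<pi>"
    unfolding bundle_morphism_def
    by (intro exI conjI, rule G_functor_comp[OF G_functor_projr F(1)]) (use F(2) in auto)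
  ultimately have "bundle_equiv_via G X ?W (Pc_proj \<circ> projr) C.Pc' Pc_proj P \<pi>"
    unfolding bundle_equiv_via_def
    using P C.Pc_principal_bundle principal_bundle_inr[OF G C.Pc_principal_bundle] by blast
  then show ?thesis using \<U> C.cech_cocycle unfolding c by blast
qed

text \<open>Surjectivity and injectivity are expressed on representatives. The bundle
  \<open>W\<close> that has to exist lives on sum types with room for a copy of \<open>P_c\<close>;
  the bundle \<open>W\<close> that is given may live on any types.\<close>

theorem theorem11:
  fixes G :: "('a, 'b) two_group" and X :: "'x topology"
  assumes "top_2group G"
  shows "(\<forall>(P :: ('p0, 'p1, 'a, 'b) two_space) \<pi>. principal_bundle G X P \<pi> \<longrightarrow>
            (\<exists>\<U> c (W :: ('p0 + ('x, 'a) Pc_ob, 'p1 + ('x, 'b) Pc_mor, 'a, 'b) two_space) \<omega>.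
               open_cover X \<U> \<and> cech_cocycle G X \<U> c \<and>
               bundle_equiv_via G X W \<omega> (Pc G X \<U> c) Pc_proj P \<pi>))
       \<and> (admits_good_covers X \<longrightarrow>
            (\<forall>\<U> c \<U>' c' (W :: ('w0, 'w1, 'a, 'b) two_space) \<omega>.
               open_cover X \<U> \<and> cech_cocycle G X \<U> c \<and> open_cover X \<U>' \<and> cech_cocycle G X \<U>' c' \<and>
               bundle_equiv_via G X W \<omega> (Pc G X \<U> c) Pc_proj (Pc G X \<U>' c') Pc_proj \<longrightarrow>
               cech_colim_eq G X \<U> c \<U>' c'))"
  using principal_bundle_equiv_Pc[OF assms] bundle_equiv_imp_colim_eq[OF assms] by blast

end
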